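(* Assume that $u\in H^1_+\cap L^2_s$ for some $s>\frac12$. (1) For every $k\in \mathbb{C}^+\cup\mathbb{C}^-\cup\big((-\infty,0)\setminus\sigma_{pp}(\mathbb{L}_u)\big)$ there exists a unique function $\phi_k\in H^1_+\cap L^\infty_{-s}$ such that $\mathbb{L}_u\phi_k=k\phi_k+u$. (2) For every $\lambda\in(0,+\infty)\setminus\sigma_{pp}(\mathbb{L}_u)$ there exist unique functions $\phi_\lambda^+,\phi_\lambda^-\in L^\infty_{-s}$ such that $\mathbb{L}_u\phi_\lambda^\pm=\lambda\phi_\lambda^\pm+u$, $\lim_{x\to-\infty}\phi_\lambda^+(x)=0$, and $\lim_{x\to+\infty}\phi_\lambda^-(x)=0$.
   Context: All functions are complex valued on $\mathbb{R}$. $\hat f(\xi)=\int_{\mathbb{R}} f(x)e^{-ix\xi}\,dx$. $H^\sigma_+=\{f\in H^\sigma(\mathbb{R};\mathbb{C}):\mathrm{supp}\,\hat f\subset[0,+\infty)\}$ for $\sigma\ge0$, and $L^2_+=H^0_+$. $\Pi:L^2\to L^2$ is the Cauchy-Szegő projector, $\widehat{\Pi f}(\xi)=\mathbf{1}_{\xi\ge0}\hat f(\xi)$. $\langle x\rangle=\sqrt{1+x^2}$. $L^2_s=\{f:\int_{\mathbb{R}}|f(x)|^2(1+x^2)^s\,dx<\infty\}$. $L^\infty_{-s}=\{f:\|f\|_{L^\infty_{-s}}=\|\langle x\rangle^{-s}f\|_{L^\infty}<\infty\}$. $\mathbb{C}^\pm=\{z\in\mathbb{C}:\pm\mathrm{Im}\,z>0\}$.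 For $u\in H^1_+$ the Lax operator is $\mathbb{L}_u h=-i\partial_xh-u\Pi(\overline u h)$, an unbounded self-adjoint operator on $L^2_+$ with domain $H^1_+$; $\sigma_{pp}(\mathbb{L}_u)$ is its set of eigenvalues. If $u\in L^2_s$ and $h\in L^\infty_{-s}$, then $\overline u h\in L^2$ and $\mathbb{L}_u h$ is defined by the same formula, in the sense of distributions. *)

theory Defs
  imports "HOL-Probability.Essential_Supremum"
begin

text \<open>
  Elements of Lebesgue spaces are represented by Borel functions on the real line, and equality in
  those spaces is equality almost everywhere with respect to \<^term>\<open>lborel\<close>.
\<close>

definition L2 :: "(real \<Rightarrow> complex) set" where
  "L2 = {f. f \<in> borel_measurable borel \<and> integrable lborel (\<lambda>x. (cmod (f x))\<^sup>2)}"

text \<open>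
  The integral defining the Fourier transform need not converge for square integrable functions;
  as usual, the transform is the limit in mean of the truncated integrals.  It is determined up to
  null sets, whence the choice of a representative.  The nonnegative integral is used because the
  Bochner integral of a non-integrable function is 0.
\<close>

definition has_L2_fourier :: "(real \<Rightarrow> complex) \<Rightarrow> (real \<Rightarrow> complex) \<Rightarrow> bool" where
  "has_L2_fourier f F \<longleftrightarrow> f \<in> L2 \<and> F \<in> L2 \<and>
     ((\<lambda>R::real. \<integral>\<^sup>+\<xi>. ennreal ((cmod
          ((LINT x:{-R..R}|lborel. f x * exp (- (\<i> * of_real (x * \<xi>)))) - F \<xi>))\<^sup>2) \<partial>lborel)
        \<longlongrightarrow> 0) at_top"

definition L2_fourier :: "(real \<Rightarrow> complex) \<Rightarrow> real \<Rightarrow> complex" where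
  "L2_fourier f = (SOME F. has_L2_fourier f F)"

definition sobolev :: "real \<Rightarrow> (real \<Rightarrow> complex) set" where
  "sobolev \<sigma> = {f \<in> L2. integrable lborel (\<lambda>\<xi>. (1 + \<xi>\<^sup>2) powr \<sigma> * (cmod (L2_fourier f \<xi>))\<^sup>2)}"

text \<open>The support of a class of functions is contained in the closed half-line \<^term>\<open>{0::real..}\<close>
  iff the functions vanish almost everywhere on its complement.\<close>

definition hardy_sobolev :: "real \<Rightarrow> (real \<Rightarrow> complex) set" where
  "hardy_sobolev \<sigma> = {f \<in> sobolev \<sigma>. AE \<xi> in lborel. \<xi> < 0 \<longrightarrow> L2_fourier f \<xi> = 0}"

definition szego :: "(real \<Rightarrow> complex) \<Rightarrow> real \<Rightarrow> complex" where
  "szego f = (SOME g. g \<in> L2 \<and>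
     (AE \<xi> in lborel. L2_fourier g \<xi> = indicator {0..} \<xi> * L2_fourier f \<xi>))"

definition L2_weighted :: "real \<Rightarrow> (real \<Rightarrow> complex) set" where
  "L2_weighted s = {f \<in> borel_measurable borel.
     integrable lborel (\<lambda>x. (cmod (f x))\<^sup>2 * (1 + x\<^sup>2) powr s)}"

definition japanese :: "real \<Rightarrow> real" where
  "japanese x = sqrt (1 + x\<^sup>2)"

text \<open>\<^term>\<open>Linf_weighted r\<close> consists of the functions with a bounded product with the
  \<^term>\<open>r\<close>-th power of the Japanese bracket; the exponent is meant to be negative below.\<close>

definition Linf_weighted :: "real \<Rightarrow> (real \<Rightarrow> complex) set" where
  "Linf_weighted r = {f \<in> borel_measurable borel.
     esssup lborel (\<lambda>x. ereal (cmod (of_real (japanese x powr r) * f x))) < \<infinity>}"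

definition test_functions :: "(real \<Rightarrow> complex) set" where
  "test_functions = {\<psi>. bounded {x. \<psi> x \<noteq> 0} \<and>
     (\<forall>n x. ((\<lambda>g y. vector_derivative g (at y)) ^^ n) \<psi> differentiable (at x))}"

text \<open>Distributions are treated as functionals that are only evaluated at test functions.\<close>

type_synonym distr = "(real \<Rightarrow> complex) \<Rightarrow> complex"

definition distr_of :: "(real \<Rightarrow> complex) \<Rightarrow> distr" where
  "distr_of f \<psi> = (LINT x|lborel. f x * \<psi> x)"

definition distr_deriv :: "distr \<Rightarrow> distr" where
  "distr_deriv T \<psi> = - T (\<lambda>x. vector_derivative \<psi> (at x))"

definition distr_eq :: "distr \<Rightarrow> distr \<Rightarrow> bool" where
  "distr_eq S T \<longleftrightarrow> (\<forall>\<psi>\<in>test_functions. S \<psi> = T \<psi>)"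

definition lax :: "(real \<Rightarrow> complex) \<Rightarrow> (real \<Rightarrow> complex) \<Rightarrow> distr" where
  "lax u h \<psi> = - \<i> * distr_deriv (distr_of h) \<psi>
     - distr_of (\<lambda>x. u x * szego (\<lambda>y. cnj (u y) * h y) x) \<psi>"

text \<open>On the domain \<^term>\<open>hardy_sobolev 1\<close> the distributional derivative is square integrable, so
  the eigenvalue equation between square integrable functions is its distributional version.\<close>

definition sigma_pp :: "(real \<Rightarrow> complex) \<Rightarrow> complex set" where
  "sigma_pp u = {k. \<exists>h \<in> hardy_sobolev 1. \<not> (AE x in lborel. h x = 0) \<and>
     distr_eq (lax u h) (distr_of (\<lambda>x. k * h x))}"

definition ex1_AE :: "((real \<Rightarrow> complex) \<Rightarrow> bool) \<Rightarrow> bool" where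
  "ex1_AE P \<longleftrightarrow> (\<exists>f. P f \<and> (\<forall>g. P g \<longrightarrow> (AE x in lborel. g x = f x)))"

text \<open>
  A class of functions tends to 0 at an end of the line iff one of its representatives does so
  pointwise.  Inside \<^term>\<open>ex1_AE\<close>, a pointwise limit therefore gives existence and uniqueness
  of the class with this limit.
\<close>

end

theory Submission
  imports Defs "HOL-Probability.Probability" "HOL-Computational_Algebra.Polynomial"
begin

text \<open>
  With \<open>h = \<Pi>(cnj u \<phi>)\<close> the equation becomes \<open>- \<i> \<phi>' - k \<phi> = u (1 + h)\<close>, whose solution vanishing at one
  end of the line is given by a half-line resolvent \<open>R\<close>; hence \<open>h\<close> solves a fixed point equation
  \<open>h = g + A h\<close> with \<open>A h = \<Pi>(cnj u R(u h))\<close>, and every solution with the required side condition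
  arises in this way.  \<open>A\<close> is a norm limit of finite rank operators because \<open>R\<close> is, up to a small
  error, a propagation from the end points of a fine partition, so the Fredholm alternative reduces
  everything to \<open>A h = h \<Longrightarrow> h = 0\<close>.  For non-real \<open>k\<close> this is the symmetry of the Lax operator.  For
  real \<open>k\<close> the pairing of \<open>u h\<close> with \<open>\<phi> = R(u h)\<close> is real, so the flux of \<open>\<phi>\<close> through the other end of
  the line is zero; then \<open>\<phi>\<close> is bounded by the tail integrals of \<open>u h\<close>, hence by a multiple of
  \<open>(1 + x\<^sup>2) powr (- s / 2)\<close>, and lies in \<open>L\<^sup>2\<close> because \<open>s > 1/2\<close>.  Thus \<open>\<phi>\<close> is an eigenfunction unless it
  vanishes.
\<close>

subsection \<open>Square integrable functions\<close>

text \<open>The unknown is \<open>h\<close> and not the solution because for positive real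
  \<open>k\<close> the solution is in general only bounded, and the resolvent of -i d/dx does not
  act on L^2. The map h |-> cnj u R(u h) does: \<open>u h\<close> is integrable, \<open>R\<close>
  turns it into a bounded function, and the second factor brings it back to L^2. Finite rank
  approximation rests on the multiplicativity of exp(i k (x - y)): beyond a point p, what was
  collected before p only gets multiplied by exp(i k (x - p)), so the error on a cell is the mass of
  \<open>u h\<close> in that cell. The end of the line from which \<open>R\<close> integrates is
  dictated by the sign of Im k, since the kernel has to stay bounded; for real k both ends are
  allowed, which yields the two solutions of part (2). Two solutions of the first order equation
  differ by a multiple of exp(i k x), which is excluded by membership in L^2 in part (1) and by the
  limit in part (2). The pairing in the flux argument is real because it is the quadratic form of
  the orthogonal projector at cnj u \<phi>. The condition s > 1/2 also makes \<open>u\<close>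
  integrable.\<close>

lemma borel_measurable_cnj [measurable (raw)]:
  "f \<in> borel_measurable M \<Longrightarrow> (\<lambda>x. cnj (f x)) \<in> borel_measurable M"
  by (rule borel_measurable_continuous_on[OF continuous_on_cnj[OF continuous_on_id]])

lemma L2_measurable [measurable_dest]: "f \<in> L2 \<Longrightarrow> f \<in> borel_measurable borel"
  by (simp add: L2_def)

lemma L2_integrable_square: "f \<in> L2 \<Longrightarrow> integrable lborel (\<lambda>x. (cmod (f x))\<^sup>2)"
  by (simp add: L2_def)

lemma L2_dominated:
  assumes "f \<in> borel_measurable borel" "integrable lborel g"
    and "AE x in lborel. (cmod (f x))\<^sup>2 \<le> g x"
  shows "f \<in> L2"
  unfolding L2_def
proof (safe intro!: assms)
  show "integrable lborel (\<lambda>x. (cmod (f x))\<^sup>2)"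
  proof (rule Bochner_Integration.integrable_bound[OF assms(2)])
    show "(\<lambda>x. (cmod (f x))\<^sup>2) \<in> borel_measurable lborel"
      using assms(1) by measurable
    show "AE x in lborel. norm ((cmod (f x))\<^sup>2) \<le> norm (g x)"
      using assms(3) by eventually_elim auto
  qed
qed

lemma L2_nn_finite:
  assumes "f \<in> borel_measurable borel" "(\<integral>\<^sup>+x. ennreal ((cmod (f x))\<^sup>2) \<partial>lborel) < \<infinity>"
  shows "f \<in> L2"
  using assms unfolding L2_def
  by (auto intro!: integrableI_nonneg)

lemma L2_nn_eq:
  assumes "f \<in> L2"
  shows "(\<integral>\<^sup>+x. ennreal ((cmod (f x))\<^sup>2) \<partial>lborel) = ennreal (LINT x|lborel. (cmod (f x))\<^sup>2)"
  using L2_integrable_square[OF assms] by (intro nn_integral_eq_integral) auto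

lemma L2_bounded_mult:
  assumes "f \<in> L2" "m \<in> borel_measurable borel" "AE x in lborel. cmod (m x) \<le> C"
  shows "(\<lambda>x. m x * f x) \<in> L2"
proof (rule L2_dominated)
  show "integrable lborel (\<lambda>x. C\<^sup>2 * (cmod (f x))\<^sup>2)"
    using L2_integrable_square[OF assms(1)] by simp
  show "AE x in lborel. (cmod (m x * f x))\<^sup>2 \<le> C\<^sup>2 * (cmod (f x))\<^sup>2"
    using assms(3)
    by eventually_elim (auto simp: norm_mult power_mult_distrib intro!: mult_right_mono power_mono)
  show "(\<lambda>x. m x * f x) \<in> borel_measurable borel"
    using assms(1,2) by measurable
qed

lemma L2_zero [simp]: "(\<lambda>x. 0) \<in> L2"
  by (simp add: L2_def)

lemma L2_cmult: "f \<in> L2 \<Longrightarrow> (\<lambda>x. c * f x) \<in> L2"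
  by (rule L2_bounded_mult[where C = "cmod c"]) auto

lemma L2_cnj: "f \<in> L2 \<Longrightarrow> (\<lambda>x. cnj (f x)) \<in> L2"
  by (auto simp: L2_def)

lemma L2_add:
  assumes "f \<in> L2" "g \<in> L2"
  shows "(\<lambda>x. f x + g x) \<in> L2"
proof (rule L2_dominated)
  show "integrable lborel (\<lambda>x. 2 * (cmod (f x))\<^sup>2 + 2 * (cmod (g x))\<^sup>2)"
    using assms by (auto simp: L2_def)
  have "(cmod (f x + g x))\<^sup>2 \<le> 2 * (cmod (f x))\<^sup>2 + 2 * (cmod (g x))\<^sup>2" for x
  proof -
    have "(cmod (f x + g x))\<^sup>2 \<le> (cmod (f x) + cmod (g x))\<^sup>2"
      by (intro power_mono norm_triangle_ineq) auto
    also have "\<dots> \<le> 2 * (cmod (f x))\<^sup>2 + 2 * (cmod (g x))\<^sup>2"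
      using sum_squares_bound[of "cmod (f x)" "cmod (g x)"] by (simp add: power2_sum)
    finally show ?thesis .
  qed
  then show "AE x in lborel. (cmod (f x + g x))\<^sup>2 \<le> 2 * (cmod (f x))\<^sup>2 + 2 * (cmod (g x))\<^sup>2"
    by simp
  show "(\<lambda>x. f x + g x) \<in> borel_measurable borel"
    using assms by measurable
qed

lemma L2_diff: "f \<in> L2 \<Longrightarrow> g \<in> L2 \<Longrightarrow> (\<lambda>x. f x - g x) \<in> L2"
  using L2_add[of f "\<lambda>x. -1 * g x"] L2_cmult[of g "-1"] by simp

lemma L2_mult_integrable:
  assumes "f \<in> L2" "g \<in> L2"
  shows "integrable lborel (\<lambda>x. f x * g x)"
proof (rule Bochner_Integration.integrable_bound)
  show "integrable lborel (\<lambda>x. (cmod (f x))\<^sup>2 + (cmod (g x))\<^sup>2)"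
    using assms by (auto simp: L2_def)
  show "(\<lambda>x. f x * g x) \<in> borel_measurable lborel"
    using assms by measurable
  have "cmod (f x * g x) \<le> (cmod (f x))\<^sup>2 + (cmod (g x))\<^sup>2" for x
  proof -
    have "cmod (f x) * cmod (g x) \<ge> 0" by simp
    then show ?thesis
      using sum_squares_bound[of "cmod (f x)" "cmod (g x)"] unfolding norm_mult by linarith
  qed
  then show "AE x in lborel. norm (f x * g x) \<le> norm ((cmod (f x))\<^sup>2 + (cmod (g x))\<^sup>2)"
    by (auto intro!: AE_I2 order_trans[OF _ abs_ge_self])
qed

lemma L2_cong_AE:
  assumes "f \<in> L2" "g \<in> borel_measurable borel" "AE x in lborel. f x = g x"
  shows "g \<in> L2"
  by (rule L2_dominated[OF assms(2) L2_integrable_square[OF assms(1)]])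
     (use assms(3) in \<open>eventually_elim, simp\<close>)

subsection \<open>The Hilbert space of classes of square integrable functions\<close>

\<comment> \<open>The relation is partial: only square integrable functions have a class. Passing to
  classes makes the norm definite, so that the Banach fixed point theorem behind the Fredholm
  alternative becomes available.\<close>
quotient_type l2 = "real \<Rightarrow> complex" / partial:
    "\<lambda>f g. f \<in> L2 \<and> g \<in> L2 \<and> (AE x in lborel. f x = g x)"
  morphisms l2_fun l2_cls
proof (rule part_equivpI)
  show "\<exists>x. x \<in> L2 \<and> x \<in> L2 \<and> (AE y in lborel. x y = x y)"
    by (rule exI[of _ "\<lambda>_. 0"]) simp
  show "symp (\<lambda>f g. f \<in> L2 \<and> g \<in> L2 \<and> (AE x in lborel. f x = g x))"
    by (auto intro!: sympI elim!: eventually_mono)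
  show "transp (\<lambda>f g. f \<in> L2 \<and> g \<in> L2 \<and> (AE x in lborel. f x = g x))"
  proof (rule transpI, elim conjE, intro conjI)
    fix x y z :: "real \<Rightarrow> complex"
    assume "AE a in lborel. x a = y a" "AE a in lborel. y a = z a"
    then show "AE a in lborel. x a = z a" by eventually_elim simp
  qed
qed

lemma l2_fun_L2 [simp]: "l2_fun a \<in> L2"
  using Quotient3_rep_reflp[OF Quotient3_l2] by blast

lemma l2_fun_measurable [measurable]: "l2_fun a \<in> borel_measurable borel"
  using l2_fun_L2 by (rule L2_measurable)

lemma l2_cls_fun [simp]: "l2_cls (l2_fun a) = a"
  by (rule Quotient3_abs_rep[OF Quotient3_l2])

lemma l2_cls_eq: "f \<in> L2 \<Longrightarrow> g \<in> L2 \<Longrightarrow> AE x in lborel. f x = g x \<Longrightarrow> l2_cls f = l2_cls g"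
  by (rule Quotient3_rel_abs[OF Quotient3_l2]) simp

lemma l2_cls_eqD: "l2_cls f = l2_cls g \<Longrightarrow> f \<in> L2 \<Longrightarrow> g \<in> L2 \<Longrightarrow> AE x in lborel. f x = g x"
  using Quotient3_rel[OF Quotient3_l2, of f g] by auto

lemma l2_fun_cls: "f \<in> L2 \<Longrightarrow> AE x in lborel. l2_fun (l2_cls f) x = f x"
  by (rule l2_cls_eqD) auto

lemma l2_eqI: "(AE x in lborel. l2_fun a x = l2_fun b x) \<Longrightarrow> a = b"
  using l2_cls_eq[of "l2_fun a" "l2_fun b"] by simp

text \<open>Only real scalars belong to the structure. Multiplication by a complex number c is the
  bounded real-linear operator \<open>l2_mul (\<lambda>_. c)\<close>, and complex homogeneity is
  stated separately where it matters.\<close>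

instantiation l2 :: real_vector
begin

definition zero_l2 where "0 = l2_cls (\<lambda>x. 0)"
definition plus_l2 where "a + b = l2_cls (\<lambda>x. l2_fun a x + l2_fun b x)"
definition minus_l2 where "a - b = l2_cls (\<lambda>x. l2_fun a x - l2_fun b x)"
definition uminus_l2 where "- a = l2_cls (\<lambda>x. -1 * l2_fun a x)"
definition scaleR_l2 where "r *\<^sub>R a = l2_cls (\<lambda>x. of_real r * l2_fun a x)"

lemma l2_fun_zero: "AE x in lborel. l2_fun 0 x = 0"
  unfolding zero_l2_def by (rule l2_fun_cls) simp
lemma l2_fun_plus: "AE x in lborel. l2_fun (a + b) x = l2_fun a x + l2_fun b x"
  unfolding plus_l2_def by (intro l2_fun_cls L2_add) auto
lemma l2_fun_minus: "AE x in lborel. l2_fun (a - b) x = l2_fun a x - l2_fun b x"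
  unfolding minus_l2_def by (intro l2_fun_cls L2_diff) auto
lemma l2_fun_uminus: "AE x in lborel. l2_fun (- a) x = - l2_fun a x"
  using l2_fun_cls[of "\<lambda>x. -1 * l2_fun a x"] L2_cmult[of "l2_fun a" "-1"]
  unfolding uminus_l2_def by simp
lemma l2_fun_scaleR: "AE x in lborel. l2_fun (r *\<^sub>R a) x = of_real r * l2_fun a x"
  unfolding scaleR_l2_def by (intro l2_fun_cls L2_cmult) auto

instance
proof
  fix a b c :: l2 and r t :: real
  show "a + b + c = a + (b + c)"
    by (rule l2_eqI, use l2_fun_plus[of "a+b" c] l2_fun_plus[of a b] l2_fun_plus[of a "b+c"] l2_fun_plus[of b c] in \<open>eventually_elim, simp\<close>)
  show "a + b = b + a"
    by (rule l2_eqI, use l2_fun_plus[of a b] l2_fun_plus[of b a] in \<open>eventually_elim, simp\<close>)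
  show "0 + a = a"
    by (rule l2_eqI, use l2_fun_plus[of 0 a] l2_fun_zero in \<open>eventually_elim, simp\<close>)
  show "- a + a = 0"
    by (rule l2_eqI, use l2_fun_plus[of "-a" a] l2_fun_uminus[of a] l2_fun_zero in \<open>eventually_elim, simp\<close>)
  show "a - b = a + - b"
    by (rule l2_eqI, use l2_fun_plus[of a "-b"] l2_fun_uminus[of b] l2_fun_minus[of a b] in \<open>eventually_elim, simp\<close>)
  show "r *\<^sub>R (a + b) = r *\<^sub>R a + r *\<^sub>R b"
    by (rule l2_eqI, use l2_fun_scaleR[of r "a+b"] l2_fun_plus[of a b] l2_fun_plus[of "r *\<^sub>R a" "r *\<^sub>R b"]
      l2_fun_scaleR[of r a] l2_fun_scaleR[of r b] in \<open>eventually_elim, simp add: algebra_simps\<close>)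
  show "(r + t) *\<^sub>R a = r *\<^sub>R a + t *\<^sub>R a"
    by (rule l2_eqI, use l2_fun_scaleR[of "r+t" a] l2_fun_plus[of "r *\<^sub>R a" "t *\<^sub>R a"]
      l2_fun_scaleR[of r a] l2_fun_scaleR[of t a] in \<open>eventually_elim, simp add: algebra_simps\<close>)
  show "r *\<^sub>R t *\<^sub>R a = (r * t) *\<^sub>R a"
    by (rule l2_eqI, use l2_fun_scaleR[of "r*t" a] l2_fun_scaleR[of r "t *\<^sub>R a"] l2_fun_scaleR[of t a] in \<open>eventually_elim, simp add: algebra_simps\<close>)
  show "1 *\<^sub>R a = a"
    by (rule l2_eqI, use l2_fun_scaleR[of 1 a] in \<open>eventually_elim, simp add: algebra_simps\<close>)
qed

end

lemma l2_pair_integrable: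
  "integrable lborel (\<lambda>x. l2_fun a x * l2_fun b x)"
  "integrable lborel (\<lambda>x. l2_fun a x * cnj (l2_fun b x))"
  by (intro L2_mult_integrable L2_cnj; simp)+

instantiation l2 :: real_inner
begin

definition inner_l2 :: "l2 \<Rightarrow> l2 \<Rightarrow> real"
  where "inner_l2 a b = (LINT x|lborel. Re (l2_fun a x * cnj (l2_fun b x)))"
definition norm_l2 :: "l2 \<Rightarrow> real" where "norm_l2 a = sqrt (inner a a)"
definition dist_l2 :: "l2 \<Rightarrow> l2 \<Rightarrow> real" where "dist_l2 a b = norm (a - b)"
definition sgn_l2 :: "l2 \<Rightarrow> l2" where "sgn_l2 a = a /\<^sub>R norm a"
definition uniformity_l2 :: "(l2 \<times> l2) filter"
  where "uniformity_l2 = (INF e\<in>{0 <..}. principal {(x, y). dist x y < e})"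
definition open_l2 :: "l2 set \<Rightarrow> bool"
  where "open_l2 U = (\<forall>x\<in>U. eventually (\<lambda>(x', y). x' = x \<longrightarrow> y \<in> U) uniformity)"

lemma inner_l2_square: "inner a (a::l2) = (LINT x|lborel. (cmod (l2_fun a x))\<^sup>2)"
  unfolding inner_l2_def by (intro Bochner_Integration.integral_cong) (auto simp: complex_mult_cnj cmod_power2)

instance
proof
  fix a b c :: l2 and r :: real
  have int: "integrable lborel (\<lambda>x. Re (l2_fun a x * cnj (l2_fun b x)))" for a b
    using l2_pair_integrable(2) by (rule integrable_Re)
  show "inner a b = inner b a"
    unfolding inner_l2_def by (intro Bochner_Integration.integral_cong) (auto simp: mult.commute)
  show "inner (a + b) c = inner a c + inner b c"
  proof -
    have "inner (a + b) c = (LINT x|lborel. Re (l2_fun a x * cnj (l2_fun c x)) + Re (l2_fun b x * cnj (l2_fun c x)))"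
      unfolding inner_l2_def
    proof (intro integral_cong_AE)
      show "AE x in lborel. Re (l2_fun (a + b) x * cnj (l2_fun c x)) =
          Re (l2_fun a x * cnj (l2_fun c x)) + Re (l2_fun b x * cnj (l2_fun c x))"
        using l2_fun_plus[of a b] by eventually_elim (simp add: algebra_simps)
    qed measurable
    then show ?thesis unfolding inner_l2_def using int by simp
  qed
  show "inner (r *\<^sub>R a) b = r * inner a b"
  proof -
    have "inner (r *\<^sub>R a) b = (LINT x|lborel. r * Re (l2_fun a x * cnj (l2_fun b x)))"
      unfolding inner_l2_def
    proof (intro integral_cong_AE)
      show "AE x in lborel. Re (l2_fun (r *\<^sub>R a) x * cnj (l2_fun b x)) =
          r * Re (l2_fun a x * cnj (l2_fun b x))"
        using l2_fun_scaleR[of r a] by eventually_elim (simp add: algebra_simps)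
    qed measurable
    then show ?thesis unfolding inner_l2_def by simp
  qed
  show "0 \<le> inner a a"
    unfolding inner_l2_square by simp
  show "(inner a a = 0) = (a = 0)"
  proof
    assume "inner a a = 0"
    then have "AE x in lborel. (cmod (l2_fun a x))\<^sup>2 = 0"
      unfolding inner_l2_square
      by (subst (asm) integral_nonneg_eq_0_iff_AE) (auto intro: L2_integrable_square)
    then show "a = 0"
      using l2_fun_zero by (intro l2_eqI[of a 0]) (auto elim: eventually_elim2)
  next
    assume "a = 0"
    then show "inner a a = 0"
      unfolding inner_l2_square using l2_fun_zero
      by (subst integral_nonneg_eq_0_iff_AE) (auto intro: L2_integrable_square)
  qed
qed (rule norm_l2_def dist_l2_def sgn_l2_def uniformity_l2_def open_l2_def)+

end

lemma norm_l2_square: "(norm a)\<^sup>2 = (LINT x|lborel. (cmod (l2_fun a x))\<^sup>2)"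
  by (simp add: power2_norm_eq_inner inner_l2_square)

lemma norm_l2_cls: "f \<in> L2 \<Longrightarrow> (norm (l2_cls f))\<^sup>2 = (LINT x|lborel. (cmod (f x))\<^sup>2)"
  unfolding norm_l2_square
proof (intro integral_cong_AE)
  assume f: "f \<in> L2"
  show "AE x in lborel. (cmod (l2_fun (l2_cls f) x))\<^sup>2 = (cmod (f x))\<^sup>2"
    using l2_fun_cls[OF f] by eventually_elim simp
  show "(\<lambda>x. (cmod (f x))\<^sup>2) \<in> borel_measurable lborel" using f by measurable
qed measurable

lemma norm_l2_cls_nn: "f \<in> L2 \<Longrightarrow> ennreal ((norm (l2_cls f))\<^sup>2) = (\<integral>\<^sup>+x. ennreal ((cmod (f x))\<^sup>2) \<partial>lborel)"
  by (simp add: norm_l2_cls L2_nn_eq)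

lemma l2_cls_add:
  assumes "f \<in> L2" "g \<in> L2"
  shows "l2_cls (\<lambda>x. f x + g x) = l2_cls f + l2_cls g"
  by (rule l2_eqI, use l2_fun_plus[of "l2_cls f" "l2_cls g"] l2_fun_cls[OF assms(1)] l2_fun_cls[OF assms(2)]
    l2_fun_cls[OF L2_add[OF assms]] in \<open>eventually_elim, simp\<close>)

lemma l2_cls_diff:
  assumes "f \<in> L2" "g \<in> L2"
  shows "l2_cls (\<lambda>x. f x - g x) = l2_cls f - l2_cls g"
  by (rule l2_eqI, use l2_fun_minus[of "l2_cls f" "l2_cls g"] l2_fun_cls[OF assms(1)] l2_fun_cls[OF assms(2)]
    l2_fun_cls[OF L2_diff[OF assms]] in \<open>eventually_elim, simp\<close>)

lemma norm_l2_cls_diff_nn: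
  assumes "f \<in> L2" "g \<in> L2"
  shows "ennreal ((norm (l2_cls f - l2_cls g))\<^sup>2) = (\<integral>\<^sup>+x. ennreal ((cmod (f x - g x))\<^sup>2) \<partial>lborel)"
  using norm_l2_cls_nn[OF L2_diff[OF assms]] by (simp add: l2_cls_diff assms)

text \<open>Riesz-Fischer: a subsequence with geometrically small increments converges almost
  everywhere, Fatou's lemma turns this into convergence in norm, and a Cauchy sequence follows its
  subsequence.\<close>

instance l2 :: complete_space
proof
  fix X :: "nat \<Rightarrow> l2"
  assume "Cauchy X"
  have ex: "\<exists>M. \<forall>m\<ge>M. norm (X m - X M) < (1/4)^n" for n :: nat
    using CauchyD[OF \<open>Cauchy X\<close>, of "(1/4)^n"] by auto
  define M where "M n = (SOME M. \<forall>m\<ge>M. norm (X m - X M) < (1/4)^n)" for n :: nat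
  have M: "norm (X m - X (M n)) < (1/4)^n" if "m \<ge> M n" for m n
    using someI_ex[OF ex[of n]] that unfolding M_def by blast
  \<comment> \<open>The summand \<open>n\<close> gives strict growth, the sum dominates
    \<open>M n\<close>.\<close>
  define r where "r n = n + sum M {..n}" for n
  have r_ge: "r n \<ge> M n" for n
    using member_le_sum[of n "{..n}" M] unfolding r_def by simp
  have r_Suc: "r n < r (Suc n)" for n
    unfolding r_def by simp
  have r_mono: "strict_mono r" using r_Suc by (simp add: strict_mono_Suc_iff)
  have near: "norm (X (r (Suc n)) - X (r n)) \<le> 2 * (1/4)^n" for n
  proof -
    have "norm (X (r (Suc n)) - X (r n)) \<le> norm (X (r (Suc n)) - X (M n)) + norm (X (r n) - X (M n))"
      using norm_triangle_ineq4[of "X (r (Suc n)) - X (M n)" "X (r n) - X (M n)"] by simp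
    also have "\<dots> \<le> (1/4)^n + (1/4)^n"
      using M[of n "r (Suc n)"] M[of n "r n"] r_ge[of n] r_Suc[of n] by (intro add_mono less_imp_le) auto
    finally show ?thesis by simp
  qed
  define f where "f n = l2_fun (X (r n))" for n
  have [measurable]: "f n \<in> borel_measurable borel" for n unfolding f_def by simp
  have fL2: "f n \<in> L2" for n unfolding f_def by simp
  define d where "d n x = cmod (f (Suc n) x - f n x)" for n x
  have [measurable]: "d n \<in> borel_measurable borel" for n unfolding d_def by measurable
  have dn: "(\<integral>\<^sup>+x. ennreal ((d n x)\<^sup>2) \<partial>lborel) \<le> ennreal (4 * (1/16)^n)" for n
  proof -
    have "(\<integral>\<^sup>+x. ennreal ((d n x)\<^sup>2) \<partial>lborel) = ennreal ((norm (X (r (Suc n)) - X (r n)))\<^sup>2)"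
      unfolding d_def using norm_l2_cls_diff_nn[OF fL2 fL2, of "Suc n" n] by (simp add: f_def)
    also have "\<dots> \<le> ennreal ((2 * (1/4)^n)\<^sup>2)"
      by (intro ennreal_leI power_mono near) simp
    also have "(2 * (1/4)^n)\<^sup>2 = (4 * (1/16)^n :: real)"
      by (simp add: power2_eq_square power_mult_distrib[symmetric])
    finally show ?thesis .
  qed
  \<comment> \<open>The squared increments integrate to at most 4/16^n, so the weight 4^n still
    leaves a convergent series; where the weighted sum is a finite number S, the increments are at
    most sqrt S / 2^n.\<close>
  have "(\<integral>\<^sup>+x. (\<Sum>n. ennreal (4^n * (d n x)\<^sup>2)) \<partial>lborel) = (\<Sum>n. \<integral>\<^sup>+x. ennreal (4^n * (d n x)\<^sup>2) \<partial>lborel)"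
    by (intro nn_integral_suminf) measurable
  also have "\<dots> \<le> (\<Sum>n. ennreal (4 * (1/4)^n))"
  proof (intro suminf_le allI)
    fix n
    have "(\<integral>\<^sup>+x. ennreal (4^n * (d n x)\<^sup>2) \<partial>lborel) = ennreal (4^n) * (\<integral>\<^sup>+x. ennreal ((d n x)\<^sup>2) \<partial>lborel)"
      by (simp add: ennreal_mult nn_integral_cmult)
    also have "\<dots> \<le> ennreal (4^n) * ennreal (4 * (1/16)^n)"
      by (intro mult_left_mono dn) auto
    also have "\<dots> = ennreal (4 * (1/4)^n)"
      by (simp add: ennreal_mult[symmetric] power_mult_distrib[symmetric] mult.left_commute)
    finally show "(\<integral>\<^sup>+x. ennreal (4^n * (d n x)\<^sup>2) \<partial>lborel) \<le> ennreal (4 * (1/4)^n)" .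
  qed auto
  also have "\<dots> < \<infinity>"
    by (subst suminf_ennreal2) (auto intro!: summable_mult summable_geometric)
  finally have "AE x in lborel. (\<Sum>n. ennreal (4^n * (d n x)\<^sup>2)) \<noteq> \<infinity>"
    by (intro nn_integral_noteq_infinite) auto
  then have conv: "AE x in lborel. convergent (\<lambda>n. f n x)"
  proof eventually_elim
    case (elim x)
    define S where "S = enn2real (\<Sum>n. ennreal (4^n * (d n x)\<^sup>2))"
    have S: "ennreal S = (\<Sum>n. ennreal (4^n * (d n x)\<^sup>2))" "S \<ge> 0"
      using elim unfolding S_def by (auto simp: less_top)
    have db: "d n x \<le> sqrt S * (1/2)^n" for n
    proof -
      have "ennreal (4^n * (d n x)\<^sup>2) \<le> ennreal S"
      proof -
        have "sum (\<lambda>n. ennreal (4^n * (d n x)\<^sup>2)) {n} \<le> (\<Sum>n. ennreal (4^n * (d n x)\<^sup>2))"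
          by (rule sum_le_suminf) (rule summableI, simp, rule zero_le)
        then show ?thesis unfolding S(1)[symmetric] by simp
      qed
      then have "4^n * (d n x)\<^sup>2 \<le> S" using S(2) by simp
      then have "(2^n * d n x)\<^sup>2 \<le> S" by (simp add: power_mult_distrib power_even_eq[symmetric] power_mult[symmetric] mult.commute[of n] power_mult)
      then have "2^n * d n x \<le> sqrt S" by (rule real_le_rsqrt)
      then have "(1/2)^n * (2^n * d n x) \<le> (1/2)^n * sqrt S" by (rule mult_left_mono) simp
      then show ?thesis by (simp add: power_one_over mult.commute)
    qed
    have "summable (\<lambda>n. f (Suc n) x - f n x)"
    proof (rule summable_comparison_test)
      show "summable (\<lambda>n. sqrt S * (1/2)^n)" by (intro summable_mult summable_geometric) auto
      show "\<exists>N. \<forall>n\<ge>N. norm (f (Suc n) x - f n x) \<le> sqrt S * (1/2)^n"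
        using db unfolding d_def by blast
    qed
    then have "convergent (\<lambda>n. \<Sum>i<n. f (Suc i) x - f i x)"
      by (simp add: summable_iff_convergent)
    then have "convergent (\<lambda>n. f n x - f 0 x)"
      using sum_lessThan_telescope[of "\<lambda>n. f n x"] by (simp only:)
    then show ?case by (rule convergent_diff_const_right_iff[THEN iffD1])
  qed
  define g where "g x = lim (\<lambda>n. f n x)" for x
  have [measurable]: "g \<in> borel_measurable borel" unfolding g_def by measurable
  have lim: "AE x in lborel. (\<lambda>n. f n x) \<longlonglongrightarrow> g x"
    using conv by eventually_elim (simp add: g_def convergent_LIMSEQ_iff)
  define E where "E = (\<lambda>n::nat. 2 * (1/4)^n :: real)"
  have fatou: "(\<integral>\<^sup>+x. ennreal ((cmod (g x - f n x))\<^sup>2) \<partial>lborel) \<le> ennreal ((E n)\<^sup>2)" for n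
  proof -
    have "(\<integral>\<^sup>+x. ennreal ((cmod (g x - f n x))\<^sup>2) \<partial>lborel) =
        (\<integral>\<^sup>+x. liminf (\<lambda>m. ennreal ((cmod (f m x - f n x))\<^sup>2)) \<partial>lborel)"
    proof (intro nn_integral_cong_AE)
      show "AE x in lborel. ennreal ((cmod (g x - f n x))\<^sup>2) = liminf (\<lambda>m. ennreal ((cmod (f m x - f n x))\<^sup>2))"
        using lim
      proof eventually_elim
        case (elim x)
        then have "(\<lambda>m. ennreal ((cmod (f m x - f n x))\<^sup>2)) \<longlonglongrightarrow> ennreal ((cmod (g x - f n x))\<^sup>2)"
          by (intro tendsto_ennrealI tendsto_intros)
        from lim_imp_Liminf[OF sequentially_bot this] show ?case by (rule sym)
      qed
    qed
    also have "\<dots> \<le> liminf (\<lambda>m. \<integral>\<^sup>+x. ennreal ((cmod (f m x - f n x))\<^sup>2) \<partial>lborel)"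
      by (intro nn_integral_liminf) measurable
    also have "\<dots> \<le> ennreal ((E n)\<^sup>2)"
    proof (rule Liminf_le)
      show "\<forall>\<^sub>F m in sequentially. (\<integral>\<^sup>+x. ennreal ((cmod (f m x - f n x))\<^sup>2) \<partial>lborel) \<le> ennreal ((E n)\<^sup>2)"
        using eventually_ge_at_top[of n]
      proof eventually_elim
        case (elim m)
        have "norm (X (r m) - X (r n)) \<le> norm (X (r m) - X (M n)) + norm (X (r n) - X (M n))"
          using norm_triangle_ineq4[of "X (r m) - X (M n)" "X (r n) - X (M n)"] by simp
        also have "\<dots> \<le> E n / 2 + E n / 2"
          unfolding E_def using M[of n "r m"] M[of n "r n"] r_ge[of n] strict_mono_less_eq[OF r_mono, of n m] elim
          by (intro add_mono less_imp_le) auto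
        finally have "(norm (X (r m) - X (r n)))\<^sup>2 \<le> (E n)\<^sup>2"
          by (intro power_mono) auto
        then show ?case
          unfolding norm_l2_cls_diff_nn[OF fL2 fL2, symmetric] by (simp add: f_def ennreal_leI)
      qed
    qed simp
    finally show ?thesis .
  qed
  have gf: "(\<lambda>x. g x - f 0 x) \<in> L2"
    by (rule L2_nn_finite) (measurable, rule le_less_trans[OF fatou[of 0]], simp)
  have gL2: "g \<in> L2" using L2_add[OF gf fL2[of 0]] by simp
  have bound: "norm (X (r n) - l2_cls g) \<le> E n" for n
  proof -
    have "ennreal ((norm (l2_cls g - X (r n)))\<^sup>2) \<le> ennreal ((E n)\<^sup>2)"
      using fatou[of n] norm_l2_cls_diff_nn[OF gL2 fL2, of n] by (simp add: f_def)
    then have "(norm (l2_cls g - X (r n)))\<^sup>2 \<le> (E n)\<^sup>2" by simp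
    then have "norm (l2_cls g - X (r n)) \<le> E n" by (rule power2_le_imp_le) (simp add: E_def)
    then show ?thesis by (simp add: norm_minus_commute)
  qed
  have "(\<lambda>n. X (r n)) \<longlonglongrightarrow> l2_cls g"
  proof (rule LIM_zero_cancel, rule Lim_null_comparison)
    show "\<forall>\<^sub>F n in sequentially. norm (X (r n) - l2_cls g) \<le> E n" using bound by simp
    show "E \<longlonglongrightarrow> 0"
      unfolding E_def using tendsto_mult_right_zero[OF LIMSEQ_power_zero[of "1/4::real"], of 2] by simp
  qed
  then have "(X \<circ> r) \<longlonglongrightarrow> l2_cls g" by (simp add: comp_def)
  then have "X \<longlonglongrightarrow> l2_cls g"
    by (rule Cauchy_converges_subseq[OF \<open>Cauchy X\<close> r_mono])
  then show "convergent X" by (rule convergentI)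
qed

instance l2 :: banach ..

section \<open>Invariance of Lebesgue measure under reflection and translation\<close>

lemma AE_lborel_uminus:
  assumes "AE x in lborel. P (x::real)"
  shows "AE x in lborel. P (- x)"
proof (rule AE_distrD[of uminus lborel borel P])
  show "AE x in distr lborel borel uminus. P x" unfolding lborel_distr_uminus by (rule assms)
qed simp

lemma AE_lborel_plus:
  assumes "AE x in lborel. P (x::real)"
  shows "AE x in lborel. P (c + x)"
proof (rule AE_distrD[of "(+) c" lborel borel P])
  show "AE x in distr lborel borel ((+) c). P x" unfolding lborel_distr_plus by (rule assms)
qed simp

lemma integral_lborel_uminus:
  fixes f :: "real \<Rightarrow> 'a :: {banach, second_countable_topology}"
  shows "(LINT x|lborel. f (- x)) = (LINT x|lborel. f x)"
  using lborel_integral_real_affine[of "-1" f 0] by simp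

lemma integral_lborel_plus:
  fixes f :: "real \<Rightarrow> 'a :: {banach, second_countable_topology}"
  shows "(LINT x|lborel. f (c + x)) = (LINT x|lborel. f x)"
  using lborel_integral_real_affine[of "1" f c] by simp

subsection \<open>Operators on the Hilbert space\<close>

text \<open>The bound is only required almost everywhere because \<open>u\<close> itself, whose
  bound comes from Sobolev embedding, has to qualify as a multiplier.\<close>

definition bdd_mult :: "(real \<Rightarrow> complex) \<Rightarrow> bool" where
  "bdd_mult m \<longleftrightarrow> m \<in> borel_measurable borel \<and> (\<exists>C. AE x in lborel. cmod (m x) \<le> C)"

lemma bdd_multI: "m \<in> borel_measurable borel \<Longrightarrow> (\<And>x. cmod (m x) \<le> C) \<Longrightarrow> bdd_mult m"
  unfolding bdd_mult_def by (intro conjI exI[of _ C] AE_I2)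

lemma bdd_mult_const [simp]: "bdd_mult (\<lambda>_. c)"
  by (rule bdd_multI[of _ "cmod c"]) auto

lemma bdd_mult_indicator: "A \<in> sets borel \<Longrightarrow> bdd_mult (indicator A)"
  by (rule bdd_multI[of _ 1]) (auto simp: indicator_def)

lemma L2_bdd_mult: "bdd_mult m \<Longrightarrow> f \<in> L2 \<Longrightarrow> (\<lambda>x. m x * f x) \<in> L2"
  unfolding bdd_mult_def using L2_bounded_mult by blast

definition l2_mul :: "(real \<Rightarrow> complex) \<Rightarrow> l2 \<Rightarrow> l2" where
  "l2_mul m a = l2_cls (\<lambda>x. m x * l2_fun a x)"

lemma l2_fun_mul: "bdd_mult m \<Longrightarrow> AE x in lborel. l2_fun (l2_mul m a) x = m x * l2_fun a x"
  unfolding l2_mul_def by (intro l2_fun_cls L2_bdd_mult l2_fun_L2)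

lemma norm_l2_le:
  assumes "0 \<le> C" "AE x in lborel. cmod (l2_fun a x) \<le> C * cmod (l2_fun b x)"
  shows "norm a \<le> C * norm b"
proof -
  have "(norm a)\<^sup>2 \<le> (LINT x|lborel. C\<^sup>2 * (cmod (l2_fun b x))\<^sup>2)"
    unfolding norm_l2_square
  proof (rule integral_mono_AE)
    show "AE x in lborel. (cmod (l2_fun a x))\<^sup>2 \<le> C\<^sup>2 * (cmod (l2_fun b x))\<^sup>2"
      using assms(2)
      by eventually_elim (auto simp: power_mult_distrib[symmetric] intro!: power_mono)
  qed (auto intro!: L2_integrable_square integrable_mult_right)
  also have "\<dots> = (C * norm b)\<^sup>2" by (simp add: power_mult_distrib norm_l2_square)
  finally show ?thesis by (rule power2_le_imp_le) (simp add: assms(1))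
qed

lemma norm_l2_mul_le:
  assumes "m \<in> borel_measurable borel" "0 \<le> C" "AE x in lborel. cmod (m x) \<le> C"
  shows "norm (l2_mul m a) \<le> C * norm a"
proof (rule norm_l2_le[OF assms(2)])
  have "bdd_mult m" unfolding bdd_mult_def using assms by blast
  from l2_fun_mul[OF this, of a] assms(3)
  show "AE x in lborel. cmod (l2_fun (l2_mul m a) x) \<le> C * cmod (l2_fun a x)"
    by eventually_elim (auto simp: norm_mult intro: mult_right_mono)
qed

lemma bounded_linear_l2_mul: "bdd_mult m \<Longrightarrow> bounded_linear (l2_mul m)"
proof -
  assume m: "bdd_mult m"
  then obtain C where C: "m \<in> borel_measurable borel" "AE x in lborel. cmod (m x) \<le> C"
    unfolding bdd_mult_def by blast
  show ?thesis
  proof (rule bounded_linear_intro[where K = "max C 0"])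
    fix a b
    show "l2_mul m (a + b) = l2_mul m a + l2_mul m b"
      by (rule l2_eqI, use l2_fun_mul[OF m, of a] l2_fun_mul[OF m, of b] l2_fun_mul[OF m, of "a + b"]
        l2_fun_plus[of a b] l2_fun_plus[of "l2_mul m a" "l2_mul m b"]
        in \<open>eventually_elim, simp add: algebra_simps\<close>)
    show "l2_mul m (r *\<^sub>R a) = r *\<^sub>R l2_mul m a" for r
      by (rule l2_eqI, use l2_fun_mul[OF m, of a] l2_fun_mul[OF m, of "r *\<^sub>R a"]
        l2_fun_scaleR[of r a] l2_fun_scaleR[of r "l2_mul m a"]
        in \<open>eventually_elim, simp add: algebra_simps\<close>)
    have "AE x in lborel. cmod (m x) \<le> max C 0"
      using C(2) by eventually_elim simp
    then show "norm (l2_mul m a) \<le> norm a * max C 0"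
      using norm_l2_mul_le[OF C(1), of "max C 0" a] by (simp add: mult.commute)
  qed
qed

lemma l2_mul_cls: "bdd_mult m \<Longrightarrow> f \<in> L2 \<Longrightarrow> l2_mul m (l2_cls f) = l2_cls (\<lambda>x. m x * f x)"
proof -
  assume m: "bdd_mult m" and f: "f \<in> L2"
  show ?thesis
    by (rule l2_eqI, use l2_fun_mul[OF m, of "l2_cls f"] l2_fun_cls[OF f] l2_fun_cls[OF L2_bdd_mult[OF m f]]
      in \<open>eventually_elim, simp\<close>)
qed

lemma l2_mul_const_scaleR: "l2_mul (\<lambda>_. of_real r) a = r *\<^sub>R a"
  by (rule l2_eqI, use l2_fun_mul[OF bdd_mult_const, of "of_real r" a] l2_fun_scaleR[of r a]
      in \<open>eventually_elim, simp\<close>)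

section \<open>Conjugation, reflection and translation of classes\<close>

definition l2_cnj :: "l2 \<Rightarrow> l2" where "l2_cnj a = l2_cls (\<lambda>x. cnj (l2_fun a x))"
definition l2_refl :: "l2 \<Rightarrow> l2" where "l2_refl a = l2_cls (\<lambda>x. l2_fun a (- x))"
definition l2_shift :: "real \<Rightarrow> l2 \<Rightarrow> l2" where "l2_shift c a = l2_cls (\<lambda>x. l2_fun a (c + x))"

lemma L2_refl: "f \<in> L2 \<Longrightarrow> (\<lambda>x. f (- x)) \<in> L2"
  unfolding L2_def using lborel_integrable_real_affine[of "\<lambda>x. (cmod (f x))\<^sup>2" "-1" 0]
  by auto

lemma L2_shift: "f \<in> L2 \<Longrightarrow> (\<lambda>x. f (c + x)) \<in> L2"
  unfolding L2_def using lborel_integrable_real_affine[of "\<lambda>x. (cmod (f x))\<^sup>2" "1" c]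
  by auto

lemma l2_fun_cnj: "AE x in lborel. l2_fun (l2_cnj a) x = cnj (l2_fun a x)"
  unfolding l2_cnj_def by (intro l2_fun_cls L2_cnj l2_fun_L2)

lemma l2_fun_refl: "AE x in lborel. l2_fun (l2_refl a) x = l2_fun a (- x)"
  unfolding l2_refl_def by (intro l2_fun_cls L2_refl l2_fun_L2)

lemma l2_fun_shift: "AE x in lborel. l2_fun (l2_shift c a) x = l2_fun a (c + x)"
  unfolding l2_shift_def by (intro l2_fun_cls L2_shift l2_fun_L2)

lemma l2_cnj_cls: "f \<in> L2 \<Longrightarrow> l2_cnj (l2_cls f) = l2_cls (\<lambda>x. cnj (f x))"
proof -
  assume f: "f \<in> L2"
  show ?thesis
    by (rule l2_eqI, use l2_fun_cnj[of "l2_cls f"] l2_fun_cls[OF f] l2_fun_cls[OF L2_cnj[OF f]]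
      in \<open>eventually_elim, simp\<close>)
qed

lemma l2_refl_cls: "f \<in> L2 \<Longrightarrow> l2_refl (l2_cls f) = l2_cls (\<lambda>x. f (- x))"
proof -
  assume f: "f \<in> L2"
  show ?thesis
    by (rule l2_eqI, use l2_fun_refl[of "l2_cls f"] AE_lborel_uminus[OF l2_fun_cls[OF f]]
        l2_fun_cls[OF L2_refl[OF f]] in \<open>eventually_elim, simp\<close>)
qed

lemma l2_shift_cls: "f \<in> L2 \<Longrightarrow> l2_shift c (l2_cls f) = l2_cls (\<lambda>x. f (c + x))"
proof -
  assume f: "f \<in> L2"
  show ?thesis
    by (rule l2_eqI, use l2_fun_shift[of c "l2_cls f"] AE_lborel_plus[OF l2_fun_cls[OF f], of c]
        l2_fun_cls[OF L2_shift[OF f], of c] in \<open>eventually_elim, simp\<close>)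
qed

lemma l2_cnj_cnj [simp]: "l2_cnj (l2_cnj a) = a"
  by (rule l2_eqI, use l2_fun_cnj[of a] l2_fun_cnj[of "l2_cnj a"] in \<open>eventually_elim, simp\<close>)

lemma l2_refl_refl [simp]: "l2_refl (l2_refl a) = a"
  by (rule l2_eqI, use AE_lborel_uminus[OF l2_fun_refl[of a]] l2_fun_refl[of "l2_refl a"]
      in \<open>eventually_elim, simp\<close>)

lemma norm_l2_cnj [simp]: "norm (l2_cnj a) = norm a"
proof -
  have "(norm (l2_cnj a))\<^sup>2 = (norm a)\<^sup>2"
    unfolding l2_cnj_def norm_l2_cls[OF L2_cnj[OF l2_fun_L2]] by (simp add: norm_l2_square)
  then show ?thesis by simp
qed

lemma norm_l2_refl [simp]: "norm (l2_refl a) = norm a"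
proof -
  have "(norm (l2_refl a))\<^sup>2 = (norm a)\<^sup>2"
    unfolding l2_refl_def norm_l2_cls[OF L2_refl[OF l2_fun_L2]]
    unfolding norm_l2_square
    by (rule integral_lborel_uminus)
  then show ?thesis by simp
qed

lemma norm_l2_shift [simp]: "norm (l2_shift c a) = norm a"
proof -
  have "(norm (l2_shift c a))\<^sup>2 = (norm a)\<^sup>2"
    unfolding l2_shift_def norm_l2_cls[OF L2_shift[OF l2_fun_L2]]
    unfolding norm_l2_square
    by (rule integral_lborel_plus)
  then show ?thesis by simp
qed

lemma bounded_linear_l2_cnj: "bounded_linear l2_cnj"
proof (rule bounded_linear_intro[where K = 1])
  show "l2_cnj (a + b) = l2_cnj a + l2_cnj b" for a b
    by (rule l2_eqI, use l2_fun_cnj[of a] l2_fun_cnj[of b] l2_fun_cnj[of "a + b"] l2_fun_plus[of a b]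
        l2_fun_plus[of "l2_cnj a" "l2_cnj b"] in \<open>eventually_elim, simp\<close>)
  show "l2_cnj (r *\<^sub>R a) = r *\<^sub>R l2_cnj a" for r a
    by (rule l2_eqI, use l2_fun_cnj[of a] l2_fun_cnj[of "r *\<^sub>R a"] l2_fun_scaleR[of r a]
        l2_fun_scaleR[of r "l2_cnj a"] in \<open>eventually_elim, simp\<close>)
qed simp

lemma bounded_linear_l2_refl: "bounded_linear l2_refl"
proof (rule bounded_linear_intro[where K = 1])
  show "l2_refl (a + b) = l2_refl a + l2_refl b" for a b
    by (rule l2_eqI, use l2_fun_refl[of a] l2_fun_refl[of b] l2_fun_refl[of "a + b"]
        AE_lborel_uminus[OF l2_fun_plus[of a b]]
        l2_fun_plus[of "l2_refl a" "l2_refl b"] in \<open>eventually_elim, simp\<close>)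
  show "l2_refl (r *\<^sub>R a) = r *\<^sub>R l2_refl a" for r a
    by (rule l2_eqI, use l2_fun_refl[of a] l2_fun_refl[of "r *\<^sub>R a"] AE_lborel_uminus[OF l2_fun_scaleR[of r a]]
        l2_fun_scaleR[of r "l2_refl a"] in \<open>eventually_elim, simp\<close>)
qed simp

lemma bounded_linear_l2_shift: "bounded_linear (l2_shift c)"
proof (rule bounded_linear_intro[where K = 1])
  show "l2_shift c (a + b) = l2_shift c a + l2_shift c b" for a b
    by (rule l2_eqI, use l2_fun_shift[of c a] l2_fun_shift[of c b] l2_fun_shift[of c "a + b"]
        AE_lborel_plus[OF l2_fun_plus[of a b], of c]
        l2_fun_plus[of "l2_shift c a" "l2_shift c b"] in \<open>eventually_elim, simp\<close>)
  show "l2_shift c (r *\<^sub>R a) = r *\<^sub>R l2_shift c a" for r a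
    by (rule l2_eqI, use l2_fun_shift[of c a] l2_fun_shift[of c "r *\<^sub>R a"]
        AE_lborel_plus[OF l2_fun_scaleR[of r a], of c]
        l2_fun_scaleR[of r "l2_shift c a"] in \<open>eventually_elim, simp\<close>)
qed simp

text \<open>The pairing is bilinear, without conjugation, because the Fourier transform is symmetric
  for it. The Hermitian product of a and b is \<open>l2_pair a (l2_cnj b)\<close>.\<close>

definition l2_pair :: "l2 \<Rightarrow> l2 \<Rightarrow> complex" where
  "l2_pair a b = (LINT x|lborel. l2_fun a x * l2_fun b x)"

lemma l2_pair_cls:
  assumes "f \<in> L2" "g \<in> L2"
  shows "l2_pair (l2_cls f) (l2_cls g) = (LINT x|lborel. f x * g x)"
  unfolding l2_pair_def
proof (rule integral_cong_AE)
  show "AE x in lborel. l2_fun (l2_cls f) x * l2_fun (l2_cls g) x = f x * g x"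
    using l2_fun_cls[OF assms(1)] l2_fun_cls[OF assms(2)] by eventually_elim simp
qed (use assms in measurable)

lemma l2_pair_commute: "l2_pair a b = l2_pair b a"
  by (simp add: l2_pair_def mult.commute)

lemma l2_pair_cnj_self: "l2_pair a (l2_cnj a) = of_real ((norm a)\<^sup>2)"
proof -
  have "l2_pair a (l2_cnj a) = (LINT x|lborel. of_real ((cmod (l2_fun a x))\<^sup>2))"
    using l2_pair_cls[OF l2_fun_L2[of a] L2_cnj[OF l2_fun_L2[of a]]]
    by (simp add: l2_cnj_def complex_norm_square del: of_real_power)
  then show ?thesis by (simp only: integral_complex_of_real norm_l2_square)
qed

lemma l2_pair_refl: "l2_pair (l2_refl a) (l2_refl b) = l2_pair a b"
  unfolding l2_refl_def l2_pair_cls[OF L2_refl[OF l2_fun_L2] L2_refl[OF l2_fun_L2]]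
  unfolding l2_pair_def by (rule integral_lborel_uminus[of "\<lambda>x. l2_fun a x * l2_fun b x"])

lemma l2_pair_mul: "bdd_mult m \<Longrightarrow> l2_pair (l2_mul m a) b = l2_pair a (l2_mul m b)"
proof -
  assume m: "bdd_mult m"
  have "l2_pair (l2_mul m a) (l2_cls (l2_fun b)) = l2_pair (l2_cls (l2_fun a)) (l2_mul m b)"
    unfolding l2_mul_def l2_pair_cls[OF L2_bdd_mult[OF m l2_fun_L2] l2_fun_L2]
      l2_pair_cls[OF l2_fun_L2 L2_bdd_mult[OF m l2_fun_L2]]
    by (simp add: ac_simps)
  then show ?thesis by simp
qed

lemma l2_pair_mul_const: "l2_pair (l2_mul (\<lambda>_. c) a) b = c * l2_pair a b"
proof -
  have "l2_pair (l2_mul (\<lambda>_. c) a) (l2_cls (l2_fun b)) = c * l2_pair a b"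
    unfolding l2_mul_def l2_pair_cls[OF L2_cmult[OF l2_fun_L2] l2_fun_L2]
    unfolding l2_pair_def by (simp add: mult.assoc)
  then show ?thesis by simp
qed

lemma Re_l2_pair: "Re (l2_pair a (l2_cnj b)) = inner a b"
proof -
  have "Re (l2_pair (l2_cls (l2_fun a)) (l2_cnj b)) = inner a b"
    unfolding l2_cnj_def l2_pair_cls[OF l2_fun_L2 L2_cnj[OF l2_fun_L2]] inner_l2_def
    by (rule integral_Re[symmetric, OF l2_pair_integrable(2)])
  then show ?thesis by simp
qed

lemma norm_l2_pair: "cmod (l2_pair a b) \<le> norm a * norm b"
proof (cases "l2_pair a b = 0")
  case False
  \<comment> \<open>A phase that rotates the pairing onto the positive axis, so that the
    Cauchy-Schwarz inequality of the real inner product applies.\<close>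
  define c where "c = cnj (l2_pair a b) / cmod (l2_pair a b)"
  have c: "cmod c = 1" unfolding c_def using False by (simp add: norm_divide)
  have "c * l2_pair a b = cmod (l2_pair a b)"
    unfolding c_def using False by (simp add: complex_norm_square[symmetric] power2_eq_square divide_simps mult.commute)
  then have "cmod (l2_pair a b) = Re (l2_pair (l2_mul (\<lambda>_. c) a) (l2_cnj (l2_cnj b)))"
    by (simp add: l2_pair_mul_const)
  also have "\<dots> \<le> norm (l2_mul (\<lambda>_. c) a) * norm (l2_cnj b)"
    unfolding Re_l2_pair by (rule norm_cauchy_schwarz)
  also have "\<dots> \<le> norm a * norm b"
    using norm_l2_mul_le[of "\<lambda>_. c" 1 a] c by (intro mult_mono) auto
  finally show ?thesis .
qed simp

lemma bounded_bilinear_l2_pair: "bounded_bilinear l2_pair"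
proof
  show add: "l2_pair (a + a') b = l2_pair a b + l2_pair a' b" for a a' b
  proof -
    have "l2_pair (a + a') b = (LINT x|lborel. l2_fun a x * l2_fun b x + l2_fun a' x * l2_fun b x)"
      unfolding l2_pair_def
    proof (rule integral_cong_AE)
      show "AE x in lborel. l2_fun (a + a') x * l2_fun b x = l2_fun a x * l2_fun b x + l2_fun a' x * l2_fun b x"
        using l2_fun_plus[of a a'] by eventually_elim (simp add: algebra_simps)
    qed measurable
    also have "\<dots> = l2_pair a b + l2_pair a' b"
      unfolding l2_pair_def by (rule Bochner_Integration.integral_add; rule l2_pair_integrable)
    finally show ?thesis .
  qed
  show "l2_pair b (a + a') = l2_pair b a + l2_pair b a'" for a a' b
    using add[of a a' b] by (simp only: l2_pair_commute[of b])
  show scale: "l2_pair (r *\<^sub>R a) b = r *\<^sub>R l2_pair a b" for r a b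
    using l2_pair_mul_const[of "of_real r" a b] by (simp add: l2_mul_const_scaleR scaleR_conv_of_real)
  show "l2_pair b (r *\<^sub>R a) = r *\<^sub>R l2_pair b a" for r a b
    using scale[of r a b] by (simp only: l2_pair_commute[of b])
  show "\<exists>K. \<forall>a b. norm (l2_pair a b) \<le> norm a * norm b * K"
    by (rule exI[of _ 1]) (simp add: norm_l2_pair)
qed

interpretation l2_pair: bounded_bilinear l2_pair by (rule bounded_bilinear_l2_pair)

lemma l2_pair_nondegenerate:
  assumes "\<And>b. l2_pair a b = 0"
  shows "a = 0"
  using assms[of "l2_cnj a"] by (simp add: l2_pair_cnj_self)

subsection \<open>Truncation and density of integrable functions\<close>

definition l2_trunc :: "real \<Rightarrow> l2 \<Rightarrow> l2" where "l2_trunc R = l2_mul (indicator {-R..R})"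

lemma l2_trunc_cls: "l2_trunc R a = l2_cls (\<lambda>x. indicator {-R..R} x * l2_fun a x)"
  by (simp add: l2_trunc_def l2_mul_def)

lemma L2_trunc: "f \<in> L2 \<Longrightarrow> (\<lambda>x. indicator {-R..R} x * f x) \<in> L2"
  by (intro L2_bdd_mult bdd_mult_indicator) auto

lemma indicator_L2: "indicator {a<..b::real} \<in> L2"
proof -
  have "(\<lambda>x. (cmod (indicator {a<..b::real} x))\<^sup>2) = indicator {a<..b}"
    by (auto simp: indicator_def)
  then show ?thesis
    unfolding L2_def by (cases "a \<le> b") (auto intro!: integrable_real_indicator)
qed

lemma indicator_cbox_L2: "indicator {a..b::real} \<in> L2"
proof -
  have "(\<lambda>x. (cmod (indicator {a..b::real} x))\<^sup>2) = indicator {a..b}"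
    by (auto simp: indicator_def)
  then show ?thesis
    unfolding L2_def by (auto intro!: integrable_real_indicator simp: emeasure_lborel_Icc_eq)
qed

lemma L2_trunc_integrable: "f \<in> L2 \<Longrightarrow> integrable lborel (\<lambda>x. indicator {-R..R} x * f x)"
  by (rule L2_mult_integrable[OF indicator_cbox_L2])

lemma l2_trunc_tendsto: "((\<lambda>R. l2_trunc R a) \<longlongrightarrow> a) at_top"
proof (rule LIM_zero_cancel)
  have "((\<lambda>R. LINT x|lborel. (cmod (indicator {-R..R} x * l2_fun a x - l2_fun a x))\<^sup>2)
      \<longlongrightarrow> (LINT x::real|lborel. 0)) at_top"
  proof (rule integral_dominated_convergence_at_top[where w = "\<lambda>x. (cmod (l2_fun a x))\<^sup>2"])
    show "integrable lborel (\<lambda>x. (cmod (l2_fun a x))\<^sup>2)"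
      by (rule L2_integrable_square[OF l2_fun_L2])
    show "\<forall>\<^sub>F R in at_top. AE x in lborel.
        norm ((cmod (indicator {-R..R} x * l2_fun a x - l2_fun a x))\<^sup>2) \<le> (cmod (l2_fun a x))\<^sup>2"
      by (intro always_eventually allI AE_I2) (auto simp: indicator_def)
    show "AE x in lborel. ((\<lambda>R. (cmod (indicator {-R..R} x * l2_fun a x - l2_fun a x))\<^sup>2) \<longlongrightarrow> 0) at_top"
    proof (rule AE_I2)
      fix x :: real
      have "\<forall>\<^sub>F R in at_top. (cmod (indicator {-R..R} x * l2_fun a x - l2_fun a x))\<^sup>2 = 0"
        using eventually_ge_at_top[of "\<bar>x\<bar>"] by eventually_elim (auto simp: indicator_def abs_le_iff)
      then show "((\<lambda>R. (cmod (indicator {-R..R} x * l2_fun a x - l2_fun a x))\<^sup>2) \<longlongrightarrow> 0) at_top"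
        by (rule tendsto_eventually)
    qed
  qed measurable
  moreover have "(LINT x|lborel. (cmod (indicator {-R..R} x * l2_fun a x - l2_fun a x))\<^sup>2) =
      (norm (l2_trunc R a - a))\<^sup>2" for R
  proof -
    have "l2_trunc R a - a = l2_cls (\<lambda>x. indicator {-R..R} x * l2_fun a x - l2_fun a x)"
      unfolding l2_cls_diff[OF L2_trunc[OF l2_fun_L2] l2_fun_L2] l2_trunc_cls l2_cls_fun ..
    then show ?thesis
      using norm_l2_cls[OF L2_diff[OF L2_trunc[OF l2_fun_L2] l2_fun_L2], of R a a] by (simp only:)
  qed
  ultimately have "((\<lambda>R. (norm (l2_trunc R a - a))\<^sup>2) \<longlongrightarrow> 0) at_top"
    by (simp only: Bochner_Integration.integral_zero)
  then have "((\<lambda>R. sqrt ((norm (l2_trunc R a - a))\<^sup>2)) \<longlongrightarrow> sqrt 0) at_top"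
    by (rule tendsto_real_sqrt)
  then have "((\<lambda>R. norm (l2_trunc R a - a)) \<longlongrightarrow> 0) at_top"
    by (simp only: real_sqrt_abs abs_norm_cancel real_sqrt_zero)
  then show "((\<lambda>R. l2_trunc R a - a) \<longlongrightarrow> 0) at_top"
    by (rule tendsto_norm_zero_cancel)
qed

text \<open>Truncations to [-R, R] are integrable and converge to the given class. Identities
  between continuous operators thus need a proof only where the Fourier transform is an absolutely
  convergent integral.\<close>

lemma l2_dense_eq:
  fixes F G :: "l2 \<Rightarrow> 'a::real_normed_vector"
  assumes "bounded_linear F" "bounded_linear G"
    and "\<And>f. f \<in> L2 \<Longrightarrow> integrable lborel f \<Longrightarrow> F (l2_cls f) = G (l2_cls f)"
  shows "F a = G a"
proof (rule tendsto_unique)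
  show "((\<lambda>R. F (l2_trunc R a)) \<longlongrightarrow> F a) at_top"
    by (rule bounded_linear.tendsto[OF assms(1) l2_trunc_tendsto])
  have "F (l2_trunc R a) = G (l2_trunc R a)" for R
    unfolding l2_trunc_cls by (intro assms(3) L2_trunc L2_trunc_integrable l2_fun_L2)
  then show "((\<lambda>R. F (l2_trunc R a)) \<longlongrightarrow> G a) at_top"
    using bounded_linear.tendsto[OF assms(2) l2_trunc_tendsto[of a]] by simp
qed simp

subsection \<open>The Fourier transform\<close>

definition FT :: "(real \<Rightarrow> complex) \<Rightarrow> real \<Rightarrow> complex" where
  "FT f \<xi> = (LINT x|lborel. f x * exp (- (\<i> * of_real (x * \<xi>))))"

lemma cmod_FT_kernel [simp]: "cmod (exp (- (\<i> * of_real t))) = 1"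
  using norm_exp_i_times[of "- t"] by simp

lemma FT_kernel_integrable:
  assumes "integrable lborel f"
  shows "integrable lborel (\<lambda>x. f x * exp (- (\<i> * of_real (x * \<xi>))))"
  by (rule Bochner_Integration.integrable_bound[OF assms])
     (use borel_measurable_integrable[OF assms] in \<open>auto simp: norm_mult\<close>)

lemma FT_measurable [measurable (raw)]:
  "f \<in> borel_measurable borel \<Longrightarrow> FT f \<in> borel_measurable borel"
proof -
  assume [measurable]: "f \<in> borel_measurable borel"
  have "(\<lambda>\<xi>. LINT x|lborel. f x * exp (- (\<i> * of_real (x * \<xi>)))) \<in> borel_measurable borel"
    by measurable
  then show ?thesis by (simp add: FT_def[abs_def])
qed

lemma FT_bound: "cmod (FT f \<xi>) \<le> (LINT x|lborel. cmod (f x))"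
proof -
  have "cmod (FT f \<xi>) \<le> (LINT x|lborel. cmod (f x * exp (- (\<i> * of_real (x * \<xi>)))))"
    unfolding FT_def by (rule integral_norm_bound)
  then show ?thesis by (simp add: norm_mult)
qed

lemma FT_cong_AE:
  assumes "f \<in> borel_measurable borel" "g \<in> borel_measurable borel" "AE x in lborel. f x = g x"
  shows "FT f = FT g"
proof
  fix \<xi>
  show "FT f \<xi> = FT g \<xi>"
    unfolding FT_def
  proof (rule integral_cong_AE)
    show "AE x in lborel. f x * exp (- (\<i> * of_real (x * \<xi>))) = g x * exp (- (\<i> * of_real (x * \<xi>)))"
      using assms(3) by eventually_elim simp
  qed (use assms in measurable)
qed

lemma FT_add:
  assumes "integrable lborel f" "integrable lborel g"
  shows "FT (\<lambda>x. f x + g x) \<xi> = FT f \<xi> + FT g \<xi>"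
  unfolding FT_def distrib_right
  by (rule Bochner_Integration.integral_add; rule FT_kernel_integrable; rule assms)

lemma FT_diff:
  assumes "integrable lborel f" "integrable lborel g"
  shows "FT (\<lambda>x. f x - g x) \<xi> = FT f \<xi> - FT g \<xi>"
  unfolding FT_def left_diff_distrib
  by (rule Bochner_Integration.integral_diff; rule FT_kernel_integrable; rule assms)

lemma FT_cmult: "FT (\<lambda>x. c * f x) \<xi> = c * FT f \<xi>"
  unfolding FT_def by (simp add: mult.assoc)

lemma FT_cnj: "FT (\<lambda>x. cnj (f x)) \<xi> = cnj (FT f (- \<xi>))"
proof -
  have "(\<lambda>x. cnj (f x) * exp (- (\<i> * of_real (x * \<xi>)))) =
      (\<lambda>x. cnj (f x * exp (- (\<i> * of_real (x * - \<xi>)))))"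
    by (simp add: exp_cnj)
  then show ?thesis unfolding FT_def by (simp only: Bochner_Integration.integral_cnj)
qed

lemma FT_refl: "FT (\<lambda>x. f (- x)) \<xi> = FT f (- \<xi>)"
  unfolding FT_def
  using integral_lborel_uminus[of "\<lambda>x. f x * exp (- (\<i> * of_real (x * - \<xi>)))"] by simp

lemma FT_modulate: "FT (\<lambda>x. exp (- (\<i> * of_real (c * x))) * f x) \<xi> = FT f (c + \<xi>)"
  unfolding FT_def
  by (rule Bochner_Integration.integral_cong)
     (simp_all add: mult.assoc mult.left_commute[of _ "f _"] mult_exp_exp algebra_simps)

text \<open>Fubini's theorem for the kernel exp(-i x \<xi>), which has modulus 1. This is the source
  of the symmetry \<open>l2_pair_FT\<close> and of the Gaussian regularisation below.\<close>

lemma FT_exchange: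
  assumes f: "integrable lborel f" and g: "integrable lborel g"
  shows "(LINT \<xi>|lborel. FT f \<xi> * g \<xi>) = (LINT x|lborel. f x * FT g x)"
proof -
  have [measurable]: "f \<in> borel_measurable borel" "g \<in> borel_measurable borel"
    using f g by auto
  let ?h = "\<lambda>x \<xi>. f x * g \<xi> * exp (- (\<i> * of_real (x * \<xi>)))"
  have int: "integrable (lborel \<Otimes>\<^sub>M lborel) (\<lambda>(x, \<xi>). ?h x \<xi>)"
  proof (rule lborel_pair.Fubini_integrable)
    have "integrable lborel (\<lambda>x. cmod (f x) * (LINT \<xi>|lborel. cmod (g \<xi>)))"
      by (intro integrable_mult_left integrable_norm f)
    then show "integrable lborel (\<lambda>x. LINT \<xi>|lborel. norm (case (x, \<xi>) of (x, \<xi>) \<Rightarrow> ?h x \<xi>))"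
      by (simp add: norm_mult)
    have "integrable lborel (?h x)" for x
    proof (rule Bochner_Integration.integrable_bound)
      show "integrable lborel (\<lambda>\<xi>. f x * g \<xi>)" using g by simp
      show "AE \<xi> in lborel. norm (?h x \<xi>) \<le> norm (f x * g \<xi>)" by (simp add: norm_mult)
    qed measurable
    then show "AE x in lborel. integrable lborel (\<lambda>\<xi>. case (x, \<xi>) of (x, \<xi>) \<Rightarrow> ?h x \<xi>)"
      by simp
  qed measurable
  have "(LINT \<xi>|lborel. FT f \<xi> * g \<xi>) = (LINT \<xi>|lborel. LINT x|lborel. ?h x \<xi>)"
  proof (rule Bochner_Integration.integral_cong[OF refl])
    fix \<xi> :: real
    have "FT f \<xi> * g \<xi> = (LINT x|lborel. (f x * exp (- (\<i> * of_real (x * \<xi>)))) * g \<xi>)"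
      unfolding FT_def by (rule integral_mult_left_zero[symmetric])
    then show "FT f \<xi> * g \<xi> = (LINT x|lborel. ?h x \<xi>)" by (simp add: ac_simps)
  qed
  also have "\<dots> = (LINT x|lborel. LINT \<xi>|lborel. ?h x \<xi>)"
    by (rule lborel_pair.Fubini_integral[OF int])
  also have "\<dots> = (LINT x|lborel. f x * FT g x)"
  proof (rule Bochner_Integration.integral_cong[OF refl])
    fix x :: real
    have "(LINT \<xi>|lborel. f x * (g \<xi> * exp (- (\<i> * of_real (\<xi> * x))))) = f x * FT g x"
      unfolding FT_def by (rule integral_mult_right_zero)
    then show "(LINT \<xi>|lborel. ?h x \<xi>) = f x * FT g x"
      by (simp only: mult.assoc mult.commute[of x])
  qed
  finally show ?thesis .
qed

section \<open>Gaussian regularisation and the L^2 bound of the Fourier transform\<close>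

definition gauss_weight :: "real \<Rightarrow> real \<Rightarrow> real" where
  "gauss_weight c \<xi> = exp (- (\<xi> / c)\<^sup>2 / 2)"

text \<open>Normalised to be the transform of \<open>gauss_weight c\<close>: a Gaussian of standard
  deviation 1/c and total mass 2 pi, the constant in the L^2 bound.\<close>

definition gauss_kernel :: "real \<Rightarrow> real \<Rightarrow> real" where
  "gauss_kernel c t = 2 * pi * normal_density 0 (1 / c) t"

lemma gauss_weight_measurable [measurable]: "gauss_weight c \<in> borel_measurable borel"
  unfolding gauss_weight_def[abs_def] by measurable

lemma gauss_kernel_measurable [measurable]: "gauss_kernel c \<in> borel_measurable borel"
  unfolding gauss_kernel_def[abs_def] by measurable

lemma gauss_weight_integrable:
  assumes "c > 0" shows "integrable lborel (gauss_weight c)"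
proof -
  have "gauss_weight c = (\<lambda>\<xi>. sqrt (2 * pi * c\<^sup>2) * normal_density 0 c \<xi>)"
    using assms by (auto simp: gauss_weight_def normal_density_def power_divide)
  then show ?thesis using assms by simp
qed

text \<open>The characteristic function of the standard normal distribution at -t, freed of the
  density factor.\<close>

lemma FT_std_normal:
  "FT (\<lambda>\<xi>. of_real (exp (- \<xi>\<^sup>2 / 2))) t = of_real (sqrt (2 * pi) * exp (- t\<^sup>2 / 2))"
proof -
  have "of_real (exp (- (- t)\<^sup>2 / 2)) = char std_normal_distribution (- t)"
    by (simp add: char_std_normal_distribution)
  also have "\<dots> = (LINT x|lborel. std_normal_density x *\<^sub>R exp (\<i> * of_real (- t * x)))"
    unfolding char_def by (rule integral_density) (auto simp: normal_density_nonneg)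
  also have "\<dots> = (LINT x|lborel. of_real (1 / sqrt (2 * pi)) * (of_real (exp (- x\<^sup>2 / 2)) * exp (- (\<i> * of_real (x * t)))))"
    by (intro Bochner_Integration.integral_cong)
       (simp_all add: std_normal_density_def scaleR_conv_of_real mult.commute[of t] ac_simps)
  also have "\<dots> = of_real (1 / sqrt (2 * pi)) * FT (\<lambda>\<xi>. of_real (exp (- \<xi>\<^sup>2 / 2))) t"
    unfolding FT_def by (rule integral_mult_right_zero)
  finally have "of_real (sqrt (2 * pi)) * of_real (exp (- (- t)\<^sup>2 / 2)) =
      of_real (sqrt (2 * pi)) * of_real (1 / sqrt (2 * pi)) * FT (\<lambda>\<xi>. of_real (exp (- \<xi>\<^sup>2 / 2))) t"
    by (simp only: mult.assoc)
  also have "of_real (sqrt (2 * pi)) * of_real (1 / sqrt (2 * pi)) = (1::complex)"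
    by (simp flip: of_real_mult)
  finally show ?thesis by simp
qed

lemma FT_gauss_weight:
  assumes "c > 0"
  shows "FT (\<lambda>\<xi>. of_real (gauss_weight c \<xi>)) t = of_real (gauss_kernel c t)"
proof -
  have "FT (\<lambda>\<xi>. of_real (gauss_weight c \<xi>)) t =
     c *\<^sub>R (LINT \<xi>|lborel. of_real (gauss_weight c (0 + c * \<xi>)) * exp (- (\<i> * of_real ((0 + c * \<xi>) * t))))"
    unfolding FT_def using assms
    lborel_integral_real_affine[of c "\<lambda>\<xi>. of_real (gauss_weight c \<xi>) * exp (- (\<i> * of_real (\<xi> * t)))" 0] by simp
  also have "\<dots> = c *\<^sub>R FT (\<lambda>\<xi>. of_real (exp (- \<xi>\<^sup>2 / 2))) (c * t)"
    unfolding FT_def using assms by (simp add: gauss_weight_def ac_simps)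
  also have "\<dots> = of_real (gauss_kernel c t)"
    unfolding FT_std_normal gauss_kernel_def normal_density_def scaleR_conv_of_real of_real_mult[symmetric] of_real_eq_iff
    using assms by (simp add: real_sqrt_mult real_sqrt_divide power_divide power_mult_distrib field_simps)
  finally show ?thesis .
qed

lemma gauss_kernel_nn:
  assumes "c > 0"
  shows "(\<integral>\<^sup>+y. ennreal (gauss_kernel c (y - x)) \<partial>lborel) = ennreal (2 * pi)"
    "(\<integral>\<^sup>+y. ennreal (gauss_kernel c (x - y)) \<partial>lborel) = ennreal (2 * pi)"
proof -
  have 0: "(\<integral>\<^sup>+y. ennreal (gauss_kernel c y) \<partial>lborel) = ennreal (2 * pi)"
    unfolding gauss_kernel_def using assms by (subst nn_integral_eq_integral) auto
  show "(\<integral>\<^sup>+y. ennreal (gauss_kernel c (y - x)) \<partial>lborel) = ennreal (2 * pi)"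
    using nn_integral_real_affine[of "\<lambda>y. ennreal (gauss_kernel c y)" 1 "- x"] 0 by simp
  show "(\<integral>\<^sup>+y. ennreal (gauss_kernel c (x - y)) \<partial>lborel) = ennreal (2 * pi)"
    using nn_integral_real_affine[of "\<lambda>y. ennreal (gauss_kernel c y)" "-1" x] 0 by simp
qed

text \<open>The weight makes everything absolutely convergent, and \<open>FT_exchange\<close>
  rewrites the left side as the quadratic form of the kernel \<open>gauss_kernel c (y - x)\<close>
  at f. Since this kernel is nonnegative with mass 2 pi in each variable, Schur's test gives the
  constant.\<close>

lemma gauss_weighted_FT_bound:
  assumes c: "c > 0" and f: "integrable lborel f" and f2: "f \<in> L2"
  shows "(\<integral>\<^sup>+\<xi>. ennreal (gauss_weight c \<xi> * (cmod (FT f \<xi>))\<^sup>2) \<partial>lborel)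
    \<le> ennreal (2 * pi) * (\<integral>\<^sup>+x. ennreal ((cmod (f x))\<^sup>2) \<partial>lborel)"
proof -
  have [measurable]: "f \<in> borel_measurable borel" using f by auto
  have w0: "0 \<le> gauss_weight c \<xi>" for \<xi> by (simp add: gauss_weight_def)
  have k0: "0 \<le> gauss_kernel c t" for t by (simp add: gauss_kernel_def)
  define N where "N = (LINT x|lborel. cmod (f x))"
  have N0: "0 \<le> N" unfolding N_def by simp
  define G where "G \<xi> = of_real (gauss_weight c \<xi>) * cnj (FT f \<xi>)" for \<xi>
  have [measurable]: "G \<in> borel_measurable borel" unfolding G_def[abs_def] by measurable
  have G: "integrable lborel G"
  proof (rule Bochner_Integration.integrable_bound)
    show "integrable lborel (\<lambda>\<xi>. gauss_weight c \<xi> * N)"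
      using gauss_weight_integrable[OF c] by simp
    show "AE \<xi> in lborel. norm (G \<xi>) \<le> norm (gauss_weight c \<xi> * N)"
      using FT_bound[of f] N0 w0 unfolding G_def N_def
      by (auto simp: norm_mult abs_mult intro!: mult_left_mono AE_I2)
  qed measurable
  \<comment> \<open>\<open>FT_exchange\<close> a second time, now against the modulated weight: the
    transform of G is the conjugate of a Gaussian average of f.\<close>
  have FTG: "FT G x = cnj (LINT y|lborel. f y * of_real (gauss_kernel c (y - x)))" for x
  proof -
    let ?e = "\<lambda>\<xi>. exp (- (\<i> * of_real (- x * \<xi>))) * of_real (gauss_weight c \<xi>)"
    have e: "integrable lborel ?e"
    proof (rule Bochner_Integration.integrable_bound[OF gauss_weight_integrable[OF c]])
      show "AE \<xi> in lborel. norm (?e \<xi>) \<le> norm (gauss_weight c \<xi>)"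
        unfolding norm_mult cmod_FT_kernel by simp
    qed measurable
    have "FT G x = (LINT \<xi>|lborel. cnj (FT f \<xi> * ?e \<xi>))"
      unfolding FT_def[of G] G_def
      by (intro Bochner_Integration.integral_cong) (simp_all add: exp_cnj ac_simps)
    also have "\<dots> = cnj (LINT \<xi>|lborel. FT f \<xi> * ?e \<xi>)"
      by (rule Bochner_Integration.integral_cnj)
    also have "(LINT \<xi>|lborel. FT f \<xi> * ?e \<xi>) = (LINT y|lborel. f y * FT ?e y)"
      by (rule FT_exchange[OF f e])
    also have "\<dots> = (LINT y|lborel. f y * of_real (gauss_kernel c (y - x)))"
      unfolding FT_modulate FT_gauss_weight[OF c] by simp
    finally show ?thesis .
  qed
  have int: "integrable lborel (\<lambda>\<xi>. gauss_weight c \<xi> * (cmod (FT f \<xi>))\<^sup>2)"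
  proof (rule Bochner_Integration.integrable_bound)
    show "integrable lborel (\<lambda>\<xi>. gauss_weight c \<xi> * N\<^sup>2)"
      using gauss_weight_integrable[OF c] by simp
    show "AE \<xi> in lborel. norm (gauss_weight c \<xi> * (cmod (FT f \<xi>))\<^sup>2) \<le> norm (gauss_weight c \<xi> * N\<^sup>2)"
      using FT_bound[of f] N0 w0 unfolding N_def
      by (auto simp: norm_mult abs_mult intro!: mult_left_mono AE_I2 power_mono)
  qed measurable
  have "of_real (LINT \<xi>|lborel. gauss_weight c \<xi> * (cmod (FT f \<xi>))\<^sup>2) = (LINT \<xi>|lborel. FT f \<xi> * G \<xi>)"
    unfolding integral_complex_of_real[symmetric] G_def
    by (intro Bochner_Integration.integral_cong) (simp_all add: complex_norm_square ac_simps del: of_real_power)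
  also have "\<dots> = (LINT x|lborel. f x * FT G x)" by (rule FT_exchange[OF f G])
  finally have eq: "cmod (LINT x|lborel. f x * FT G x) = (LINT \<xi>|lborel. gauss_weight c \<xi> * (cmod (FT f \<xi>))\<^sup>2)"
    using w0 by (metis (no_types, lifting) Bochner_Integration.integral_nonneg norm_of_real abs_of_nonneg mult_nonneg_nonneg zero_le_power2)
  have "(\<integral>\<^sup>+\<xi>. ennreal (gauss_weight c \<xi> * (cmod (FT f \<xi>))\<^sup>2) \<partial>lborel) = ennreal (cmod (LINT x|lborel. f x * FT G x))"
    unfolding eq using int w0 by (intro nn_integral_eq_integral) auto
  \<comment> \<open>If the integrand is not integrable, its Bochner integral is 0 by convention and
    the bound is trivial.\<close>
  also have "\<dots> \<le> (\<integral>\<^sup>+x. ennreal (cmod (f x * FT G x)) \<partial>lborel)"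
  proof (cases "integrable lborel (\<lambda>x. f x * FT G x)")
    case True then show ?thesis by (rule integral_norm_bound_ennreal)
  qed (simp add: not_integrable_integral_eq)
  \<comment> \<open>The product of the moduli at x and y is split by the inequality between
    arithmetic and geometric mean, after which each half contains the kernel integrated over the
    free variable.\<close>
  also have "\<dots> \<le> (\<integral>\<^sup>+x. (\<integral>\<^sup>+y. ennreal (((cmod (f x))\<^sup>2 / 2 + (cmod (f y))\<^sup>2 / 2) * gauss_kernel c (y - x)) \<partial>lborel) \<partial>lborel)"
  proof (rule nn_integral_mono)
    fix x :: real
    let ?I = "LINT y|lborel. f y * of_real (gauss_kernel c (y - x))"
    have "ennreal (cmod ?I) \<le> (\<integral>\<^sup>+y. ennreal (cmod (f y * of_real (gauss_kernel c (y - x)))) \<partial>lborel)"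
    proof (cases "integrable lborel (\<lambda>y. f y * of_real (gauss_kernel c (y - x)))")
      case True then show ?thesis by (rule integral_norm_bound_ennreal)
    qed (simp add: not_integrable_integral_eq)
    then have "ennreal (cmod (f x)) * ennreal (cmod ?I) \<le>
        ennreal (cmod (f x)) * (\<integral>\<^sup>+y. ennreal (cmod (f y * of_real (gauss_kernel c (y - x)))) \<partial>lborel)"
      by (intro mult_left_mono) auto
    also have "\<dots> = (\<integral>\<^sup>+y. ennreal (cmod (f x)) * ennreal (cmod (f y * of_real (gauss_kernel c (y - x)))) \<partial>lborel)"
      by (rule nn_integral_cmult[symmetric]) measurable
    also have "\<dots> \<le> (\<integral>\<^sup>+y. ennreal (((cmod (f x))\<^sup>2 / 2 + (cmod (f y))\<^sup>2 / 2) * gauss_kernel c (y - x)) \<partial>lborel)"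
    proof (rule nn_integral_mono)
      fix y :: real
      have "cmod (f x) * cmod (f y) \<le> (cmod (f x))\<^sup>2 / 2 + (cmod (f y))\<^sup>2 / 2"
        using sum_squares_bound[of "cmod (f x)" "cmod (f y)"] by simp
      then have "cmod (f x) * cmod (f y) * gauss_kernel c (y - x) \<le>
          ((cmod (f x))\<^sup>2 / 2 + (cmod (f y))\<^sup>2 / 2) * gauss_kernel c (y - x)"
        using k0 by (rule mult_right_mono)
      then show "ennreal (cmod (f x)) * ennreal (cmod (f y * of_real (gauss_kernel c (y - x)))) \<le>
          ennreal (((cmod (f x))\<^sup>2 / 2 + (cmod (f y))\<^sup>2 / 2) * gauss_kernel c (y - x))"
        using k0[of "y - x"] by (simp add: ennreal_mult[symmetric] norm_mult mult.assoc ennreal_leI)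
    qed
    finally show "ennreal (cmod (f x * FT G x)) \<le>
      (\<integral>\<^sup>+y. ennreal (((cmod (f x))\<^sup>2 / 2 + (cmod (f y))\<^sup>2 / 2) * gauss_kernel c (y - x)) \<partial>lborel)"
      unfolding FTG norm_mult complex_mod_cnj by (simp add: ennreal_mult)
  qed
  also have "\<dots> = (\<integral>\<^sup>+x. (\<integral>\<^sup>+y. ennreal ((cmod (f x))\<^sup>2 / 2) * ennreal (gauss_kernel c (y - x)) \<partial>lborel) \<partial>lborel)
      + (\<integral>\<^sup>+x. (\<integral>\<^sup>+y. ennreal ((cmod (f y))\<^sup>2 / 2) * ennreal (gauss_kernel c (y - x)) \<partial>lborel) \<partial>lborel)"
  proof -
    have "ennreal ((a\<^sup>2 / 2 + b\<^sup>2 / 2) * gauss_kernel c t) =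
        ennreal (a\<^sup>2 / 2) * ennreal (gauss_kernel c t) + ennreal (b\<^sup>2 / 2) * ennreal (gauss_kernel c t)" for a b t
      using k0[of t] by (simp add: ennreal_mult[symmetric] ennreal_plus[symmetric] distrib_right del: ennreal_plus)
    then show ?thesis by (simp only:) (simp add: nn_integral_add)
  qed
  also have "(\<integral>\<^sup>+x. (\<integral>\<^sup>+y. ennreal ((cmod (f y))\<^sup>2 / 2) * ennreal (gauss_kernel c (y - x)) \<partial>lborel) \<partial>lborel)
      = (\<integral>\<^sup>+y. (\<integral>\<^sup>+x. ennreal ((cmod (f y))\<^sup>2 / 2) * ennreal (gauss_kernel c (y - x)) \<partial>lborel) \<partial>lborel)"
    by (rule lborel_pair.Fubini'[symmetric]) measurable
  also have "\<dots> = (\<integral>\<^sup>+y. ennreal ((cmod (f y))\<^sup>2 / 2) * ennreal (2 * pi) \<partial>lborel)"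
    by (simp add: nn_integral_cmult gauss_kernel_nn[OF c])
  also have "(\<integral>\<^sup>+x. (\<integral>\<^sup>+y. ennreal ((cmod (f x))\<^sup>2 / 2) * ennreal (gauss_kernel c (y - x)) \<partial>lborel) \<partial>lborel)
      = (\<integral>\<^sup>+y. ennreal ((cmod (f y))\<^sup>2 / 2) * ennreal (2 * pi) \<partial>lborel)"
    by (simp add: nn_integral_cmult gauss_kernel_nn[OF c])
  also have "(\<integral>\<^sup>+y. ennreal ((cmod (f y))\<^sup>2 / 2) * ennreal (2 * pi) \<partial>lborel) + (\<integral>\<^sup>+y. ennreal ((cmod (f y))\<^sup>2 / 2) * ennreal (2 * pi) \<partial>lborel)
      = (\<integral>\<^sup>+y. ennreal (2 * pi) * ennreal ((cmod (f y))\<^sup>2) \<partial>lborel)"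
    by (subst nn_integral_add[symmetric]) (auto simp: ennreal_mult[symmetric] ennreal_plus[symmetric] simp del: ennreal_plus intro!: nn_integral_cong)
  also have "\<dots> = ennreal (2 * pi) * (\<integral>\<^sup>+x. ennreal ((cmod (f x))\<^sup>2) \<partial>lborel)"
    by (rule nn_integral_cmult) measurable
  finally show ?thesis .
qed

text \<open>The weight tends to 1 as its width grows, and Fatou's lemma removes it. An inequality
  suffices for the extension to L^2; equality is a consequence of the inversion formula.\<close>

lemma FT_L2_bound:
  assumes f: "integrable lborel f" and f2: "f \<in> L2"
  shows "(\<integral>\<^sup>+\<xi>. ennreal ((cmod (FT f \<xi>))\<^sup>2) \<partial>lborel) \<le> ennreal (2 * pi) * (\<integral>\<^sup>+x. ennreal ((cmod (f x))\<^sup>2) \<partial>lborel)"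
proof -
  have [measurable]: "f \<in> borel_measurable borel" using f by auto
  have lim: "(\<lambda>n. ennreal (gauss_weight (real (Suc n)) \<xi> * (cmod (FT f \<xi>))\<^sup>2)) \<longlonglongrightarrow> ennreal ((cmod (FT f \<xi>))\<^sup>2)" for \<xi>
  proof -
    have "(\<lambda>n. \<xi> * inverse (real (Suc n))) \<longlonglongrightarrow> \<xi> * 0"
      by (intro tendsto_mult tendsto_const LIMSEQ_inverse_real_of_nat)
    then have "(\<lambda>n. \<xi> / real (Suc n)) \<longlonglongrightarrow> 0" by (simp add: divide_inverse)
    then have "(\<lambda>n. gauss_weight (real (Suc n)) \<xi> * (cmod (FT f \<xi>))\<^sup>2) \<longlonglongrightarrow> exp (- 0\<^sup>2 / 2) * (cmod (FT f \<xi>))\<^sup>2"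
      unfolding gauss_weight_def by (intro tendsto_intros) simp_all
    then show ?thesis by (intro tendsto_ennrealI) simp
  qed
  have "(\<integral>\<^sup>+\<xi>. ennreal ((cmod (FT f \<xi>))\<^sup>2) \<partial>lborel) =
     (\<integral>\<^sup>+\<xi>. liminf (\<lambda>n. ennreal (gauss_weight (real (Suc n)) \<xi> * (cmod (FT f \<xi>))\<^sup>2)) \<partial>lborel)"
    by (intro nn_integral_cong lim_imp_Liminf[OF sequentially_bot lim, symmetric])
  also have "\<dots> \<le> liminf (\<lambda>n. \<integral>\<^sup>+\<xi>. ennreal (gauss_weight (real (Suc n)) \<xi> * (cmod (FT f \<xi>))\<^sup>2) \<partial>lborel)"
    by (intro nn_integral_liminf) measurable
  also have "\<dots> \<le> ennreal (2 * pi) * (\<integral>\<^sup>+x. ennreal ((cmod (f x))\<^sup>2) \<partial>lborel)"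
    by (rule Liminf_le) (auto intro!: always_eventually gauss_weighted_FT_bound f f2)
  finally show ?thesis .
qed

lemma FT_L2:
  assumes f: "integrable lborel f" and f2: "f \<in> L2"
  shows "FT f \<in> L2"
proof (rule L2_nn_finite)
  show "FT f \<in> borel_measurable borel" using f2 by measurable
  have "ennreal (2 * pi) * (\<integral>\<^sup>+x. ennreal ((cmod (f x))\<^sup>2) \<partial>lborel) < \<infinity>"
    unfolding L2_nn_eq[OF f2] by (simp add: ennreal_mult_less_top)
  with FT_L2_bound[OF f f2] show "(\<integral>\<^sup>+x. ennreal ((cmod (FT f x))\<^sup>2) \<partial>lborel) < \<infinity>"
    by (rule le_less_trans)
qed

lemma norm_FT_le:
  assumes f: "integrable lborel f" and f2: "f \<in> L2"
  shows "norm (l2_cls (FT f)) \<le> sqrt (2 * pi) * norm (l2_cls f)"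
proof -
  have "ennreal ((norm (l2_cls (FT f)))\<^sup>2) \<le> ennreal (2 * pi) * ennreal ((norm (l2_cls f))\<^sup>2)"
    unfolding norm_l2_cls_nn[OF FT_L2[OF f f2]] norm_l2_cls_nn[OF f2] by (rule FT_L2_bound[OF f f2])
  then have "(norm (l2_cls (FT f)))\<^sup>2 \<le> 2 * pi * (norm (l2_cls f))\<^sup>2"
    by (simp add: ennreal_mult[symmetric])
  also have "\<dots> = (sqrt (2 * pi) * norm (l2_cls f))\<^sup>2"
    by (simp add: power_mult_distrib)
  finally show ?thesis by (rule power2_le_imp_le) simp
qed

section \<open>Extension of the Fourier transform to L^2\<close>

definition FT_trunc :: "real \<Rightarrow> l2 \<Rightarrow> l2" where
  "FT_trunc R a = l2_cls (FT (\<lambda>x. indicator {-R..R} x * l2_fun a x))"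

lemma FT_trunc_diff: "norm (FT_trunc R a - FT_trunc S b) \<le> sqrt (2 * pi) * norm (l2_trunc R a - l2_trunc S b)"
proof -
  let ?f = "\<lambda>x. indicator {-R..R} x * l2_fun a x" and ?g = "\<lambda>x. indicator {-S..S} x * l2_fun b x"
  have f: "integrable lborel ?f" "?f \<in> L2" and g: "integrable lborel ?g" "?g \<in> L2"
    by (auto intro: L2_trunc L2_trunc_integrable)
  have "FT_trunc R a - FT_trunc S b = l2_cls (\<lambda>\<xi>. FT ?f \<xi> - FT ?g \<xi>)"
    unfolding FT_trunc_def l2_cls_diff[OF FT_L2[OF f] FT_L2[OF g]] ..
  also have "(\<lambda>\<xi>. FT ?f \<xi> - FT ?g \<xi>) = FT (\<lambda>x. ?f x - ?g x)"
    by (rule ext) (rule FT_diff[OF f(1) g(1), symmetric])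
  also have "norm (l2_cls (FT (\<lambda>x. ?f x - ?g x))) \<le> sqrt (2 * pi) * norm (l2_cls (\<lambda>x. ?f x - ?g x))"
    by (rule norm_FT_le[OF Bochner_Integration.integrable_diff[OF f(1) g(1)] L2_diff[OF f(2) g(2)]])
  finally show ?thesis
    unfolding l2_cls_diff[OF f(2) g(2)] l2_trunc_cls .
qed

text \<open>A limit along integer truncations suffices for the definition: by
  \<open>FT_trunc_diff\<close> the truncated transforms inherit the Cauchy property, and
  \<open>FT_trunc_tendsto\<close> recovers the limit over real radii demanded by
  \<open>has_L2_fourier\<close>.\<close>

definition l2_FT :: "l2 \<Rightarrow> l2" where
  "l2_FT a = lim (\<lambda>n::nat. FT_trunc (real n) a)"

lemma l2_trunc_tendsto_seq: "(\<lambda>n::nat. l2_trunc (real n) a) \<longlonglongrightarrow> a"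
  by (rule filterlim_compose[OF l2_trunc_tendsto filterlim_real_sequentially])

lemma FT_trunc_tendsto_seq: "(\<lambda>n::nat. FT_trunc (real n) a) \<longlonglongrightarrow> l2_FT a"
proof -
  have "Cauchy (\<lambda>n::nat. FT_trunc (real n) a)"
  proof (rule metric_CauchyI)
    fix e :: real assume "0 < e"
    then have e: "0 < e / sqrt (2 * pi)" by simp
    have "Cauchy (\<lambda>n::nat. l2_trunc (real n) a)"
      by (rule LIMSEQ_imp_Cauchy[OF l2_trunc_tendsto_seq])
    from metric_CauchyD[OF this e] obtain M where
      M: "\<And>m n. m \<ge> M \<Longrightarrow> n \<ge> M \<Longrightarrow> dist (l2_trunc (real m) a) (l2_trunc (real n) a) < e / sqrt (2 * pi)"
      by blast
    have "dist (FT_trunc (real m) a) (FT_trunc (real n) a) < e" if "m \<ge> M" "n \<ge> M" for m n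
    proof -
      have "dist (FT_trunc (real m) a) (FT_trunc (real n) a) \<le> sqrt (2 * pi) * dist (l2_trunc (real m) a) (l2_trunc (real n) a)"
        unfolding dist_norm by (rule FT_trunc_diff)
      also have "\<dots> < sqrt (2 * pi) * (e / sqrt (2 * pi))"
        by (rule mult_strict_left_mono[OF M[OF that]]) simp
      finally show ?thesis by simp
    qed
    then show "\<exists>M. \<forall>m\<ge>M. \<forall>n\<ge>M. dist (FT_trunc (real m) a) (FT_trunc (real n) a) < e" by blast
  qed
  then show ?thesis
    unfolding l2_FT_def by (simp add: Cauchy_convergent_iff convergent_LIMSEQ_iff)
qed

lemma l2_FT_close: "norm (FT_trunc R a - l2_FT b) \<le> sqrt (2 * pi) * norm (l2_trunc R a - b)"
proof (rule LIMSEQ_le)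
  show "(\<lambda>n. norm (FT_trunc R a - FT_trunc (real n) b)) \<longlonglongrightarrow> norm (FT_trunc R a - l2_FT b)"
    by (intro tendsto_intros FT_trunc_tendsto_seq)
  show "(\<lambda>n. sqrt (2 * pi) * norm (l2_trunc R a - l2_trunc (real n) b)) \<longlonglongrightarrow> sqrt (2 * pi) * norm (l2_trunc R a - b)"
    by (intro tendsto_intros l2_trunc_tendsto_seq)
  show "\<exists>N. \<forall>n\<ge>N. norm (FT_trunc R a - FT_trunc (real n) b) \<le> sqrt (2 * pi) * norm (l2_trunc R a - l2_trunc (real n) b)"
    using FT_trunc_diff by blast
qed

lemma FT_trunc_tendsto: "((\<lambda>R. FT_trunc R a) \<longlongrightarrow> l2_FT a) at_top"
proof (rule LIM_zero_cancel, rule Lim_null_comparison)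
  show "\<forall>\<^sub>F R in at_top. norm (FT_trunc R a - l2_FT a) \<le> sqrt (2 * pi) * norm (l2_trunc R a - a)"
    by (intro always_eventually allI l2_FT_close)
  have "((\<lambda>R. sqrt (2 * pi) * norm (l2_trunc R a - a)) \<longlongrightarrow> sqrt (2 * pi) * norm (a - a)) at_top"
    by (intro tendsto_intros l2_trunc_tendsto)
  then show "((\<lambda>R. sqrt (2 * pi) * norm (l2_trunc R a - a)) \<longlongrightarrow> 0) at_top" by simp
qed

lemma FT_trunc_add: "FT_trunc R (a + b) = FT_trunc R a + FT_trunc R b"
proof -
  let ?f = "\<lambda>x. indicator {-R..R} x * l2_fun a x" and ?g = "\<lambda>x. indicator {-R..R} x * l2_fun b x"
  have f: "integrable lborel ?f" "?f \<in> L2" and g: "integrable lborel ?g" "?g \<in> L2"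
    by (auto intro: L2_trunc L2_trunc_integrable)
  have "FT (\<lambda>x. indicator {-R..R} x * l2_fun (a + b) x) = FT (\<lambda>x. ?f x + ?g x)"
  proof (rule FT_cong_AE)
    show "AE x in lborel. indicator {-R..R} x * l2_fun (a + b) x = ?f x + ?g x"
      using l2_fun_plus[of a b] by eventually_elim (simp add: algebra_simps)
  qed measurable
  also have "\<dots> = (\<lambda>\<xi>. FT ?f \<xi> + FT ?g \<xi>)"
    by (rule ext) (rule FT_add[OF f(1) g(1)])
  finally show ?thesis
    unfolding FT_trunc_def l2_cls_add[OF FT_L2[OF f] FT_L2[OF g], symmetric] by simp
qed

lemma FT_trunc_scaleR: "FT_trunc R (r *\<^sub>R a) = r *\<^sub>R FT_trunc R a"
proof -
  let ?f = "\<lambda>x. indicator {-R..R} x * l2_fun a x"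
  have f: "integrable lborel ?f" "?f \<in> L2"
    by (auto intro: L2_trunc L2_trunc_integrable)
  have "FT (\<lambda>x. indicator {-R..R} x * l2_fun (r *\<^sub>R a) x) = FT (\<lambda>x. of_real r * ?f x)"
  proof (rule FT_cong_AE)
    show "AE x in lborel. indicator {-R..R} x * l2_fun (r *\<^sub>R a) x = of_real r * ?f x"
      using l2_fun_scaleR[of r a] by eventually_elim (simp add: algebra_simps)
  qed measurable
  also have "\<dots> = (\<lambda>\<xi>. of_real r * FT ?f \<xi>)"
    by (rule ext) (rule FT_cmult)
  finally show ?thesis
    unfolding FT_trunc_def l2_mul_const_scaleR[symmetric]
    by (simp add: l2_mul_cls[OF bdd_mult_const FT_L2[OF f]])
qed

lemma l2_FT_cls:
  assumes f2: "f \<in> L2" and f: "integrable lborel f"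
  shows "l2_FT (l2_cls f) = l2_cls (FT f)"
proof (rule LIMSEQ_unique)
  show "(\<lambda>n. FT_trunc (real n) (l2_cls f)) \<longlonglongrightarrow> l2_FT (l2_cls f)" by (rule FT_trunc_tendsto_seq)
  show "(\<lambda>n. FT_trunc (real n) (l2_cls f)) \<longlonglongrightarrow> l2_cls (FT f)"
  proof (rule LIM_zero_cancel, rule Lim_null_comparison)
    have "norm (FT_trunc R (l2_cls f) - l2_cls (FT f)) \<le> sqrt (2 * pi) * norm (l2_trunc R (l2_cls f) - l2_cls f)" for R
    proof -
      let ?g = "\<lambda>x. indicator {-R..R} x * f x"
      have g: "integrable lborel ?g" "?g \<in> L2" using f2 by (auto intro: L2_trunc L2_trunc_integrable)
      have 1: "FT_trunc R (l2_cls f) = l2_cls (FT ?g)"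
        unfolding FT_trunc_def
      proof (rule arg_cong[where f = l2_cls], rule FT_cong_AE)
        show "AE x in lborel. indicator {-R..R} x * l2_fun (l2_cls f) x = indicator {-R..R} x * f x"
          using l2_fun_cls[OF f2] by eventually_elim simp
      qed (use f2 in measurable)
      have "l2_cls (FT ?g) - l2_cls (FT f) = l2_cls (\<lambda>\<xi>. FT ?g \<xi> - FT f \<xi>)"
        unfolding l2_cls_diff[OF FT_L2[OF g] FT_L2[OF f f2]] ..
      also have "(\<lambda>\<xi>. FT ?g \<xi> - FT f \<xi>) = FT (\<lambda>x. ?g x - f x)"
        by (rule ext) (rule FT_diff[OF g(1) f, symmetric])
      also have "norm (l2_cls (FT (\<lambda>x. ?g x - f x))) \<le> sqrt (2 * pi) * norm (l2_cls (\<lambda>x. ?g x - f x))"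
        by (rule norm_FT_le[OF Bochner_Integration.integrable_diff[OF g(1) f] L2_diff[OF g(2) f2]])
      finally show ?thesis
        unfolding 1 l2_cls_diff[OF g(2) f2]
        unfolding l2_trunc_def l2_mul_cls[OF bdd_mult_indicator[of "{-R..R}"] f2, OF atLeastAtMost_borel] .
    qed
    then show "\<forall>\<^sub>F n in sequentially. norm (FT_trunc (real n) (l2_cls f) - l2_cls (FT f)) \<le>
        sqrt (2 * pi) * norm (l2_trunc (real n) (l2_cls f) - l2_cls f)" by simp
    have "(\<lambda>n. sqrt (2 * pi) * norm (l2_trunc (real n) (l2_cls f) - l2_cls f)) \<longlonglongrightarrow> sqrt (2 * pi) * norm (l2_cls f - l2_cls f)"
      by (intro tendsto_intros l2_trunc_tendsto_seq)
    then show "(\<lambda>n. sqrt (2 * pi) * norm (l2_trunc (real n) (l2_cls f) - l2_cls f)) \<longlonglongrightarrow> 0" by simp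
  qed
qed

lemma bounded_linear_l2_FT: "bounded_linear l2_FT"
proof (rule bounded_linear_intro[where K = "sqrt (2 * pi)"])
  fix a b :: l2 and r :: real
  show "l2_FT (a + b) = l2_FT a + l2_FT b"
  proof (rule LIMSEQ_unique)
    show "(\<lambda>n. FT_trunc (real n) (a + b)) \<longlonglongrightarrow> l2_FT (a + b)" by (rule FT_trunc_tendsto_seq)
    show "(\<lambda>n. FT_trunc (real n) (a + b)) \<longlonglongrightarrow> l2_FT a + l2_FT b"
      unfolding FT_trunc_add by (intro tendsto_add FT_trunc_tendsto_seq)
  qed
  show "l2_FT (r *\<^sub>R a) = r *\<^sub>R l2_FT a"
  proof (rule LIMSEQ_unique)
    show "(\<lambda>n. FT_trunc (real n) (r *\<^sub>R a)) \<longlonglongrightarrow> l2_FT (r *\<^sub>R a)" by (rule FT_trunc_tendsto_seq)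
    show "(\<lambda>n. FT_trunc (real n) (r *\<^sub>R a)) \<longlonglongrightarrow> r *\<^sub>R l2_FT a"
      unfolding FT_trunc_scaleR by (intro tendsto_intros FT_trunc_tendsto_seq)
  qed
  have 0: "FT_trunc R 0 = 0" for R
    using FT_trunc_scaleR[of R 0 0] by simp
  have 1: "l2_trunc R 0 = 0" for R
    unfolding l2_trunc_def
    by (rule bounded_linear.linear[THEN linear_0, OF bounded_linear_l2_mul]) (simp add: bdd_mult_indicator)
  show "norm (l2_FT a) \<le> norm a * sqrt (2 * pi)"
    using l2_FT_close[of 0 0 a] unfolding 0 1 by (simp add: mult.commute)
qed

text \<open>Density is applied in one argument at a time; on integrable functions the claim is
  \<open>FT_exchange\<close>.\<close>

lemma l2_pair_FT: "l2_pair (l2_FT a) b = l2_pair a (l2_FT b)"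
proof (rule l2_dense_eq[of "\<lambda>a. l2_pair (l2_FT a) b" "\<lambda>a. l2_pair a (l2_FT b)"])
  fix f assume f: "f \<in> L2" "integrable lborel f"
  show "l2_pair (l2_FT (l2_cls f)) b = l2_pair (l2_cls f) (l2_FT b)"
  proof (rule l2_dense_eq[of "\<lambda>b. l2_pair (l2_FT (l2_cls f)) b" "\<lambda>b. l2_pair (l2_cls f) (l2_FT b)"])
    fix g assume g: "g \<in> L2" "integrable lborel g"
    show "l2_pair (l2_FT (l2_cls f)) (l2_cls g) = l2_pair (l2_cls f) (l2_FT (l2_cls g))"
      unfolding l2_FT_cls[OF f] l2_FT_cls[OF g] l2_pair_cls[OF FT_L2[OF f(2,1)] g(1)]
        l2_pair_cls[OF f(1) FT_L2[OF g(2,1)]]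
      by (rule FT_exchange[OF f(2) g(2)])
  qed (rule l2_pair.bounded_linear_right bounded_linear_compose[OF l2_pair.bounded_linear_right bounded_linear_l2_FT])+
qed (rule l2_pair.bounded_linear_left bounded_linear_compose[OF l2_pair.bounded_linear_left bounded_linear_l2_FT])+

lemma l2_FT_refl: "l2_FT (l2_refl a) = l2_refl (l2_FT a)"
proof (rule l2_dense_eq[of "\<lambda>a. l2_FT (l2_refl a)" "\<lambda>a. l2_refl (l2_FT a)"])
  fix f assume f: "f \<in> L2" "integrable lborel f"
  have "integrable lborel (\<lambda>x. f (- x))"
    using lborel_integrable_real_affine[OF f(2), of "-1" 0] by simp
  then show "l2_FT (l2_refl (l2_cls f)) = l2_refl (l2_FT (l2_cls f))"
    unfolding l2_refl_cls[OF f(1)] l2_FT_cls[OF f] l2_refl_cls[OF FT_L2[OF f(2,1)]] FT_refl[of f, symmetric]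
    by (rule l2_FT_cls[OF L2_refl[OF f(1)]])
qed (rule bounded_linear_compose[OF bounded_linear_l2_FT bounded_linear_l2_refl]
     bounded_linear_compose[OF bounded_linear_l2_refl bounded_linear_l2_FT])+

lemma l2_FT_cnj: "l2_FT (l2_cnj a) = l2_refl (l2_cnj (l2_FT a))"
proof (rule l2_dense_eq[of "\<lambda>a. l2_FT (l2_cnj a)" "\<lambda>a. l2_refl (l2_cnj (l2_FT a))"])
  fix f assume f: "f \<in> L2" "integrable lborel f"
  have "integrable lborel (\<lambda>x. cnj (f x))" using f(2) by simp
  then show "l2_FT (l2_cnj (l2_cls f)) = l2_refl (l2_cnj (l2_FT (l2_cls f)))"
    unfolding l2_cnj_cls[OF f(1)] l2_FT_cls[OF f] l2_cnj_cls[OF FT_L2[OF f(2,1)]]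
      l2_refl_cls[OF L2_cnj[OF FT_L2[OF f(2,1)]]] FT_cnj[of f, symmetric]
    by (rule l2_FT_cls[OF L2_cnj[OF f(1)]])
next
  show "bounded_linear (\<lambda>a. l2_refl (l2_cnj (l2_FT a)))"
    by (rule bounded_linear_compose[OF bounded_linear_l2_refl bounded_linear_compose[OF bounded_linear_l2_cnj bounded_linear_l2_FT]])
qed (rule bounded_linear_compose[OF bounded_linear_l2_FT bounded_linear_l2_cnj])

lemma bdd_mult_kernel: "bdd_mult (\<lambda>x. exp (- (\<i> * of_real (c * x))))"
proof (rule bdd_multI[of _ 1])
  show "cmod (exp (- (\<i> * of_real (c * x)))) \<le> 1" for x
    unfolding cmod_FT_kernel by simp
qed measurable

lemma l2_FT_modulate:
  "l2_FT (l2_mul (\<lambda>x. exp (- (\<i> * of_real (c * x)))) a) = l2_shift c (l2_FT a)"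
proof (rule l2_dense_eq[of "\<lambda>a. l2_FT (l2_mul (\<lambda>x. exp (- (\<i> * of_real (c * x)))) a)" "\<lambda>a. l2_shift c (l2_FT a)"])
  fix f assume f: "f \<in> L2" "integrable lborel f"
  have "integrable lborel (\<lambda>x. exp (- (\<i> * of_real (c * x))) * f x)"
    using FT_kernel_integrable[OF f(2), of c] by (simp add: mult.commute)
  then show "l2_FT (l2_mul (\<lambda>x. exp (- (\<i> * of_real (c * x)))) (l2_cls f)) = l2_shift c (l2_FT (l2_cls f))"
    unfolding l2_mul_cls[OF bdd_mult_kernel f(1)] l2_FT_cls[OF f]
      l2_shift_cls[OF FT_L2[OF f(2,1)]] FT_modulate[of c f, symmetric]
    by (rule l2_FT_cls[OF L2_bdd_mult[OF bdd_mult_kernel f(1)]])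
qed (rule bounded_linear_compose[OF bounded_linear_l2_FT bounded_linear_l2_mul[OF bdd_mult_kernel]]
     bounded_linear_compose[OF bounded_linear_l2_shift bounded_linear_l2_FT])+

text \<open>The bridge to the given definition: its nonnegative integral is the squared distance of
  the truncated transform from F, so its limit is 0 exactly if F represents \<open>l2_FT\<close>. In
  particular the chosen \<open>L2_fourier\<close> has a well-defined class.\<close>

lemma has_L2_fourier_iff:
  "has_L2_fourier f F \<longleftrightarrow> f \<in> L2 \<and> F \<in> L2 \<and> l2_cls F = l2_FT (l2_cls f)"
proof (cases "f \<in> L2 \<and> F \<in> L2")
  case True
  then have f: "f \<in> L2" and F: "F \<in> L2" by auto
  have eq: "(\<integral>\<^sup>+\<xi>. ennreal ((cmod ((LINT x:{-R..R}|lborel. f x * exp (- (\<i> * of_real (x * \<xi>)))) - F \<xi>))\<^sup>2) \<partial>lborel)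
      = ennreal ((norm (FT_trunc R (l2_cls f) - l2_cls F))\<^sup>2)" for R
  proof -
    let ?g = "\<lambda>x. indicator {-R..R} x * f x"
    have g: "integrable lborel ?g" "?g \<in> L2" using f by (auto intro: L2_trunc L2_trunc_integrable)
    have 1: "FT_trunc R (l2_cls f) = l2_cls (FT ?g)"
      unfolding FT_trunc_def
    proof (rule arg_cong[where f = l2_cls], rule FT_cong_AE)
      show "AE x in lborel. indicator {-R..R} x * l2_fun (l2_cls f) x = indicator {-R..R} x * f x"
        using l2_fun_cls[OF f] by eventually_elim simp
    qed (use f in measurable)
    have 2: "(LINT x:{-R..R}|lborel. f x * exp (- (\<i> * of_real (x * \<xi>)))) = FT ?g \<xi>" for \<xi>
      unfolding set_lebesgue_integral_def FT_def
      by (rule Bochner_Integration.integral_cong) (auto simp: indicator_def)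
    show ?thesis
      unfolding 1 2 by (rule norm_l2_cls_diff_nn[OF FT_L2[OF g] F, symmetric])
  qed
  have "((\<lambda>R. ennreal ((norm (FT_trunc R (l2_cls f) - l2_cls F))\<^sup>2)) \<longlongrightarrow> 0) at_top
      \<longleftrightarrow> l2_cls F = l2_FT (l2_cls f)"
  proof
    assume "l2_cls F = l2_FT (l2_cls f)"
    then have "((\<lambda>R. ennreal ((norm (FT_trunc R (l2_cls f) - l2_cls F))\<^sup>2)) \<longlongrightarrow> ennreal ((norm (l2_cls F - l2_cls F))\<^sup>2)) at_top"
      using FT_trunc_tendsto[of "l2_cls f"] by (intro tendsto_ennrealI tendsto_intros) simp
    then show "((\<lambda>R. ennreal ((norm (FT_trunc R (l2_cls f) - l2_cls F))\<^sup>2)) \<longlongrightarrow> 0) at_top" by simp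
  next
    assume "((\<lambda>R. ennreal ((norm (FT_trunc R (l2_cls f) - l2_cls F))\<^sup>2)) \<longlongrightarrow> 0) at_top"
    moreover have "((\<lambda>R. ennreal ((norm (FT_trunc R (l2_cls f) - l2_cls F))\<^sup>2)) \<longlongrightarrow> ennreal ((norm (l2_FT (l2_cls f) - l2_cls F))\<^sup>2)) at_top"
      by (intro tendsto_ennrealI tendsto_intros FT_trunc_tendsto)
    ultimately have "ennreal ((norm (l2_FT (l2_cls f) - l2_cls F))\<^sup>2) = 0"
      by (intro tendsto_unique[OF trivial_limit_at_top_linorder])
    then show "l2_cls F = l2_FT (l2_cls f)" by simp
  qed
  then show ?thesis unfolding has_L2_fourier_def eq using f F by simp
qed (auto simp: has_L2_fourier_def)

lemma L2_fourier_cls: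
  assumes "f \<in> L2"
  shows "L2_fourier f \<in> L2" "l2_cls (L2_fourier f) = l2_FT (l2_cls f)"
proof -
  have "has_L2_fourier f (l2_fun (l2_FT (l2_cls f)))"
    unfolding has_L2_fourier_iff using assms by simp
  then have "has_L2_fourier f (L2_fourier f)"
    unfolding L2_fourier_def by (rule someI[of "has_L2_fourier f"])
  then show "L2_fourier f \<in> L2" "l2_cls (L2_fourier f) = l2_FT (l2_cls f)"
    unfolding has_L2_fourier_iff by auto
qed

lemma L2_fourier_AE: "f \<in> L2 \<Longrightarrow> AE \<xi> in lborel. L2_fourier f \<xi> = l2_fun (l2_FT (l2_cls f)) \<xi>"
  by (rule l2_cls_eqD) (simp_all add: L2_fourier_cls)

subsection \<open>Inversion formula and Plancherel's theorem\<close>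

text \<open>Positive and negative part are densities of two finite measures that agree on all
  half-lines, hence everywhere; densities are unique up to null sets.\<close>

lemma AE_zero_of_integral_Ioi:
  fixes g :: "real \<Rightarrow> real"
  assumes g: "integrable lborel g"
    and zero: "\<And>x. (LINT y|lborel. indicator {x<..} y * g y) = 0"
  shows "AE x in lborel. g x = 0"
proof -
  have [measurable]: "g \<in> borel_measurable borel" using g by auto
  define p where "p x = max 0 (g x)" for x
  define q where "q x = max 0 (- g x)" for x
  have [measurable]: "p \<in> borel_measurable borel" "q \<in> borel_measurable borel"
    unfolding p_def[abs_def] q_def[abs_def] by measurable
  have int: "integrable lborel (\<lambda>y. indicator {x<..} y * p y)" "integrable lborel (\<lambda>y. indicator {x<..} y * q y)" for x
    by (rule Bochner_Integration.integrable_bound[OF g]; auto simp: p_def q_def indicator_def)+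
  have dens: "emeasure (density lborel (\<lambda>x. ennreal (p x))) {x<..} = ennreal (LINT y|lborel. indicator {x<..} y * p y)" for x
  proof -
    have "emeasure (density lborel (\<lambda>x. ennreal (p x))) {x<..} = (\<integral>\<^sup>+y. ennreal (indicator {x<..} y * p y) \<partial>lborel)"
      by (subst emeasure_density) (auto intro!: nn_integral_cong simp: indicator_def)
    then show ?thesis
      using int(1)[of x] by (subst (asm) nn_integral_eq_integral) (auto simp: p_def)
  qed
  have dens': "emeasure (density lborel (\<lambda>x. ennreal (q x))) {x<..} = ennreal (LINT y|lborel. indicator {x<..} y * q y)" for x
  proof -
    have "emeasure (density lborel (\<lambda>x. ennreal (q x))) {x<..} = (\<integral>\<^sup>+y. ennreal (indicator {x<..} y * q y) \<partial>lborel)"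
      by (subst emeasure_density) (auto intro!: nn_integral_cong simp: indicator_def)
    then show ?thesis
      using int(2)[of x] by (subst (asm) nn_integral_eq_integral) (auto simp: q_def)
  qed
  have "density lborel (\<lambda>x. ennreal (p x)) = density lborel (\<lambda>x. ennreal (q x))"
  proof (rule measure_eqI_lessThan)
    fix x
    show "emeasure (density lborel (\<lambda>x. ennreal (p x))) {x<..} < \<infinity>" unfolding dens by simp
    have "(\<lambda>y. indicator {x<..} y * p y - indicator {x<..} y * q y) = (\<lambda>y. indicator {x<..} y * g y)"
      by (auto simp: p_def q_def indicator_def max_def)
    then have "(LINT y|lborel. indicator {x<..} y * p y) - (LINT y|lborel. indicator {x<..} y * q y) = 0"
      using zero[of x] by (simp flip: Bochner_Integration.integral_diff[OF int(1)[of x] int(2)[of x]])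
    then show "emeasure (density lborel (\<lambda>x. ennreal (p x))) {x<..} = emeasure (density lborel (\<lambda>x. ennreal (q x))) {x<..}"
      unfolding dens dens' by simp
  qed simp_all
  then have "AE x in lborel. ennreal (p x) = ennreal (q x)"
    by (intro sigma_finite_measure.density_unique[OF lborel.sigma_finite_measure_axioms]) simp_all
  then show ?thesis
    by eventually_elim (auto simp: p_def q_def max_def split: if_splits)
qed

text \<open>Cutting to (-n, n] makes the function integrable on the whole line and turns integrals
  over half-lines into integrals over half-open intervals, so the previous criterion applies to real
  and imaginary part.\<close>

lemma AE_zero_of_integral_Ioc:
  fixes W :: "real \<Rightarrow> complex"
  assumes int: "\<And>a b. integrable lborel (\<lambda>x. indicator {a<..b} x * W x)"
    and zero: "\<And>a b. a < b \<Longrightarrow> (LINT x|lborel. indicator {a<..b} x * W x) = 0"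
  shows "AE x in lborel. W x = 0"
proof -
  have "AE x in lborel. indicator {- real n<..real n} x * W x = 0" for n :: nat
  proof -
    let ?G = "\<lambda>x. indicator {- real n<..real n} x * W x"
    have z: "(LINT y|lborel. indicator {x<..} y * ?G y) = 0" for x
    proof -
      have "(\<lambda>y. indicator {x<..} y * ?G y) = (\<lambda>y. indicator {max x (- real n)<..real n} y * W y)"
        by (auto simp: indicator_def)
      then show ?thesis
        using zero[of "max x (- real n)" "real n"] by (cases "max x (- real n) < real n") auto
    qed
    have i: "integrable lborel (\<lambda>y. indicator {x<..} y * ?G y)" for x
    proof -
      have "(\<lambda>y. indicator {x<..} y * ?G y) = (\<lambda>y. indicator {max x (- real n)<..real n} y * W y)"
        by (auto simp: indicator_def)
      then show ?thesis using int by simp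
    qed
    have "AE x in lborel. Re (?G x) = 0"
    proof (rule AE_zero_of_integral_Ioi)
      show "integrable lborel (\<lambda>x. Re (?G x))" by (rule integrable_Re[OF int])
      show "(LINT y|lborel. indicator {x<..} y * Re (?G y)) = 0" for x
      proof -
        have "(\<lambda>y. indicator {x<..} y * Re (?G y)) = (\<lambda>y. Re (indicator {x<..} y * ?G y))"
          by (auto simp: indicator_def)
        then show ?thesis using integral_Re[OF i[of x]] z[of x] by simp
      qed
    qed
    moreover have "AE x in lborel. Im (?G x) = 0"
    proof (rule AE_zero_of_integral_Ioi)
      show "integrable lborel (\<lambda>x. Im (?G x))" by (rule integrable_Im[OF int])
      show "(LINT y|lborel. indicator {x<..} y * Im (?G y)) = 0" for x
      proof -
        have "(\<lambda>y. indicator {x<..} y * Im (?G y)) = (\<lambda>y. Im (indicator {x<..} y * ?G y))"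
          by (auto simp: indicator_def)
        then show ?thesis using integral_Im[OF i[of x]] z[of x] by simp
      qed
    qed
    ultimately show ?thesis by eventually_elim (simp add: complex_eq_iff)
  qed
  then have "AE x in lborel. \<forall>n::nat. indicator {- real n<..real n} x * W x = 0"
    unfolding AE_all_countable by (rule allI)
  then show ?thesis
  proof eventually_elim
    case (elim x)
    obtain n :: nat where "\<bar>x\<bar> < real n" using reals_Archimedean2 by blast
    then have "x \<in> {- real n<..real n}" by auto
    with elim show ?case by (metis indicator_simps(1) mult_1)
  qed
qed

lemma l2_FT_mul_const: "l2_FT (l2_mul (\<lambda>_. c) a) = l2_mul (\<lambda>_. c) (l2_FT a)"
proof (rule l2_dense_eq[of "\<lambda>a. l2_FT (l2_mul (\<lambda>_. c) a)" "\<lambda>a. l2_mul (\<lambda>_. c) (l2_FT a)"])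
  fix f assume f: "f \<in> L2" "integrable lborel f"
  have "integrable lborel (\<lambda>x. c * f x)" using f(2) by simp
  then show "l2_FT (l2_mul (\<lambda>_. c) (l2_cls f)) = l2_mul (\<lambda>_. c) (l2_FT (l2_cls f))"
    unfolding l2_mul_cls[OF bdd_mult_const f(1)] l2_FT_cls[OF f] l2_mul_cls[OF bdd_mult_const FT_L2[OF f(2,1)]]
      FT_cmult[of c f, symmetric]
    by (rule l2_FT_cls[OF L2_cmult[OF f(1)]])
qed (rule bounded_linear_compose[OF bounded_linear_l2_FT bounded_linear_l2_mul[OF bdd_mult_const]]
     bounded_linear_compose[OF bounded_linear_l2_mul[OF bdd_mult_const] bounded_linear_l2_FT])+

lemma l2_refl_mul_const: "l2_refl (l2_mul (\<lambda>_. c) a) = l2_mul (\<lambda>_. c) (l2_refl a)"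
  by (rule l2_eqI, use l2_fun_refl[of a] l2_fun_refl[of "l2_mul (\<lambda>_. c) a"]
     AE_lborel_uminus[OF l2_fun_mul[OF bdd_mult_const, of c a]] l2_fun_mul[OF bdd_mult_const, of c "l2_refl a"]
     in \<open>eventually_elim, simp\<close>)

section \<open>Levy's inversion theorem read as a Parseval identity\<close>

lemma FT_indicator_Ioc:
  assumes "a \<le> b" "t \<noteq> 0"
  shows "FT (indicator {a<..b}) t = (iexp (- (t * a)) - iexp (- (t * b))) / (\<i> * of_real t)"
proof -
  let ?F = "\<lambda>x. - iexp (- (t * x)) / (\<i> * of_real t)"
  have "has_bochner_integral lborel (\<lambda>x. indicator {a..b} x *\<^sub>R exp (- (\<i> * of_real (x * t)))) (?F b - ?F a)"
  proof (rule has_bochner_integral_FTC_Icc[OF assms(1)])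
    fix x :: real
    have "((\<lambda>z. - exp (- (\<i> * of_real t * z)) / (\<i> * of_real t)) has_field_derivative exp (- (\<i> * of_real t * of_real x))) (at (of_real x))"
      using assms(2) by (auto intro!: derivative_eq_intros)
    then have "((\<lambda>x. - exp (- (\<i> * of_real t * of_real x)) / (\<i> * of_real t)) has_vector_derivative exp (- (\<i> * of_real t * of_real x))) (at x within {a..b})"
      by (rule has_vector_derivative_real_field)
    then show "(?F has_vector_derivative exp (- (\<i> * of_real (x * t)))) (at x within {a..b})"
      by (simp add: ac_simps)
  qed (auto intro!: continuous_intros)
  then have "(LINT x|lborel. indicator {a..b} x *\<^sub>R exp (- (\<i> * of_real (x * t)))) = ?F b - ?F a"
    by (rule has_bochner_integral_integral_eq)
  moreover have "FT (indicator {a<..b}) t = (LINT x|lborel. indicator {a..b} x *\<^sub>R exp (- (\<i> * of_real (x * t))))"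
    unfolding FT_def
  proof (rule integral_cong_AE)
    show "AE x in lborel. indicator {a<..b} x * exp (- (\<i> * of_real (x * t))) = indicator {a..b} x *\<^sub>R exp (- (\<i> * of_real (x * t)))"
      using AE_lborel_singleton[of a] by eventually_elim (auto simp: indicator_def)
  qed measurable
  ultimately show ?thesis by (simp add: diff_divide_distrib)
qed

lemma indicator_Ioc_integrable: "integrable lborel (indicator {a<..b::real} :: real \<Rightarrow> complex)"
proof -
  have "integrable lborel (\<lambda>x. complex_of_real (indicator {a<..b} x))"
    by (cases "a \<le> b") auto
  moreover have "(\<lambda>x. complex_of_real (indicator {a<..b} x)) = indicator {a<..b}"
    by (auto simp: indicator_def)
  ultimately show ?thesis by simp
qed

text \<open>The quotient in Levy's inversion formula is the transform of the indicator of (a, b],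
  and the characteristic function is the transform of p reflected. The formula for the probability
  of (a, b] is therefore Parseval's identity for this pair of functions.\<close>

lemma Levy_pair_prob:
  fixes p :: "real \<Rightarrow> real"
  assumes ab: "a < b" and p: "integrable lborel p" "\<And>x. 0 \<le> p x" "(LINT x|lborel. p x) = 1"
    and p2: "(\<lambda>x. complex_of_real (p x)) \<in> L2"
  shows "l2_pair (l2_FT (l2_cls (indicator {a<..b}))) (l2_refl (l2_FT (l2_cls (\<lambda>x. of_real (p x)))))
    = of_real (2 * pi) * l2_pair (l2_cls (indicator {a<..b})) (l2_cls (\<lambda>x. of_real (p x)))"
proof -
  let ?I = "indicator {a<..b} :: real \<Rightarrow> complex" and ?p = "\<lambda>x. complex_of_real (p x)"
  have [measurable]: "p \<in> borel_measurable borel" using p by auto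
  have ip: "integrable lborel ?p" using p by simp
  note iI = indicator_Ioc_integrable[of a b] and I2 = indicator_L2[of a b]
  define M where "M = density lborel (\<lambda>x. ennreal (p x))"
  interpret M: real_distribution M
  proof (intro real_distribution.intro real_distribution_axioms.intro prob_spaceI)
    have "emeasure M (space M) = (\<integral>\<^sup>+x. ennreal (p x) \<partial>lborel)"
      unfolding M_def by (subst emeasure_density) (auto intro!: nn_integral_cong)
    also have "\<dots> = 1" using p by (subst nn_integral_eq_integral) auto
    finally show "emeasure M (space M) = 1" .
  qed (simp add: M_def)
  \<comment> \<open>Levy's formula requires that the end points of the interval carry no
    mass.\<close>
  have null: "measure M {c} = 0" for c
  proof -
    have "emeasure M {c} = (\<integral>\<^sup>+x. ennreal (p x) * indicator {c} x \<partial>lborel)"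
      unfolding M_def by (subst emeasure_density) auto
    also have "\<dots> = (\<integral>\<^sup>+x. 0 \<partial>(lborel :: real measure))"
      by (rule nn_integral_cong_AE) (use AE_lborel_singleton[of c] in \<open>eventually_elim, simp add: indicator_def\<close>)
    finally show ?thesis by (simp add: measure_def)
  qed
  have meas: "measure M {a<..b} = (LINT x|lborel. indicator {a<..b} x * p x)"
  proof -
    have i: "integrable lborel (\<lambda>x. indicator {a<..b} x * p x)"
      by (rule Bochner_Integration.integrable_bound[OF p(1)]) (auto simp: indicator_def)
    have "emeasure M {a<..b} = (\<integral>\<^sup>+x. ennreal (indicator {a<..b} x * p x) \<partial>lborel)"
      unfolding M_def by (subst emeasure_density) (auto intro!: nn_integral_cong simp: indicator_def)
    also have "\<dots> = ennreal (LINT x|lborel. indicator {a<..b} x * p x)"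
      using i p(2) by (intro nn_integral_eq_integral) auto
    finally show ?thesis using p(2) by (simp add: measure_def)
  qed
  have char: "char M t = FT ?p (- t)" for t
  proof -
    have "char M t = (LINT x|lborel. p x *\<^sub>R iexp (t * x))"
      unfolding char_def M_def by (rule integral_density) (use p in auto)
    then show ?thesis unfolding FT_def by (simp add: scaleR_conv_of_real mult.commute[of t])
  qed
  \<comment> \<open>As a product of two square integrable functions, Q is integrable, so the
    principal value in Levy's formula is an ordinary integral.\<close>
  define Q where "Q t = FT ?I t * FT ?p (- t)" for t
  have Q: "integrable lborel Q"
    unfolding Q_def by (rule L2_mult_integrable[OF FT_L2[OF iI I2] L2_refl[OF FT_L2[OF ip p2]]])
  then have [measurable]: "Q \<in> borel_measurable borel" by auto
  have "(\<lambda>T::nat. 1 / (2 * pi) * (CLBINT t=-real T..real T. (iexp (-(t * a)) - iexp (-(t * b))) / (\<i> * t) * char M t))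
    \<longlonglongrightarrow> of_real (measure M {a<..b})"
    using M.Levy_Inversion[of a b] ab null by simp
  moreover have "(CLBINT t=-real T..real T. (iexp (-(t * a)) - iexp (-(t * b))) / (\<i> * t) * char M t)
      = (LINT t|lborel. indicator {-real T..real T} t * Q t)" for T :: nat
  proof -
    have "(CLBINT t=-real T..real T. (iexp (-(t * a)) - iexp (-(t * b))) / (\<i> * t) * char M t)
      = (CLBINT t:{-real T..real T}. (iexp (-(t * a)) - iexp (-(t * b))) / (\<i> * t) * char M t)"
      by (rule interval_integral_Icc) simp
    also have "\<dots> = (LINT t|lborel. indicator {-real T..real T} t * Q t)"
      unfolding set_lebesgue_integral_def
    proof (rule integral_cong_AE)
      \<comment> \<open>At t = 0 the quotient is 0 by the convention for division, whereas the
        transform equals b - a; this point is a null set.\<close>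
      show "AE t in lborel. indicator {- real T..real T} t *\<^sub>R ((iexp (-(t * a)) - iexp (-(t * b))) / (\<i> * t) * char M t)
        = indicator {- real T..real T} t * Q t"
        using AE_lborel_singleton[of 0]
        by eventually_elim (use ab in \<open>auto simp: Q_def char FT_indicator_Ioc indicator_def\<close>)
    qed (use M.char_measurable in measurable)
    finally show ?thesis .
  qed
  ultimately have "(\<lambda>T::nat. 1 / (2 * pi) * (LINT t|lborel. indicator {-real T..real T} t * Q t))
    \<longlonglongrightarrow> of_real (measure M {a<..b})" by simp
  moreover have "(\<lambda>T::nat. 1 / (2 * pi) * (LINT t|lborel. indicator {-real T..real T} t * Q t))
    \<longlonglongrightarrow> 1 / (2 * pi) * (LINT t|lborel. Q t)"
  proof (intro tendsto_mult tendsto_const integral_dominated_convergence[where w = "\<lambda>t. cmod (Q t)"])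
    show "integrable lborel (\<lambda>t. cmod (Q t))" using Q by simp
    show "AE t in lborel. norm (indicator {-real T..real T} t * Q t) \<le> cmod (Q t)" for T :: nat
      by (rule AE_I2) (auto simp: indicator_def)
    show "AE t in lborel. (\<lambda>T::nat. indicator {-real T..real T} t * Q t) \<longlonglongrightarrow> Q t"
    proof (rule AE_I2, rule tendsto_eventually)
      fix t :: real
      obtain N :: nat where N: "\<bar>t\<bar> \<le> real N" using real_arch_simple by blast
      show "\<forall>\<^sub>F T in sequentially. indicator {- real T..real T} t * Q t = Q t"
        using eventually_ge_at_top[of N]
      proof eventually_elim
        case (elim T)
        then have "\<bar>t\<bar> \<le> real T" using N by (meson of_nat_le_iff order_trans)
        then show ?case by (auto simp: indicator_def abs_le_iff)
      qed
    qed
  qed measurable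
  ultimately have "1 / (2 * pi) * (LINT t|lborel. Q t) = of_real (measure M {a<..b})"
    using LIMSEQ_unique by blast
  then have "(LINT t|lborel. Q t) = of_real (2 * pi) * of_real (measure M {a<..b})"
    by (simp add: field_simps)
  also have "of_real (measure M {a<..b}) = (LINT x|lborel. ?I x * ?p x)"
  proof -
    have "(\<lambda>x. ?I x * ?p x) = (\<lambda>x. complex_of_real (indicator {a<..b} x * p x))"
      by (auto simp: indicator_def)
    then show ?thesis unfolding meas by (simp only: integral_complex_of_real)
  qed
  finally show ?thesis
    unfolding l2_FT_cls[OF I2 iI] l2_FT_cls[OF p2 ip] l2_refl_cls[OF FT_L2[OF ip p2]]
      l2_pair_cls[OF FT_L2[OF iI I2] L2_refl[OF FT_L2[OF ip p2]]] l2_pair_cls[OF I2 p2] Q_def .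
qed

text \<open>Normalisation by the total mass reduces this to probability densities; mass zero means p
  = 0 almost everywhere.\<close>

lemma Levy_pair_nonneg:
  fixes p :: "real \<Rightarrow> real"
  assumes ab: "a < b" and p: "integrable lborel p" "\<And>x. 0 \<le> p x"
    and p2: "(\<lambda>x. complex_of_real (p x)) \<in> L2"
  shows "l2_pair (l2_FT (l2_cls (indicator {a<..b}))) (l2_refl (l2_FT (l2_cls (\<lambda>x. of_real (p x)))))
    = of_real (2 * pi) * l2_pair (l2_cls (indicator {a<..b})) (l2_cls (\<lambda>x. of_real (p x)))"
proof (cases "(LINT x|lborel. p x) = 0")
  case True
  then have "AE x in lborel. p x = 0"
    using p by (simp add: integral_nonneg_eq_0_iff_AE)
  then have "AE x in lborel. complex_of_real (p x) = 0" by eventually_elim simp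
  then have "l2_cls (\<lambda>x. of_real (p x)) = 0"
    unfolding zero_l2_def by (intro l2_cls_eq p2) auto
  then show ?thesis
    by (simp add: bounded_linear.linear[OF bounded_linear_l2_FT, THEN linear_0]
      bounded_linear.linear[OF bounded_linear_l2_refl, THEN linear_0] l2_pair.zero_right)
next
  case False
  define m where "m = (LINT x|lborel. p x)"
  define q where "q x = p x / m" for x
  have m: "m \<noteq> 0" "m \<ge> 0" using False p(2) by (auto simp: m_def)
  have q2: "(\<lambda>x. complex_of_real (q x)) \<in> L2"
    using L2_cmult[OF p2, of "of_real (1 / m)"] by (simp add: q_def)
  have eq: "l2_cls (\<lambda>x. complex_of_real (p x)) = m *\<^sub>R l2_cls (\<lambda>x. complex_of_real (q x))"
    unfolding l2_mul_const_scaleR[symmetric] l2_mul_cls[OF bdd_mult_const q2]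
    using m by (simp add: q_def)
  have "l2_pair (l2_FT (l2_cls (indicator {a<..b}))) (l2_refl (l2_FT (l2_cls (\<lambda>x. of_real (q x)))))
    = of_real (2 * pi) * l2_pair (l2_cls (indicator {a<..b})) (l2_cls (\<lambda>x. of_real (q x)))"
    by (rule Levy_pair_prob[OF ab _ _ _ q2]) (use p m in \<open>auto simp: q_def m_def[symmetric]\<close>)
  then show ?thesis
    unfolding eq by (simp add: bounded_linear.linear[OF bounded_linear_l2_FT, THEN linear_scale]
      bounded_linear.linear[OF bounded_linear_l2_refl, THEN linear_scale] l2_pair.scaleR_right)
qed

text \<open>By density f may be taken integrable. Both sides are additive and complex homogeneous,
  so f can be split into the positive and negative parts of its real and imaginary part.\<close>

lemma Levy_pair:
  assumes ab: "a < b"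
  shows "l2_pair (l2_FT (l2_cls (indicator {a<..b}))) (l2_refl (l2_FT f))
    = of_real (2 * pi) * l2_pair (l2_cls (indicator {a<..b})) f"
proof -
  let ?S = "\<lambda>f. l2_pair (l2_FT (l2_cls (indicator {a<..b}))) (l2_refl (l2_FT f))"
  let ?T = "\<lambda>f. of_real (2 * pi) * l2_pair (l2_cls (indicator {a<..b})) f"
  have S: "bounded_linear ?S"
    by (rule bounded_linear_compose[OF l2_pair.bounded_linear_right
      bounded_linear_compose[OF bounded_linear_l2_refl bounded_linear_l2_FT]])
  have T: "bounded_linear ?T"
    by (rule bounded_linear_compose[OF bounded_linear_mult_right l2_pair.bounded_linear_right])
  have Si: "?S (l2_mul (\<lambda>_. c) f) = c * ?S f" for c f
    unfolding l2_FT_mul_const l2_refl_mul_const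
    by (simp only: l2_pair_commute[of _ "l2_mul _ _"] l2_pair_mul_const) (simp only: l2_pair_commute)
  have Ti: "?T (l2_mul (\<lambda>_. c) f) = c * ?T f" for c f
    by (simp only: l2_pair_commute[of _ "l2_mul _ _"] l2_pair_mul_const) (simp add: l2_pair_commute)
  show ?thesis
  proof (rule l2_dense_eq[OF S T])
    fix f assume f: "f \<in> L2" "integrable lborel f"
    have [measurable]: "f \<in> borel_measurable borel" using f(1) by measurable
    let ?c = "\<lambda>p. l2_cls (\<lambda>x. complex_of_real (p x))"
    have part: "?S (?c p) = ?T (?c p)" "(\<lambda>x. complex_of_real (p x)) \<in> L2"
      if [measurable]: "p \<in> borel_measurable borel" and p: "\<And>x. 0 \<le> p x" "\<And>x. p x \<le> cmod (f x)" for p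
    proof -
      have 1: "integrable lborel p"
        by (rule Bochner_Integration.integrable_bound[OF integrable_norm[OF f(2)]]) (use p in \<open>auto intro!: AE_I2\<close>)
      show 2: "(\<lambda>x. complex_of_real (p x)) \<in> L2"
        by (rule L2_dominated[OF _ L2_integrable_square[OF f(1)]]) (use p in \<open>auto intro!: AE_I2 power_mono\<close>)
      show "?S (?c p) = ?T (?c p)" by (rule Levy_pair_nonneg[OF ab 1 p(1) 2])
    qed
    define p1 p2 p3 p4 where "p1 x = max 0 (Re (f x))" and "p2 x = max 0 (- Re (f x))"
      and "p3 x = max 0 (Im (f x))" and "p4 x = max 0 (- Im (f x))" for x
    note defs = p1_def p2_def p3_def p4_def
    have le: "p1 x \<le> cmod (f x)" "p2 x \<le> cmod (f x)" "p3 x \<le> cmod (f x)" "p4 x \<le> cmod (f x)" for x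
      using abs_Re_le_cmod[of "f x"] abs_Im_le_cmod[of "f x"] norm_ge_zero[of "f x"] unfolding defs by linarith+
    have [measurable]: "p1 \<in> borel_measurable borel" "p2 \<in> borel_measurable borel"
       "p3 \<in> borel_measurable borel" "p4 \<in> borel_measurable borel"
      unfolding defs[abs_def] by measurable
    note P1 = part[of p1, OF _ _ le(1)] and P2 = part[of p2, OF _ _ le(2)]
      and P3 = part[of p3, OF _ _ le(3)] and P4 = part[of p4, OF _ _ le(4)]
    have nn: "0 \<le> p1 x" "0 \<le> p2 x" "0 \<le> p3 x" "0 \<le> p4 x" for x unfolding defs by simp_all
    have L: "(\<lambda>x. complex_of_real (p1 x)) \<in> L2" "(\<lambda>x. complex_of_real (p2 x)) \<in> L2"
      "(\<lambda>x. complex_of_real (p3 x)) \<in> L2" "(\<lambda>x. complex_of_real (p4 x)) \<in> L2"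
      using P1(2) P2(2) P3(2) P4(2) nn by auto
    have feq: "f x = (of_real (p1 x) - of_real (p2 x)) + \<i> * (of_real (p3 x) - of_real (p4 x))" for x
      by (simp add: complex_eq_iff defs max_def)
    have "l2_cls f = l2_cls (\<lambda>x. (of_real (p1 x) - of_real (p2 x)) + \<i> * (of_real (p3 x) - of_real (p4 x)))"
      by (rule arg_cong[where f = l2_cls], rule ext, rule feq)
    also have "\<dots> = l2_cls (\<lambda>x. of_real (p1 x) - of_real (p2 x)) + l2_cls (\<lambda>x. \<i> * (of_real (p3 x) - of_real (p4 x)))"
      by (intro l2_cls_add L2_diff L2_cmult L)
    also have "l2_cls (\<lambda>x. \<i> * (of_real (p3 x) - of_real (p4 x))) = l2_mul (\<lambda>_. \<i>) (l2_cls (\<lambda>x. of_real (p3 x) - of_real (p4 x)))"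
      by (rule l2_mul_cls[OF bdd_mult_const L2_diff[OF L(3,4)], symmetric])
    also have "l2_cls (\<lambda>x. of_real (p1 x) - of_real (p2 x)) = ?c p1 - ?c p2"
      by (intro l2_cls_diff L)
    also have "l2_cls (\<lambda>x. of_real (p3 x) - of_real (p4 x)) = ?c p3 - ?c p4"
      by (intro l2_cls_diff L)
    finally have eq: "l2_cls f = (?c p1 - ?c p2) + l2_mul (\<lambda>_. \<i>) (?c p3 - ?c p4)" .
    note linS = linear_add[OF bounded_linear.linear[OF S]] linear_diff[OF bounded_linear.linear[OF S]]
    note linT = linear_add[OF bounded_linear.linear[OF T]] linear_diff[OF bounded_linear.linear[OF T]]
    have c: "?S (?c p1) = ?T (?c p1)" "?S (?c p2) = ?T (?c p2)" "?S (?c p3) = ?T (?c p3)" "?S (?c p4) = ?T (?c p4)"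
      by (rule P1(1) P2(1) P3(1) P4(1); simp add: nn)+
    have "?S (l2_cls f) = (?S (?c p1) - ?S (?c p2)) + \<i> * (?S (?c p3) - ?S (?c p4))"
      unfolding eq linS Si ..
    also have "\<dots> = (?T (?c p1) - ?T (?c p2)) + \<i> * (?T (?c p3) - ?T (?c p4))"
      unfolding c ..
    also have "\<dots> = ?T (l2_cls f)"
      unfolding eq linT Ti ..
    finally show "?S (l2_cls f) = ?T (l2_cls f)" .
  qed
qed

lemma l2_eqI_Ioc:
  assumes "\<And>a b. a < b \<Longrightarrow> l2_pair f (l2_cls (indicator {a<..b})) = l2_pair g (l2_cls (indicator {a<..b}))"
  shows "f = g"
proof -
  have "AE x in lborel. l2_fun (f - g) x = 0"
  proof (rule AE_zero_of_integral_Ioc)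
    show "integrable lborel (\<lambda>x. indicator {a<..b} x * l2_fun (f - g) x)" for a b
      by (rule L2_mult_integrable[OF indicator_L2 l2_fun_L2])
    fix a b :: real assume "a < b"
    have "(LINT x|lborel. indicator {a<..b} x * l2_fun (f - g) x) = l2_pair (l2_cls (indicator {a<..b})) (l2_cls (l2_fun (f - g)))"
      by (rule l2_pair_cls[OF indicator_L2 l2_fun_L2, symmetric])
    also have "\<dots> = 0"
      unfolding l2_cls_fun l2_pair_commute[of _ "f - g"] l2_pair.diff_left
      using assms[OF \<open>a < b\<close>] by simp
    finally show "(LINT x|lborel. indicator {a<..b} x * l2_fun (f - g) x) = 0" .
  qed
  with l2_fun_zero have "AE x in lborel. l2_fun (f - g) x = l2_fun 0 x"
    by eventually_elim simp
  then have "f - g = 0" by (rule l2_eqI)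
  then show ?thesis by simp
qed

text \<open>Levy's identity, tested against every f, gives the inversion formula for indicators of
  intervals because the pairing is nondegenerate. Since transform and reflection are symmetric for
  the pairing, the formula for indicators yields the formula for any f tested against indicators,
  which determine a class.\<close>

lemma l2_FT_FT: "l2_FT (l2_FT a) = (2 * pi) *\<^sub>R l2_refl a"
proof -
  have I: "l2_FT (l2_refl (l2_FT (l2_cls (indicator {a<..b})))) = (2 * pi) *\<^sub>R l2_cls (indicator {a<..b})"
    if "a < b" for a b
  proof -
    let ?I = "l2_cls (indicator {a<..b})"
    have "l2_pair (l2_FT (l2_refl (l2_FT ?I)) - (2 * pi) *\<^sub>R ?I) f = 0" for f
    proof -
      have "l2_pair (l2_FT (l2_refl (l2_FT ?I))) f = l2_pair (l2_refl (l2_FT ?I)) (l2_refl (l2_refl (l2_FT f)))"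
        unfolding l2_refl_refl by (rule l2_pair_FT)
      also have "\<dots> = l2_pair (l2_FT ?I) (l2_refl (l2_FT f))" by (rule l2_pair_refl)
      also have "\<dots> = of_real (2 * pi) * l2_pair ?I f" by (rule Levy_pair[OF that])
      finally show ?thesis by (simp add: l2_pair.diff_left l2_pair.scaleR_left scaleR_conv_of_real)
    qed
    then have "l2_FT (l2_refl (l2_FT ?I)) - (2 * pi) *\<^sub>R ?I = 0" by (rule l2_pair_nondegenerate)
    then show ?thesis by simp
  qed
  have *: "l2_FT (l2_refl (l2_FT f)) = (2 * pi) *\<^sub>R f" for f
  proof (rule l2_eqI_Ioc)
    fix a b :: real assume ab: "a < b"
    let ?I = "l2_cls (indicator {a<..b})"
    have "l2_pair (l2_FT (l2_refl (l2_FT f))) ?I = l2_pair (l2_refl (l2_FT f)) (l2_refl (l2_refl (l2_FT ?I)))"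
      unfolding l2_refl_refl by (rule l2_pair_FT)
    also have "\<dots> = l2_pair (l2_FT f) (l2_refl (l2_FT ?I))" by (rule l2_pair_refl)
    also have "\<dots> = l2_pair f (l2_FT (l2_refl (l2_FT ?I)))" by (rule l2_pair_FT)
    also have "\<dots> = l2_pair ((2 * pi) *\<^sub>R f) ?I"
      unfolding I[OF ab] by (simp add: l2_pair.scaleR_left l2_pair.scaleR_right)
    finally show "l2_pair (l2_FT (l2_refl (l2_FT f))) ?I = l2_pair ((2 * pi) *\<^sub>R f) ?I" .
  qed
  have "l2_FT (l2_FT (l2_refl (l2_refl a))) = (2 * pi) *\<^sub>R l2_refl a"
    unfolding l2_FT_refl[of "l2_refl a"] * ..
  then show ?thesis unfolding l2_refl_refl .
qed

lemma l2_pair_FT_FT: "l2_pair (l2_FT a) (l2_refl (l2_FT b)) = of_real (2 * pi) * l2_pair a b"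
  unfolding l2_pair_FT l2_FT_refl[symmetric] l2_FT_FT l2_refl_refl
  by (simp add: l2_pair.scaleR_right scaleR_conv_of_real)

lemma Plancherel: "l2_pair (l2_FT a) (l2_cnj (l2_FT b)) = of_real (2 * pi) * l2_pair a (l2_cnj b)"
  unfolding l2_pair_FT_FT[symmetric] l2_FT_cnj l2_refl_refl ..

definition l2_IFT :: "l2 \<Rightarrow> l2" where "l2_IFT a = (1 / (2 * pi)) *\<^sub>R l2_refl (l2_FT a)"

lemma l2_FT_IFT [simp]: "l2_FT (l2_IFT a) = a"
  by (simp add: l2_IFT_def bounded_linear.linear[OF bounded_linear_l2_FT, THEN linear_scale]
    l2_FT_refl l2_FT_FT bounded_linear.linear[OF bounded_linear_l2_refl, THEN linear_scale])

lemma l2_IFT_FT [simp]: "l2_IFT (l2_FT a) = a"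
  by (simp add: l2_IFT_def l2_FT_FT bounded_linear.linear[OF bounded_linear_l2_refl, THEN linear_scale])

lemma bounded_linear_l2_IFT: "bounded_linear l2_IFT"
  unfolding l2_IFT_def
  by (rule bounded_linear_compose[OF bounded_linear_scaleR_right
     bounded_linear_compose[OF bounded_linear_l2_refl bounded_linear_l2_FT]])

lemma l2_FT_inject: "l2_FT a = l2_FT b \<longleftrightarrow> a = b"
  using l2_IFT_FT by metis

subsection \<open>The Szego projector and the Hardy space\<close>

definition l2_szego :: "l2 \<Rightarrow> l2" where
  "l2_szego a = l2_IFT (l2_mul (indicator {0..}) (l2_FT a))"

lemma bdd_mult_halfline [simp]: "bdd_mult (indicator {0::real..})"
  by (rule bdd_mult_indicator) simp

lemma l2_FT_szego: "l2_FT (l2_szego a) = l2_mul (indicator {0..}) (l2_FT a)"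
  by (simp add: l2_szego_def)

lemma bounded_linear_l2_szego: "bounded_linear l2_szego"
  unfolding l2_szego_def
  by (rule bounded_linear_compose[OF bounded_linear_l2_IFT
     bounded_linear_compose[OF bounded_linear_l2_mul[OF bdd_mult_halfline] bounded_linear_l2_FT]])

definition hardy :: "l2 \<Rightarrow> bool" where
  "hardy a \<longleftrightarrow> (AE \<xi> in lborel. \<xi> < 0 \<longrightarrow> l2_fun (l2_FT a) \<xi> = 0)"

lemma hardy_szego: "hardy (l2_szego a)"
  unfolding hardy_def l2_FT_szego
  using l2_fun_mul[OF bdd_mult_halfline, of "l2_FT a"] by eventually_elim auto

text \<open>The Fourier transform is injective on classes, so all candidates for the choice in
  \<open>szego\<close> lie in one class, that of the multiplier operator
  \<open>l2_szego\<close>.\<close>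

lemma szego_cls:
  assumes "f \<in> L2"
  shows "szego f \<in> L2" "l2_cls (szego f) = l2_szego (l2_cls f)"
proof -
  let ?P = "\<lambda>g. g \<in> L2 \<and> (AE \<xi> in lborel. L2_fourier g \<xi> = indicator {0..} \<xi> * L2_fourier f \<xi>)"
  have iff: "?P g \<longleftrightarrow> g \<in> L2 \<and> l2_cls g = l2_szego (l2_cls f)" for g
  proof (cases "g \<in> L2")
    case True
    have L: "(\<lambda>\<xi>. indicator {0..} \<xi> * L2_fourier f \<xi>) \<in> L2"
      by (rule L2_bdd_mult[OF bdd_mult_halfline L2_fourier_cls(1)[OF assms]])
    have "(AE \<xi> in lborel. L2_fourier g \<xi> = indicator {0..} \<xi> * L2_fourier f \<xi>) \<longleftrightarrow>
        l2_cls (L2_fourier g) = l2_cls (\<lambda>\<xi>. indicator {0..} \<xi> * L2_fourier f \<xi>)"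
      using l2_cls_eq[OF L2_fourier_cls(1)[OF True] L] l2_cls_eqD[OF _ L2_fourier_cls(1)[OF True] L] by blast
    also have "\<dots> \<longleftrightarrow> l2_FT (l2_cls g) = l2_FT (l2_szego (l2_cls f))"
      unfolding l2_FT_szego L2_fourier_cls(2)[OF True] L2_fourier_cls(2)[OF assms, symmetric]
        l2_mul_cls[OF bdd_mult_halfline L2_fourier_cls(1)[OF assms]] ..
    finally show ?thesis using True by (simp add: l2_FT_inject)
  qed simp
  have "?P (l2_fun (l2_szego (l2_cls f)))" unfolding iff by simp
  then have "?P (szego f)" unfolding szego_def by (rule someI[of ?P])
  then show "szego f \<in> L2" "l2_cls (szego f) = l2_szego (l2_cls f)" unfolding iff by auto
qed

text \<open>On the Fourier side the projector is multiplication by an indicator, an idempotent and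
  symmetric operation, so the value is a squared norm divided by 2 pi. This is what annihilates the
  flux later.\<close>

lemma l2_pair_szego_real: "l2_pair (l2_szego q) (l2_cnj q) \<in> \<real>"
proof -
  let ?m = "l2_mul (indicator {0..})"
  have idem: "?m (?m a) = ?m a" for a
    by (rule l2_eqI, use l2_fun_mul[OF bdd_mult_halfline, of a] l2_fun_mul[OF bdd_mult_halfline, of "?m a"]
      in \<open>eventually_elim, simp add: indicator_def\<close>)
  have cnj: "l2_cnj (?m a) = ?m (l2_cnj a)" for a
    by (rule l2_eqI, use l2_fun_mul[OF bdd_mult_halfline, of a] l2_fun_mul[OF bdd_mult_halfline, of "l2_cnj a"]
        l2_fun_cnj[of a] l2_fun_cnj[of "?m a"]
      in \<open>eventually_elim, simp add: indicator_def\<close>)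
  have "of_real (2 * pi) * l2_pair (l2_szego q) (l2_cnj q) = l2_pair (?m (l2_FT q)) (l2_cnj (l2_FT q))"
    unfolding Plancherel[symmetric] l2_FT_szego ..
  also have "\<dots> = l2_pair (?m (?m (l2_FT q))) (l2_cnj (l2_FT q))" unfolding idem ..
  also have "\<dots> = l2_pair (?m (l2_FT q)) (l2_cnj (?m (l2_FT q)))"
    unfolding l2_pair_mul[OF bdd_mult_halfline, of "?m (l2_FT q)"] cnj ..
  also have "\<dots> = of_real ((norm (?m (l2_FT q)))\<^sup>2)" by (rule l2_pair_cnj_self)
  finally have "l2_pair (l2_szego q) (l2_cnj q) = of_real ((norm (?m (l2_FT q)))\<^sup>2 / (2 * pi))"
    by (simp add: field_simps)
  then show ?thesis by simp
qed

text \<open>The transform of a product is a convolution: the integrand at \<eta> contains the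
  transforms of a at \<xi> + \<eta> and of b at -\<eta>. For \<xi> < 0 one of these frequencies is
  negative, whatever \<eta> is. Hence multiplication by \<open>u\<close> preserves the Hardy
  property.\<close>

lemma FT_mult_hardy:
  assumes "hardy a" "hardy b" "\<xi> < 0"
  shows "FT (\<lambda>x. l2_fun a x * l2_fun b x) \<xi> = 0"
proof -
  let ?k = "\<lambda>x. exp (- (\<i> * of_real (\<xi> * x)))"
  have "FT (\<lambda>x. l2_fun a x * l2_fun b x) \<xi> = (LINT x|lborel. (?k x * l2_fun a x) * l2_fun b x)"
    unfolding FT_def by (simp add: ac_simps)
  also have "\<dots> = l2_pair (l2_mul ?k a) (l2_cls (l2_fun b))"
    unfolding l2_mul_def l2_pair_cls[OF L2_bdd_mult[OF bdd_mult_kernel l2_fun_L2] l2_fun_L2] ..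
  finally have 1: "FT (\<lambda>x. l2_fun a x * l2_fun b x) \<xi> = l2_pair (l2_mul ?k a) b" by simp
  have "l2_pair (l2_FT (l2_mul ?k a)) (l2_refl (l2_FT b)) = (LINT \<eta>::real|lborel. 0)"
    unfolding l2_FT_modulate l2_pair_def
  proof (rule integral_cong_AE)
    show "AE \<eta> in lborel. l2_fun (l2_shift \<xi> (l2_FT a)) \<eta> * l2_fun (l2_refl (l2_FT b)) \<eta> = 0"
      using l2_fun_shift[of \<xi> "l2_FT a"] l2_fun_refl[of "l2_FT b"]
        AE_lborel_plus[OF assms(1)[unfolded hardy_def], of \<xi>] AE_lborel_uminus[OF assms(2)[unfolded hardy_def]]
    proof eventually_elim
      case (elim \<eta>)
      show ?case
      proof (cases "\<eta> > 0")
        case True then show ?thesis using elim by simp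
      next
        case False then show ?thesis using elim assms(3) by simp
      qed
    qed
  qed measurable
  then have "of_real (2 * pi) * l2_pair (l2_mul ?k a) b = 0" unfolding l2_pair_FT_FT by simp
  then show ?thesis unfolding 1 by simp
qed

section \<open>The space H^1_+ on the Fourier side, and its embedding into the bounded
  functions\<close>

lemma hardy_sobolev_iff:
  "f \<in> hardy_sobolev 1 \<longleftrightarrow> f \<in> L2 \<and> hardy (l2_cls f) \<and>
     integrable lborel (\<lambda>\<xi>. (1 + \<xi>\<^sup>2) * (cmod (l2_fun (l2_FT (l2_cls f)) \<xi>))\<^sup>2)"
proof (cases "f \<in> L2")
  case True
  have F: "AE \<xi> in lborel. L2_fourier f \<xi> = l2_fun (l2_FT (l2_cls f)) \<xi>" by (rule L2_fourier_AE[OF True])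
  have [measurable]: "L2_fourier f \<in> borel_measurable borel" using L2_fourier_cls(1)[OF True] by measurable
  have 1: "integrable lborel (\<lambda>\<xi>. (1 + \<xi>\<^sup>2) powr 1 * (cmod (L2_fourier f \<xi>))\<^sup>2) \<longleftrightarrow>
    integrable lborel (\<lambda>\<xi>. (1 + \<xi>\<^sup>2) * (cmod (l2_fun (l2_FT (l2_cls f)) \<xi>))\<^sup>2)"
  proof (rule integrable_cong_AE)
    show "AE \<xi> in lborel. (1 + \<xi>\<^sup>2) powr 1 * (cmod (L2_fourier f \<xi>))\<^sup>2 = (1 + \<xi>\<^sup>2) * (cmod (l2_fun (l2_FT (l2_cls f)) \<xi>))\<^sup>2"
      using F by eventually_elim simp
  qed measurable
  have 2: "(AE \<xi> in lborel. \<xi> < 0 \<longrightarrow> L2_fourier f \<xi> = 0) \<longleftrightarrow> hardy (l2_cls f)"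
    unfolding hardy_def by (rule eventually_cong[OF F]) auto
  show ?thesis unfolding hardy_sobolev_def sobolev_def mem_Collect_eq 1 2 using True by auto
qed (auto simp: hardy_sobolev_def sobolev_def)

lemma integrable_lorentzian: "integrable lborel (\<lambda>x::real. inverse (1 + x\<^sup>2))"
  using integrable_inverse_1_plus_square by (simp add: set_integrable_def)

text \<open>With w = 1 + \<xi>^2, expanding (w |F| - 1)^2 \<ge> 0 and dividing by w bounds 2 |F| by
  w |F|^2 + 1/w, which is integrable. So the transform of u is integrable, and the inversion formula
  represents u by an absolutely convergent integral.\<close>

lemma hardy_sobolev_bounded:
  assumes "u \<in> hardy_sobolev 1"
  shows "\<exists>C. AE x in lborel. cmod (u x) \<le> C"
proof -
  let ?F = "l2_fun (l2_FT (l2_cls u))"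
  have u: "u \<in> L2" and i: "integrable lborel (\<lambda>\<xi>. (1 + \<xi>\<^sup>2) * (cmod (?F \<xi>))\<^sup>2)"
    using assms unfolding hardy_sobolev_iff by auto
  have F1: "integrable lborel ?F"
  proof (rule Bochner_Integration.integrable_bound)
    show "integrable lborel (\<lambda>\<xi>. (1 + \<xi>\<^sup>2) * (cmod (?F \<xi>))\<^sup>2 + inverse (1 + \<xi>\<^sup>2))"
      by (intro Bochner_Integration.integrable_add i integrable_lorentzian)
    have "cmod (?F \<xi>) \<le> (1 + \<xi>\<^sup>2) * (cmod (?F \<xi>))\<^sup>2 + inverse (1 + \<xi>\<^sup>2)" for \<xi>
    proof -
      define w where "w = 1 + \<xi>\<^sup>2"
      have w: "w > 0" unfolding w_def by (simp add: add_pos_nonneg)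
      have "0 \<le> (w * cmod (?F \<xi>) - 1)\<^sup>2" by simp
      also have "(w * cmod (?F \<xi>) - 1)\<^sup>2 = w * (w * (cmod (?F \<xi>))\<^sup>2 + inverse w - 2 * cmod (?F \<xi>))"
        using w by (simp add: power2_eq_square field_simps)
      finally have "0 \<le> w * (cmod (?F \<xi>))\<^sup>2 + inverse w - 2 * cmod (?F \<xi>)"
        using w by (simp add: zero_le_mult_iff)
      then show ?thesis unfolding w_def[symmetric] using norm_ge_zero[of "?F \<xi>"] by linarith
    qed
    then show "AE \<xi> in lborel. norm (?F \<xi>) \<le> norm ((1 + \<xi>\<^sup>2) * (cmod (?F \<xi>))\<^sup>2 + inverse (1 + \<xi>\<^sup>2))"
      by (auto intro!: AE_I2 order_trans[OF _ abs_ge_self])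
  qed measurable
  have "(2 * pi) *\<^sub>R l2_refl (l2_cls u) = l2_cls (FT ?F)"
    using l2_FT_cls[OF l2_fun_L2 F1] by (simp add: l2_FT_FT)
  then have "(2 * pi) *\<^sub>R l2_cls u = l2_refl (l2_cls (FT ?F))"
    by (metis l2_refl_refl bounded_linear.linear[OF bounded_linear_l2_refl, THEN linear_scale])
  also have "\<dots> = l2_cls (\<lambda>x. FT ?F (- x))" by (rule l2_refl_cls[OF FT_L2[OF F1 l2_fun_L2]])
  finally have eq: "l2_cls (\<lambda>x. of_real (2 * pi) * u x) = l2_cls (\<lambda>x. FT ?F (- x))"
    unfolding l2_mul_const_scaleR[symmetric] l2_mul_cls[OF bdd_mult_const u] .
  have "AE x in lborel. of_real (2 * pi) * u x = FT ?F (- x)"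
    by (rule l2_cls_eqD[OF eq L2_cmult[OF u] L2_refl[OF FT_L2[OF F1 l2_fun_L2]]])
  then have "AE x in lborel. cmod (u x) \<le> (LINT x|lborel. cmod (?F x)) / (2 * pi)"
  proof eventually_elim
    case (elim x)
    have "2 * pi * cmod (u x) = cmod (of_real (2 * pi) * u x)" by (simp add: norm_mult)
    also have "\<dots> \<le> (LINT x|lborel. cmod (?F x))" unfolding elim by (rule FT_bound)
    finally show ?case by (simp add: field_simps)
  qed
  then show ?thesis by blast
qed

subsection \<open>Test functions\<close>

definition smooth :: "(real \<Rightarrow> complex) \<Rightarrow> bool" where
  "smooth f \<longleftrightarrow> (\<forall>n x. ((\<lambda>g y. vector_derivative g (at y)) ^^ n) f differentiable (at x))"

text \<open>Smoothness by coinduction: it suffices that f lies in a set of functions each of which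
  has a derivative in the set. This avoids formulas for the n-th derivative.\<close>

lemma smooth_coinduct:
  assumes "f \<in> S"
    and step: "\<And>g. g \<in> S \<Longrightarrow> \<exists>g'\<in>S. \<forall>x. (g has_vector_derivative g' x) (at x)"
  shows "smooth f"
proof -
  let ?D = "\<lambda>g y. vector_derivative g (at y)"
  have D: "?D g \<in> S" if g: "g \<in> S" for g :: "real \<Rightarrow> complex"
  proof -
    obtain g' where g': "g' \<in> S" "\<And>x. (g has_vector_derivative g' x) (at x)" using step[OF g] by blast
    have "?D g = g'" by (rule ext) (rule vector_derivative_at[OF g'(2)])
    then show ?thesis using g'(1) by simp
  qed
  have n: "(?D ^^ n) f \<in> S" for n
    by (induction n) (simp_all add: assms(1) D)
  show ?thesis unfolding smooth_def
  proof (intro allI)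
    fix n x
    obtain g' where "((?D ^^ n) f has_vector_derivative g' x) (at x)" using step[OF n[of n]] by blast
    then show "(?D ^^ n) f differentiable (at x)" by (rule differentiableI_vector)
  qed
qed

lemma smooth_has_vector_derivative:
  "smooth f \<Longrightarrow> (f has_vector_derivative vector_derivative f (at x)) (at x)"
proof -
  assume "smooth f"
  then have "((\<lambda>g y. vector_derivative g (at y)) ^^ 0) f differentiable (at x)"
    unfolding smooth_def by (elim allE)
  then show ?thesis unfolding vector_derivative_works[symmetric] by (simp only: funpow_0)
qed

lemma smooth_vector_derivative: "smooth f \<Longrightarrow> smooth (\<lambda>x. vector_derivative f (at x))"
proof -
  let ?D = "\<lambda>g y. vector_derivative g (at y)"
  assume f: "smooth f"
  show "smooth (?D f)" unfolding smooth_def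
  proof (intro allI)
    fix n x
    have "(?D ^^ Suc n) f differentiable (at x)"
      using f unfolding smooth_def by (elim allE)
    then show "(?D ^^ n) (?D f) differentiable (at x)" by (simp only: funpow_Suc_right comp_apply)
  qed
qed

lemma smooth_continuous_on: "smooth f \<Longrightarrow> continuous_on A f"
  by (intro continuous_at_imp_continuous_on ballI has_vector_derivative_continuous[OF smooth_has_vector_derivative])

lemma smooth_antiderivative:
  assumes "smooth g" "\<And>x. (f has_vector_derivative g x) (at x)"
  shows "smooth f"
proof (rule smooth_coinduct[where S = "insert f {h. smooth h}"])
  fix h assume "h \<in> insert f {h. smooth h}"
  then show "\<exists>g'\<in>insert f {h. smooth h}. \<forall>x. (h has_vector_derivative g' x) (at x)"
  proof (elim insertE)
    assume "h = f"
    then show ?thesis using assms by (intro bexI[of _ g]) auto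
  next
    assume "h \<in> {h. smooth h}"
    then show ?thesis
      by (intro bexI[of _ "\<lambda>x. vector_derivative h (at x)"])
         (auto intro: smooth_has_vector_derivative smooth_vector_derivative)
  qed
qed simp

text \<open>The derivative of a product is a sum of products, so coinduction needs a set closed
  under both operations; the algebra generated by the smooth functions is such a set.\<close>

inductive_set smooth_algebra :: "(real \<Rightarrow> complex) set" where
  base: "smooth f \<Longrightarrow> f \<in> smooth_algebra"
| plus: "f \<in> smooth_algebra \<Longrightarrow> g \<in> smooth_algebra \<Longrightarrow> (\<lambda>x. f x + g x) \<in> smooth_algebra"
| times: "f \<in> smooth_algebra \<Longrightarrow> g \<in> smooth_algebra \<Longrightarrow> (\<lambda>x. f x * g x) \<in> smooth_algebra"

lemma smooth_algebra_derivative: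
  "f \<in> smooth_algebra \<Longrightarrow> \<exists>f'\<in>smooth_algebra. \<forall>x. (f has_vector_derivative f' x) (at x)"
proof (induction rule: smooth_algebra.induct)
  case (base f)
  then show ?case
    by (intro bexI[of _ "\<lambda>x. vector_derivative f (at x)"])
       (auto intro: smooth_has_vector_derivative smooth_vector_derivative smooth_algebra.base)
next
  case (plus f g)
  then obtain f' g' where "f' \<in> smooth_algebra" "g' \<in> smooth_algebra"
    "\<And>x. (f has_vector_derivative f' x) (at x)" "\<And>x. (g has_vector_derivative g' x) (at x)" by blast
  then show ?case
    by (intro bexI[of _ "\<lambda>x. f' x + g' x"]) (auto intro: smooth_algebra.plus has_vector_derivative_add)
next
  case (times f g)
  then obtain f' g' where D: "f' \<in> smooth_algebra" "g' \<in> smooth_algebra"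
    "\<And>x. (f has_vector_derivative f' x) (at x)" "\<And>x. (g has_vector_derivative g' x) (at x)" by blast
  have "(\<lambda>x. f x * g' x + f' x * g x) \<in> smooth_algebra"
    using times D by (intro smooth_algebra.plus smooth_algebra.times) auto
  then show ?case using has_vector_derivative_mult[OF D(3) D(4)]
    by (intro bexI[of _ "\<lambda>x. f x * g' x + f' x * g x"]) auto
qed

lemma smooth_algebra_smooth: "f \<in> smooth_algebra \<Longrightarrow> smooth f"
  by (rule smooth_coinduct[of _ smooth_algebra]) (auto dest: smooth_algebra_derivative)

lemma smooth_add: "smooth f \<Longrightarrow> smooth g \<Longrightarrow> smooth (\<lambda>x. f x + g x)"
  and smooth_mult: "smooth f \<Longrightarrow> smooth g \<Longrightarrow> smooth (\<lambda>x. f x * g x)"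
  by (auto intro!: smooth_algebra_smooth intro: smooth_algebra.intros)

lemma smooth_exp: "smooth (\<lambda>x. c * exp (d * of_real x))"
proof (rule smooth_coinduct[where S = "{\<lambda>x. c * exp (d * of_real x) |c. True}"])
  fix g assume "g \<in> {\<lambda>x. c * exp (d * of_real x) |c. True}"
  then obtain c where g: "g = (\<lambda>x. c * exp (d * of_real x))" by blast
  have "((\<lambda>z. c * exp (d * z)) has_field_derivative c * d * exp (d * of_real x)) (at (of_real x))" for x
    by (auto intro!: derivative_eq_intros)
  then have "(g has_vector_derivative c * d * exp (d * of_real x)) (at x)" for x
    unfolding g by (rule has_vector_derivative_real_field)
  then show "\<exists>g'\<in>{\<lambda>x. c * exp (d * of_real x) |c. True}. \<forall>x. (g has_vector_derivative g' x) (at x)"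
    by (intro bexI[of _ "\<lambda>x. c * d * exp (d * of_real x)"]) auto
qed blast

lemma smooth_const: "smooth (\<lambda>_. c)"
  using smooth_exp[of c 0] by simp

lemma smooth_affine:
  assumes "smooth f" shows "smooth (\<lambda>x. f (c * x + d))"
proof (rule smooth_coinduct[where S = "{\<lambda>x. of_real k * h (c * x + d) |k h. smooth h}"])
  show "(\<lambda>x. f (c * x + d)) \<in> {\<lambda>x. of_real k * h (c * x + d) |k h. smooth h}"
    using assms by (intro CollectI exI[of _ 1] exI[of _ f]) simp
  fix g assume "g \<in> {\<lambda>x. of_real k * h (c * x + d) |k h. smooth h}"
  then obtain k h where g: "g = (\<lambda>x. of_real k * h (c * x + d))" and h: "smooth h" by blast
  have "(g has_vector_derivative of_real (k * c) * vector_derivative h (at (c * x + d))) (at x)" for x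
  proof -
    have "((\<lambda>x. c * x + d) has_vector_derivative c) (at x)"
      by (auto intro!: derivative_eq_intros)
    from vector_diff_chain_at[OF this smooth_has_vector_derivative[OF h]]
    have "((\<lambda>x. h (c * x + d)) has_vector_derivative c *\<^sub>R vector_derivative h (at (c * x + d))) (at x)"
      by (simp add: comp_def)
    from has_vector_derivative_mult_right[OF this, of "of_real k"]
    show ?thesis unfolding g by (simp add: scaleR_conv_of_real mult.assoc)
  qed
  then show "\<exists>g'\<in>{\<lambda>x. of_real k * h (c * x + d) |k h. smooth h}. \<forall>x. (g has_vector_derivative g' x) (at x)"
    using smooth_vector_derivative[OF h]
    by (intro bexI[of _ "\<lambda>x. of_real (k * c) * vector_derivative h (at (c * x + d))"] CollectI
      exI[of _ "k * c"] exI[of _ "\<lambda>x. vector_derivative h (at x)"]) auto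
qed

section \<open>Flat functions and bump functions\<close>

definition flat_exp :: "real \<Rightarrow> real poly \<Rightarrow> real \<Rightarrow> real" where
  "flat_exp c p t = (if t > 0 then poly p (1 / t) * exp (- c / t) else 0)"

lemma poly_exp_decay:
  assumes "c > (0::real)"
  shows "((\<lambda>s. poly p s * exp (- c * s)) \<longlongrightarrow> 0) at_top"
proof -
  have "((\<lambda>s. s ^ i * exp (- c * s)) \<longlongrightarrow> 0) at_top" for i
  proof -
    have "filterlim (\<lambda>s. c * s) at_top at_top"
      by (rule filterlim_tendsto_pos_mult_at_top[OF tendsto_const assms filterlim_ident])
    from filterlim_compose[OF tendsto_power_div_exp_0[of i] this]
    have "((\<lambda>s. 1 / c ^ i * ((c * s) ^ i / exp (c * s))) \<longlongrightarrow> 1 / c ^ i * 0) at_top"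
      by (intro tendsto_mult tendsto_const)
    then show ?thesis
      using assms by (simp add: power_mult_distrib exp_minus field_simps)
  qed
  then have "((\<lambda>s. \<Sum>i\<le>degree p. coeff p i * (s ^ i * exp (- c * s))) \<longlongrightarrow> (\<Sum>i\<le>degree p. coeff p i * 0)) at_top"
    by (intro tendsto_sum tendsto_mult tendsto_const)
  then show ?thesis by (simp add: poly_altdef sum_distrib_right mult.assoc)
qed

text \<open>With r = 1/t, differentiating p(r) exp(-c r) in t replaces p by r^2 (c p - p'), so the
  polynomial factor makes the family closed under derivatives. At t = 0 the right difference
  quotient is r p(r) exp(-c r), which tends to 0 as r grows.\<close>

lemma flat_exp_derivative:
  assumes c: "c > 0"
  shows "(flat_exp c p has_real_derivative flat_exp c ([:0, 0, 1:] * (smult c p - pderiv p)) t) (at t)"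
proof -
  consider "t > 0" | "t < 0" | "t = 0" by linarith
  then show ?thesis
  proof cases
    case 1
    have "((\<lambda>t. poly p (1 / t) * exp (- c / t)) has_real_derivative
       poly ([:0, 0, 1:] * (smult c p - pderiv p)) (1 / t) * exp (- c / t)) (at t)"
      using 1 by (auto intro!: derivative_eq_intros simp: field_simps power2_eq_square)
    then have "(flat_exp c p has_real_derivative
       poly ([:0, 0, 1:] * (smult c p - pderiv p)) (1 / t) * exp (- c / t)) (at t)"
      by (rule has_field_derivative_transform_within_open[of _ _ _ "{0<..}"]) (use 1 in \<open>auto simp: flat_exp_def\<close>)
    then show ?thesis using 1 by (simp add: flat_exp_def)
  next
    case 2
    have "((\<lambda>t. 0) has_real_derivative 0) (at t)" by simp
    then have "(flat_exp c p has_real_derivative 0) (at t)"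
      by (rule has_field_derivative_transform_within_open[of _ _ _ "{..<0}"]) (use 2 in \<open>auto simp: flat_exp_def\<close>)
    then show ?thesis using 2 by (simp add: flat_exp_def)
  next
    case 3
    have "((\<lambda>y. flat_exp c p y / y) \<longlongrightarrow> 0) (at_right 0)"
    proof (rule Lim_transform_eventually)
      show "((\<lambda>y. poly ([:0, 1:] * p) (inverse y) * exp (- c * inverse y)) \<longlongrightarrow> 0) (at_right 0)"
        by (rule filterlim_compose[OF poly_exp_decay[OF c] filterlim_inverse_at_top_right])
      show "\<forall>\<^sub>F y in at_right 0. poly ([:0, 1:] * p) (inverse y) * exp (- c * inverse y) = flat_exp c p y / y"
        using eventually_at_right_less[of 0]
        by eventually_elim (simp add: flat_exp_def field_simps)
    qed
    moreover have "((\<lambda>y. flat_exp c p y / y) \<longlongrightarrow> 0) (at_left 0)"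
    proof (rule tendsto_eventually)
      have "\<forall>\<^sub>F y in at_left 0. y < (0::real)"
        by (simp add: eventually_at_filter)
      then show "\<forall>\<^sub>F y in at_left 0. flat_exp c p y / y = 0"
        by eventually_elim (simp add: flat_exp_def)
    qed
    ultimately have "((\<lambda>y. flat_exp c p y / y) \<longlongrightarrow> 0) (at 0)"
      by (simp add: filterlim_split_at)
    then have "(flat_exp c p has_real_derivative 0) (at 0)"
      unfolding has_field_derivative_iff by (simp add: flat_exp_def)
    then show ?thesis using 3 by (simp add: flat_exp_def)
  qed
qed

lemma smooth_flat_exp:
  assumes "c > 0" shows "smooth (\<lambda>t. of_real (flat_exp c p t))"
proof (rule smooth_coinduct[where S = "{\<lambda>t. of_real (flat_exp c p t) |p. True}"])
  fix g assume "g \<in> {\<lambda>t. complex_of_real (flat_exp c p t) |p. True}"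
  then obtain p where g: "g = (\<lambda>t. of_real (flat_exp c p t))" by blast
  have "(g has_vector_derivative of_real (flat_exp c ([:0, 0, 1:] * (smult c p - pderiv p)) t)) (at t)" for t
    unfolding g by (rule has_vector_derivative_of_real[OF flat_exp_derivative[OF assms]])
  then show "\<exists>g'\<in>{\<lambda>t. complex_of_real (flat_exp c p t) |p. True}. \<forall>x. (g has_vector_derivative g' x) (at x)"
    by (intro bexI[of _ "\<lambda>t. of_real (flat_exp c ([:0, 0, 1:] * (smult c p - pderiv p)) t)"] allI CollectI
      exI[of _ "[:0, 0, 1:] * (smult c p - pderiv p)"] conjI refl TrueI)
qed blast

text \<open>The parameter c measures flatness at the end points: for c tending to 0 the bumps
  converge to the indicator of the open interval and stay below 1, so they can replace indicators in
  dominated limits.\<close>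

definition bump :: "real \<Rightarrow> real \<Rightarrow> real \<Rightarrow> real \<Rightarrow> real" where
  "bump c a b x = flat_exp c 1 (x - a) * flat_exp c 1 (b - x)"

lemma bump_eq: "bump c a b x = (if a < x \<and> x < b then exp (- c / (x - a)) * exp (- c / (b - x)) else 0)"
  by (simp add: bump_def flat_exp_def)

lemma smooth_bump: "c > 0 \<Longrightarrow> smooth (\<lambda>x. of_real (bump c a b x))"
  using smooth_mult[OF smooth_affine[OF smooth_flat_exp[of c 1], of 1 "- a"] smooth_affine[OF smooth_flat_exp[of c 1], of "-1" b]]
  by (simp add: bump_def)

lemma bump_bounds: "c > 0 \<Longrightarrow> 0 \<le> bump c a b x" "c > 0 \<Longrightarrow> bump c a b x \<le> indicator {a<..b} x"
proof -
  assume c: "c > 0"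
  show "0 \<le> bump c a b x" by (simp add: bump_eq)
  have "exp (- c / (x - a)) * exp (- c / (b - x)) \<le> 1 * 1" if "a < x" "x < b"
    using c that by (intro mult_mono) (auto simp: divide_nonneg_pos)
  then show "bump c a b x \<le> indicator {a<..b} x" by (simp add: bump_eq)
qed

lemma test_functions_iff: "\<psi> \<in> test_functions \<longleftrightarrow> bounded {x. \<psi> x \<noteq> 0} \<and> smooth \<psi>"
  by (simp add: test_functions_def smooth_def)

lemma test_functions_support:
  assumes "\<psi> \<in> test_functions"
  obtains R where "R > 0" "\<And>x. x \<notin> {-R..R} \<Longrightarrow> \<psi> x = 0"
proof -
  from assms obtain B where B: "B > 0" "\<And>x. \<psi> x \<noteq> 0 \<Longrightarrow> norm x \<le> B"
    unfolding test_functions_iff bounded_pos by blast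
  show ?thesis
  proof (rule that[OF B(1)])
    fix x assume x: "x \<notin> {-B..B}"
    show "\<psi> x = 0"
    proof (rule ccontr)
      assume "\<psi> x \<noteq> 0"
      then have "\<bar>x\<bar> \<le> B" using B(2)[of x] by simp
      then show False using x by auto
    qed
  qed
qed

lemma test_functions_derivative:
  assumes "\<psi> \<in> test_functions"
  shows "(\<lambda>x. vector_derivative \<psi> (at x)) \<in> test_functions"
proof -
  obtain R where R: "R > 0" "\<And>x. x \<notin> {-R..R} \<Longrightarrow> \<psi> x = 0"
    using test_functions_support[OF assms] by blast
  have z: "vector_derivative \<psi> (at x) = 0" if "x \<notin> {-R..R}" for x
  proof (rule vector_derivative_at)
    show "(\<psi> has_vector_derivative 0) (at x)"
      by (rule has_vector_derivative_transform_within_open[of "\<lambda>_. 0" _ _ "- {-R..R}"])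
         (use that R in \<open>auto intro: has_vector_derivative_const\<close>)
  qed
  have "bounded {x. vector_derivative \<psi> (at x) \<noteq> 0}"
    by (rule bounded_subset[OF bounded_closed_interval[of "-R" R]]) (use z in blast)
  then show ?thesis
    using assms smooth_vector_derivative unfolding test_functions_iff by blast
qed

lemma test_functions_bound:
  assumes "\<psi> \<in> test_functions"
  obtains R C where "R > 0" "C \<ge> 0" "\<And>x. cmod (\<psi> x) \<le> C * indicator {-R..R} x"
proof -
  obtain R where R: "R > 0" "\<And>x. x \<notin> {-R..R} \<Longrightarrow> \<psi> x = 0"
    using test_functions_support[OF assms] by blast
  have "compact (\<psi> ` {-R..R})"
    using assms by (intro compact_continuous_image smooth_continuous_on) (auto simp: test_functions_iff)
  then have "bounded (\<psi> ` {-R..R})" by (rule compact_imp_bounded)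
  then obtain C where C: "C > 0" "\<And>y. y \<in> \<psi> ` {-R..R} \<Longrightarrow> norm y \<le> C" unfolding bounded_pos by blast
  show ?thesis
    by (rule that[OF R(1), of C]) (use R(2) C in \<open>auto simp: indicator_def\<close>)
qed

lemma test_functions_measurable: "\<psi> \<in> test_functions \<Longrightarrow> \<psi> \<in> borel_measurable borel"
  by (auto simp: test_functions_iff intro: borel_measurable_continuous_onI smooth_continuous_on)

lemma test_functions_integrable: "\<psi> \<in> test_functions \<Longrightarrow> integrable lborel \<psi>"
  and test_functions_L2: "\<psi> \<in> test_functions \<Longrightarrow> \<psi> \<in> L2"
proof -
  assume t: "\<psi> \<in> test_functions"
  obtain R C where R: "R > 0" "C \<ge> 0" "\<And>x. cmod (\<psi> x) \<le> C * indicator {-R..R} x"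
    using test_functions_bound[OF t] by blast
  have [measurable]: "\<psi> \<in> borel_measurable borel" by (rule test_functions_measurable[OF t])
  have i: "integrable lborel (\<lambda>x. C * indicator {-R..R} x)"
    by (intro integrable_mult_right integrable_real_indicator) (auto simp: emeasure_lborel_Icc_eq)
  show "integrable lborel \<psi>"
    by (rule Bochner_Integration.integrable_bound[OF i]) (use R in auto)
  show "\<psi> \<in> L2"
  proof (rule L2_dominated)
    show "integrable lborel (\<lambda>x. C * (C * indicator {-R..R} x))" using i by simp
    have "(cmod (\<psi> x))\<^sup>2 \<le> C * (C * indicator {-R..R} x)" for x
      using power_mono[OF R(3)[of x] norm_ge_zero, of 2]
      by (auto simp: indicator_def power2_eq_square split: if_splits)
    then show "AE x in lborel. (cmod (\<psi> x))\<^sup>2 \<le> C * (C * indicator {-R..R} x)" by simp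
  qed measurable
qed

section \<open>Locally integrable functions and the lemma of du Bois-Reymond\<close>

definition loc_integrable :: "(real \<Rightarrow> complex) \<Rightarrow> bool" where
  "loc_integrable W \<longleftrightarrow> W \<in> borel_measurable borel \<and> (\<forall>R. integrable lborel (\<lambda>x. indicator {-R..R} x * W x))"

lemma loc_integrable_mult:
  assumes W: "loc_integrable W" and [measurable]: "m \<in> borel_measurable borel"
    and m: "\<And>x. cmod (m x) \<le> C * indicator {-R..R} x"
  shows "integrable lborel (\<lambda>x. W x * m x)"
proof (rule Bochner_Integration.integrable_bound)
  have [measurable]: "W \<in> borel_measurable borel" using W by (simp add: loc_integrable_def)
  show "integrable lborel (\<lambda>x. C * cmod (indicator {-R..R} x * W x))"
    using W unfolding loc_integrable_def by (intro integrable_mult_right integrable_norm) auto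
  show "(\<lambda>x. W x * m x) \<in> borel_measurable lborel" by measurable
  have "cmod (W x * m x) \<le> C * cmod (indicator {-R..R} x * W x)" for x
    using mult_left_mono[OF m[of x], of "cmod (W x)"]
    by (auto simp: norm_mult indicator_def mult.commute split: if_splits)
  then show "AE x in lborel. norm (W x * m x) \<le> norm (C * cmod (indicator {-R..R} x * W x))"
    by (auto intro!: AE_I2 order_trans[OF _ abs_ge_self])
qed

lemma loc_integrable_test:
  assumes "loc_integrable W" "\<psi> \<in> test_functions"
  shows "integrable lborel (\<lambda>x. W x * \<psi> x)"
  using loc_integrable_mult[OF assms(1) test_functions_measurable[OF assms(2)]] test_functions_bound[OF assms(2)]
  by metis

lemma loc_integrable_add: "loc_integrable V \<Longrightarrow> loc_integrable W \<Longrightarrow> loc_integrable (\<lambda>x. V x + W x)"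
  by (auto simp: loc_integrable_def distrib_left)

lemma loc_integrable_cmult: "loc_integrable W \<Longrightarrow> loc_integrable (\<lambda>x. c * W x)"
  by (auto simp: loc_integrable_def mult.left_commute)

lemma loc_integrable_diff: "loc_integrable V \<Longrightarrow> loc_integrable W \<Longrightarrow> loc_integrable (\<lambda>x. V x - W x)"
  by (auto simp: loc_integrable_def right_diff_distrib)

lemma loc_integrable_L1: "integrable lborel W \<Longrightarrow> loc_integrable W"
  unfolding loc_integrable_def
  by (auto intro: Bochner_Integration.integrable_bound[of lborel W] simp: indicator_def)

lemma loc_integrable_L2: "W \<in> L2 \<Longrightarrow> loc_integrable W"
  unfolding loc_integrable_def using L2_trunc_integrable by (auto dest: L2_measurable)

lemma loc_integrable_Ioc:
  assumes "loc_integrable W"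
  shows "integrable lborel (\<lambda>x. indicator {a<..b} x * W x)"
proof -
  have "integrable lborel (\<lambda>x. W x * indicator {a<..b} x)"
    by (rule loc_integrable_mult[OF assms, of _ 1 "max \<bar>a\<bar> \<bar>b\<bar>"]) (auto simp: indicator_def)
  then show ?thesis by (simp add: mult.commute)
qed

lemma integral_test_derivative:
  assumes f: "\<And>x. (f has_vector_derivative f' x) (at x)" and cont: "continuous_on UNIV f'"
    and supp: "\<And>x. x \<notin> {-R..R} \<Longrightarrow> f x = 0" "\<And>x. x \<notin> {-R..R} \<Longrightarrow> f' x = 0" and R: "R > 0"
  shows "(LINT x|lborel. f' x) = (0::complex)"
proof -
  have "has_bochner_integral lborel (\<lambda>x. indicator {-(R+1)..R+1} x *\<^sub>R f' x) (f (R+1) - f (-(R+1)))"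
    by (rule has_bochner_integral_FTC_Icc)
       (use R f in \<open>auto intro: has_vector_derivative_at_within continuous_on_subset[OF cont]\<close>)
  moreover have "(\<lambda>x. indicator {-(R+1)..R+1} x *\<^sub>R f' x) = f'"
    using supp(2) by (auto simp: indicator_def fun_eq_iff)
  ultimately have "has_bochner_integral lborel f' 0" using supp(1) by simp
  then show ?thesis by (rule has_bochner_integral_integral_eq)
qed

lemma bump_test: "c > 0 \<Longrightarrow> (\<lambda>x. of_real (bump c a b x)) \<in> test_functions"
  unfolding test_functions_iff
proof
  show "bounded {x. complex_of_real (bump c a b x) \<noteq> 0}"
    by (rule bounded_subset[OF bounded_closed_interval[of a b]]) (auto simp: bump_eq split: if_splits)
qed (rule smooth_bump)

lemma test_functions_add: "\<psi> \<in> test_functions \<Longrightarrow> \<zeta> \<in> test_functions \<Longrightarrow> (\<lambda>x. \<psi> x + \<zeta> x) \<in> test_functions"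
  unfolding test_functions_iff
  by (auto intro!: smooth_add intro: bounded_subset[of "{x. \<psi> x \<noteq> 0} \<union> {x. \<zeta> x \<noteq> 0}"])

lemma test_functions_mult: "smooth m \<Longrightarrow> \<psi> \<in> test_functions \<Longrightarrow> (\<lambda>x. m x * \<psi> x) \<in> test_functions"
  unfolding test_functions_iff
  by (auto intro!: smooth_mult intro: bounded_subset[of "{x. \<psi> x \<noteq> 0}"])

text \<open>A primitive normalised to 0 on the left of the support is constant on its right, and
  this constant is the integral of \<rho>.\<close>

lemma test_antiderivative:
  assumes \<rho>: "\<rho> \<in> test_functions" and zero: "(LINT x|lborel. \<rho> x) = 0"
  obtains \<zeta> where "\<zeta> \<in> test_functions" "\<And>x. vector_derivative \<zeta> (at x) = \<rho> x"
proof -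
  have sm: "smooth \<rho>" using \<rho> by (simp add: test_functions_iff)
  obtain R where R: "R > 0" "\<And>x. x \<notin> {-R..R} \<Longrightarrow> \<rho> x = 0" using test_functions_support[OF \<rho>] by blast
  have "\<exists>F. \<forall>x::real. - \<infinity> < ereal x \<longrightarrow> ereal x < \<infinity> \<longrightarrow> (F has_vector_derivative \<rho> x) (at x)"
    by (rule einterval_antiderivative)
       (use smooth_continuous_on[OF sm, of UNIV] in \<open>auto simp: continuous_on_eq_continuous_at\<close>)
  then obtain F where F: "\<And>x. (F has_vector_derivative \<rho> x) (at x)" by auto
  define \<zeta> where "\<zeta> x = F x - F (-(R+1))" for x
  have D: "(\<zeta> has_vector_derivative \<rho> x) (at x)" for x
    unfolding \<zeta>_def by (auto intro!: derivative_eq_intros F)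
  have FTC: "(LINT x|lborel. indicator {a..b} x *\<^sub>R \<rho> x) = F b - F a" if "a \<le> b" for a b
    by (rule has_bochner_integral_integral_eq[OF has_bochner_integral_FTC_Icc[OF that]])
       (auto intro: has_vector_derivative_at_within F smooth_continuous_on sm)
  have "\<zeta> x = 0" if x: "x \<notin> {-(R+1)..R+1}" for x
  proof (cases "x < -(R+1)")
    case True
    have "(\<lambda>y. indicator {x..-(R+1)} y *\<^sub>R \<rho> y) = (\<lambda>_. 0)"
      using R(2) by (auto simp: indicator_def fun_eq_iff)
    then show ?thesis using FTC[of x "-(R+1)"] True by (simp add: \<zeta>_def)
  next
    case False
    then have "(\<lambda>y. indicator {-(R+1)..x} y *\<^sub>R \<rho> y) = \<rho>"
      using R(2) x by (auto simp: indicator_def fun_eq_iff)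
    then show ?thesis using FTC[of "-(R+1)" x] False x R(1) zero by (simp add: \<zeta>_def)
  qed
  then have "bounded {x. \<zeta> x \<noteq> 0}"
    by (intro bounded_subset[OF bounded_closed_interval[of "-(R+1)" "R+1"]]) blast
  moreover have "smooth \<zeta>" by (rule smooth_antiderivative[OF sm D])
  ultimately have "\<zeta> \<in> test_functions" by (simp add: test_functions_iff)
  then show ?thesis using vector_derivative_at[OF D] by (rule that)
qed

lemma bump_tendsto:
  "(\<lambda>n. bump (inverse (real (Suc n))) a b x) \<longlonglongrightarrow> indicator {a<..<b} x"
proof (cases "a < x \<and> x < b")
  case True
  have "(\<lambda>n. exp (- inverse (real (Suc n)) / (x - a)) * exp (- inverse (real (Suc n)) / (b - x))) \<longlonglongrightarrow>
      exp (- 0 / (x - a)) * exp (- 0 / (b - x))"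
    by (intro tendsto_intros LIMSEQ_inverse_real_of_nat) (use True in auto)
  then show ?thesis using True by (simp add: bump_eq)
next
  case False
  then have "bump (inverse (real (Suc n))) a b x = 0" for n by (auto simp: bump_eq)
  then show ?thesis using False by auto
qed

lemma bump_integral_nonzero: "(LINT x|lborel. bump 1 0 1 x) \<noteq> 0"
proof
  assume z: "(LINT x|lborel. bump 1 0 1 x) = 0"
  have "integrable lborel (\<lambda>x. complex_of_real (bump 1 0 1 x))"
    by (rule test_functions_integrable[OF bump_test]) simp
  then have "integrable lborel (bump 1 0 1)" by (simp only: complex_of_real_integrable_eq)
  then have "AE x in lborel. bump 1 0 1 x = 0"
    using z by (simp add: integral_nonneg_eq_0_iff_AE bump_bounds)
  then have "AE x in lborel. indicator {0<..<1::real} x = (0::ennreal)"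
    by eventually_elim (auto simp: bump_eq indicator_def split: if_splits)
  then have "(\<integral>\<^sup>+x. indicator {0<..<1::real} x \<partial>lborel) = (\<integral>\<^sup>+x. 0 \<partial>(lborel::real measure))"
    by (rule nn_integral_cong_AE)
  then show False by simp
qed

text \<open>The hypothesis says that W annihilates every test function of mean zero, since these are
  the derivatives of test functions. Subtracting a multiple of one fixed bump of nonzero integral
  gives any test function mean zero, which exhibits W as a constant.\<close>

lemma du_bois_reymond:
  assumes W: "loc_integrable W"
    and zero: "\<And>\<zeta>. \<zeta> \<in> test_functions \<Longrightarrow> (LINT x|lborel. W x * vector_derivative \<zeta> (at x)) = 0"
  shows "\<exists>c. AE x in lborel. W x = c"
proof -
  have [measurable]: "W \<in> borel_measurable borel" using W by (simp add: loc_integrable_def)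
  let ?\<eta> = "\<lambda>x. complex_of_real (bump 1 0 1 x)"
  have \<eta>: "?\<eta> \<in> test_functions" by (rule bump_test) simp
  define m where "m = (LINT x|lborel. ?\<eta> x)"
  have m: "m \<noteq> 0" unfolding m_def using bump_integral_nonzero by simp
  define c where "c = (LINT x|lborel. W x * ?\<eta> x) / m"
  have key: "(LINT x|lborel. W x * \<theta> x) = c * (LINT x|lborel. \<theta> x)" if \<theta>: "\<theta> \<in> test_functions" for \<theta>
  proof -
    \<comment> \<open>The multiple of the bump that carries the whole mean of
      \<open>\<theta>\<close>.\<close>
    define k where "k = (LINT x|lborel. \<theta> x) / m"
    define \<rho> where "\<rho> x = \<theta> x + (- k) * ?\<eta> x" for x
    have \<rho>: "\<rho> \<in> test_functions"
      unfolding \<rho>_def by (intro test_functions_add \<theta> test_functions_mult \<eta> smooth_const)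
    have "(LINT x|lborel. \<rho> x) = (LINT x|lborel. \<theta> x) + (LINT x|lborel. (- k) * ?\<eta> x)"
      unfolding \<rho>_def by (intro Bochner_Integration.integral_add integrable_mult_right test_functions_integrable \<theta> \<eta>)
    also have "(LINT x|lborel. (- k) * ?\<eta> x) = (- k) * m"
      unfolding m_def by (rule integral_mult_right_zero)
    finally have "(LINT x|lborel. \<rho> x) = 0" using m by (simp add: k_def)
    from test_antiderivative[OF \<rho> this] obtain \<zeta> where
      \<zeta>: "\<zeta> \<in> test_functions" "\<And>x. vector_derivative \<zeta> (at x) = \<rho> x" by blast
    have "0 = (LINT x|lborel. W x * \<rho> x)" using zero[OF \<zeta>(1)] unfolding \<zeta>(2) by simp
    also have "\<dots> = (LINT x|lborel. W x * \<theta> x + (- k) * (W x * ?\<eta> x))"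
      by (simp add: \<rho>_def algebra_simps)
    also have "\<dots> = (LINT x|lborel. W x * \<theta> x) + (LINT x|lborel. (- k) * (W x * ?\<eta> x))"
      by (intro Bochner_Integration.integral_add integrable_mult_right loc_integrable_test[OF W] \<theta> \<eta>)
    also have "(LINT x|lborel. (- k) * (W x * ?\<eta> x)) = (- k) * (LINT x|lborel. W x * ?\<eta> x)"
      by (rule integral_mult_right_zero)
    finally show ?thesis by (simp add: k_def c_def)
  qed
  have W': "loc_integrable (\<lambda>x. W x - c)"
  proof (rule loc_integrable_diff[OF W])
    show "loc_integrable (\<lambda>_. c)"
      unfolding loc_integrable_def
    proof (intro conjI allI)
      fix R :: real
      have "integrable lborel (\<lambda>x. indicator {-R..R} x *\<^sub>R c)"
        by (rule integrable_indicator) (auto simp: emeasure_lborel_Icc_eq)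
      moreover have "(\<lambda>x. indicator {-R..R} x *\<^sub>R c) = (\<lambda>x. indicator {-R..R} x * c)"
        by (auto simp: indicator_def)
      ultimately show "integrable lborel (\<lambda>x. indicator {-R..R} x * c)" by simp
    qed simp
  qed
  have "AE x in lborel. W x - c = 0"
  proof (rule AE_zero_of_integral_Ioc)
    show "integrable lborel (\<lambda>x. indicator {a<..b} x * (W x - c))" for a b
      by (rule loc_integrable_Ioc[OF W'])
    fix a b :: real assume "a < b"
    \<comment> \<open>Bumps that converge to the indicator of the open interval carry the identity
      \<open>key\<close> over to intervals.\<close>
    let ?b = "\<lambda>n x. complex_of_real (bump (inverse (real (Suc n))) a b x)"
    have bt: "?b n \<in> test_functions" for n by (rule bump_test) simp
    have [measurable]: "?b n \<in> borel_measurable borel" for n by (rule test_functions_measurable[OF bt])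
    have lim: "(\<lambda>n. LINT x|lborel. (W x - c) * ?b n x) \<longlonglongrightarrow> (LINT x|lborel. (W x - c) * indicator {a<..<b} x)"
    proof (rule integral_dominated_convergence[where w = "\<lambda>x. cmod (indicator {a<..b} x * (W x - c))"])
      show "integrable lborel (\<lambda>x. cmod (indicator {a<..b} x * (W x - c)))"
        by (intro integrable_norm loc_integrable_Ioc[OF W'])
      show "AE x in lborel. norm ((W x - c) * ?b n x) \<le> cmod (indicator {a<..b} x * (W x - c))" for n
      proof (rule AE_I2)
        fix x
        have "cmod (?b n x) \<le> indicator {a<..b} x"
          using bump_bounds[of "inverse (real (Suc n))" a b x] by simp
        from mult_left_mono[OF this norm_ge_zero[of "W x - c"]]
        show "norm ((W x - c) * ?b n x) \<le> cmod (indicator {a<..b} x * (W x - c))"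
          by (auto simp: norm_mult indicator_def split: if_splits)
      qed
      show "AE x in lborel. (\<lambda>n. (W x - c) * ?b n x) \<longlonglongrightarrow> (W x - c) * indicator {a<..<b} x"
      proof (rule AE_I2)
        fix x
        have "(\<lambda>n. (W x - c) * ?b n x) \<longlonglongrightarrow> (W x - c) * complex_of_real (indicator {a<..<b} x)"
          by (intro tendsto_intros bump_tendsto)
        then show "(\<lambda>n. (W x - c) * ?b n x) \<longlonglongrightarrow> (W x - c) * indicator {a<..<b} x"
          by (auto simp: indicator_def)
      qed
    qed measurable
    have "(LINT x|lborel. (W x - c) * ?b n x) = 0" for n
    proof -
      have "(LINT x|lborel. (W x - c) * ?b n x) = (LINT x|lborel. W x * ?b n x - c * ?b n x)"
        by (simp add: left_diff_distrib)
      also have "\<dots> = (LINT x|lborel. W x * ?b n x) - (LINT x|lborel. c * ?b n x)"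
        by (intro Bochner_Integration.integral_diff integrable_mult_right loc_integrable_test[OF W] bt test_functions_integrable)
      also have "\<dots> = 0" unfolding key[OF bt] integral_mult_right_zero by simp
      finally show ?thesis .
    qed
    then have "(LINT x|lborel. (W x - c) * indicator {a<..<b} x) = 0"
      using lim by (simp add: LIMSEQ_const_iff)
    moreover have "(LINT x|lborel. indicator {a<..b} x * (W x - c)) = (LINT x|lborel. (W x - c) * indicator {a<..<b} x)"
    proof (rule integral_cong_AE)
      show "AE x in lborel. indicator {a<..b} x * (W x - c) = (W x - c) * indicator {a<..<b} x"
        using AE_lborel_singleton[of b] by eventually_elim (auto simp: indicator_def)
    qed measurable
    ultimately show "(LINT x|lborel. indicator {a<..b} x * (W x - c)) = 0" by simp
  qed
  then have "AE x in lborel. W x = c" by eventually_elim simp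
  then show ?thesis by blast
qed

subsection \<open>The weak first order equation\<close>

text \<open>The equation -i \<phi>' = k \<phi> + f in the sense of distributions: moving the
  derivative onto the test function changes the sign of -i.\<close>

definition weak_ode :: "complex \<Rightarrow> (real \<Rightarrow> complex) \<Rightarrow> (real \<Rightarrow> complex) \<Rightarrow> bool" where
  "weak_ode k \<phi> f \<longleftrightarrow> (\<forall>\<psi>\<in>test_functions.
     \<i> * (LINT x|lborel. \<phi> x * vector_derivative \<psi> (at x)) = (LINT x|lborel. (k * \<phi> x + f x) * \<psi> x))"

lemma loc_integrable_continuous_mult:
  assumes "loc_integrable W" "continuous_on UNIV (m :: real \<Rightarrow> complex)"
  shows "loc_integrable (\<lambda>x. m x * W x)"
  unfolding loc_integrable_def
proof (intro conjI allI)
  have [measurable]: "m \<in> borel_measurable borel" by (rule borel_measurable_continuous_onI[OF assms(2)])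
  have [measurable]: "W \<in> borel_measurable borel" using assms(1) by (simp add: loc_integrable_def)
  show "(\<lambda>x. m x * W x) \<in> borel_measurable borel" by measurable
  fix R :: real
  have "compact (m ` {-R..R})"
    by (intro compact_continuous_image continuous_on_subset[OF assms(2)]) auto
  then have "bounded (m ` {-R..R})" by (rule compact_imp_bounded)
  then obtain C where C: "C > 0" "\<And>y. y \<in> m ` {-R..R} \<Longrightarrow> norm y \<le> C" unfolding bounded_pos by blast
  have "integrable lborel (\<lambda>x. W x * (indicator {-R..R} x * m x))"
    by (rule loc_integrable_mult[OF assms(1), of _ C R]) (use C in \<open>auto simp: indicator_def\<close>)
  then show "integrable lborel (\<lambda>x. indicator {-R..R} x * (m x * W x))" by (simp add: ac_simps)
qed

text \<open>The difference w of two solutions satisfies w' = i k w weakly; multiplied by exp(-i k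
  x), its weak derivative vanishes and it is constant.\<close>

lemma weak_ode_unique:
  assumes loc: "loc_integrable \<phi>" "loc_integrable \<phi>'" "loc_integrable f"
    and ode: "weak_ode k \<phi> f" "weak_ode k \<phi>' f"
  shows "\<exists>c. AE x in lborel. \<phi> x - \<phi>' x = c * exp (\<i> * k * of_real x)"
proof -
  define w where "w x = \<phi> x - \<phi>' x" for x
  have w: "loc_integrable w" unfolding w_def by (rule loc_integrable_diff[OF loc(1,2)])
  have w_ode: "\<i> * (LINT x|lborel. w x * vector_derivative \<psi> (at x)) = k * (LINT x|lborel. w x * \<psi> x)"
    if \<psi>: "\<psi> \<in> test_functions" for \<psi>
  proof -
    note int = loc_integrable_test[OF _ \<psi>] and int' = loc_integrable_test[OF _ test_functions_derivative[OF \<psi>]]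
    have "\<i> * (LINT x|lborel. w x * vector_derivative \<psi> (at x)) =
      \<i> * (LINT x|lborel. \<phi> x * vector_derivative \<psi> (at x)) - \<i> * (LINT x|lborel. \<phi>' x * vector_derivative \<psi> (at x))"
      unfolding w_def left_diff_distrib
      by (subst Bochner_Integration.integral_diff) (auto intro!: int' loc simp: right_diff_distrib)
    also have "\<dots> = (LINT x|lborel. (k * \<phi> x + f x) * \<psi> x) - (LINT x|lborel. (k * \<phi>' x + f x) * \<psi> x)"
      using ode \<psi> unfolding weak_ode_def by simp
    also have "\<dots> = (LINT x|lborel. (k * \<phi> x + f x) * \<psi> x - (k * \<phi>' x + f x) * \<psi> x)"
      by (intro Bochner_Integration.integral_diff[symmetric] int loc_integrable_add loc_integrable_cmult loc)
    also have "\<dots> = (LINT x|lborel. k * (w x * \<psi> x))" by (simp add: w_def algebra_simps)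
    also have "\<dots> = k * (LINT x|lborel. w x * \<psi> x)" by (rule integral_mult_right_zero)
    finally show ?thesis .
  qed
  define e where "e x = exp (- \<i> * k * of_real x)" for x :: real
  have e_smooth: "smooth e" unfolding e_def using smooth_exp[of 1 "- \<i> * k"] by simp
  have W: "loc_integrable (\<lambda>x. e x * w x)"
    by (rule loc_integrable_continuous_mult[OF w smooth_continuous_on[OF e_smooth]])
  have "\<exists>c. AE x in lborel. e x * w x = c"
  proof (rule du_bois_reymond[OF W])
    fix \<zeta> assume \<zeta>: "\<zeta> \<in> test_functions"
    \<comment> \<open>Differentiating the factor \<open>e\<close> produces the term -i k e \<zeta>,
      which cancels the right side of the equation for w.\<close>
    let ?\<psi> = "\<lambda>x. e x * \<zeta> x"
    have \<psi>: "?\<psi> \<in> test_functions" by (rule test_functions_mult[OF e_smooth \<zeta>])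
    have D: "vector_derivative ?\<psi> (at x) = e x * vector_derivative \<zeta> (at x) - \<i> * k * e x * \<zeta> x" for x
    proof (rule vector_derivative_at)
      have "((\<lambda>z. exp (- \<i> * k * z)) has_field_derivative - \<i> * k * exp (- \<i> * k * of_real x)) (at (of_real x))"
        by (auto intro!: derivative_eq_intros)
      then have "(e has_vector_derivative - \<i> * k * e x) (at x)"
        unfolding e_def by (rule has_vector_derivative_real_field)
      from has_vector_derivative_mult[OF this smooth_has_vector_derivative[of \<zeta> x]] \<zeta>
      show "(?\<psi> has_vector_derivative e x * vector_derivative \<zeta> (at x) - \<i> * k * e x * \<zeta> x) (at x)"
        by (simp add: test_functions_iff)
    qed
    have i1: "integrable lborel (\<lambda>x. e x * w x * vector_derivative \<zeta> (at x))"
      by (rule loc_integrable_test[OF W test_functions_derivative[OF \<zeta>]])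
    have i2: "integrable lborel (\<lambda>x. w x * (e x * \<zeta> x))" by (rule loc_integrable_test[OF w \<psi>])
    have "k * (LINT x|lborel. w x * (e x * \<zeta> x)) = \<i> * (LINT x|lborel. w x * (e x * vector_derivative \<zeta> (at x) - \<i> * k * e x * \<zeta> x))"
      using w_ode[OF \<psi>] unfolding D by simp
    also have "(\<lambda>x. w x * (e x * vector_derivative \<zeta> (at x) - \<i> * k * e x * \<zeta> x)) =
        (\<lambda>x. e x * w x * vector_derivative \<zeta> (at x) - (\<i> * k) * (w x * (e x * \<zeta> x)))"
      by (simp add: algebra_simps)
    also have "(LINT x|lborel. e x * w x * vector_derivative \<zeta> (at x) - (\<i> * k) * (w x * (e x * \<zeta> x))) =
       (LINT x|lborel. e x * w x * vector_derivative \<zeta> (at x)) - (\<i> * k) * (LINT x|lborel. w x * (e x * \<zeta> x))"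
      by (subst Bochner_Integration.integral_diff[OF i1 integrable_mult_right[OF i2]]) simp
    finally show "(LINT x|lborel. e x * w x * vector_derivative \<zeta> (at x)) = 0"
      by (simp add: right_diff_distrib mult.assoc[symmetric])
  qed
  then obtain c where c: "AE x in lborel. e x * w x = c" by blast
  have "AE x in lborel. \<phi> x - \<phi>' x = c * exp (\<i> * k * of_real x)"
    using c
  proof eventually_elim
    case (elim x)
    have "e x * exp (\<i> * k * of_real x) = 1" by (simp add: e_def mult_exp_exp)
    then have "w x = (e x * w x) * exp (\<i> * k * of_real x)" by (simp add: mult_ac)
    then show ?case unfolding elim by (simp add: w_def)
  qed
  then show ?thesis by blast
qed

lemma FT_test_derivative:
  assumes \<psi>: "\<psi> \<in> test_functions"
  shows "FT (\<lambda>x. vector_derivative \<psi> (at x)) \<xi> = \<i> * of_real \<xi> * FT \<psi> \<xi>"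
proof -
  let ?D = "\<lambda>x. vector_derivative \<psi> (at x)" and ?e = "\<lambda>x. exp (- (\<i> * of_real (x * \<xi>)))"
  have sm: "smooth \<psi>" using \<psi> by (simp add: test_functions_iff)
  have dt: "?D \<in> test_functions" by (rule test_functions_derivative[OF \<psi>])
  obtain R1 where R1: "R1 > 0" "\<And>x. x \<notin> {-R1..R1} \<Longrightarrow> \<psi> x = 0" using test_functions_support[OF \<psi>] by blast
  obtain R2 where R2: "R2 > 0" "\<And>x. x \<notin> {-R2..R2} \<Longrightarrow> ?D x = 0" using test_functions_support[OF dt] by blast
  let ?f' = "\<lambda>x. \<psi> x * (- \<i> * of_real \<xi> * ?e x) + ?D x * ?e x"
  have "(LINT x|lborel. ?f' x) = 0"
  proof (rule integral_test_derivative[where f = "\<lambda>x. \<psi> x * ?e x" and R = "max R1 R2"])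
    fix x
    have "((\<lambda>z. exp (- (\<i> * (z * of_real \<xi>)))) has_field_derivative - \<i> * of_real \<xi> * exp (- (\<i> * (of_real x * of_real \<xi>)))) (at (of_real x))"
      by (auto intro!: derivative_eq_intros)
    then have "(?e has_vector_derivative - \<i> * of_real \<xi> * ?e x) (at x)"
      using has_vector_derivative_real_field[of "\<lambda>z. exp (- (\<i> * (z * of_real \<xi>)))" _ x UNIV] by simp
    from has_vector_derivative_mult[OF smooth_has_vector_derivative[OF sm] this]
    show "((\<lambda>x. \<psi> x * ?e x) has_vector_derivative ?f' x) (at x)" .
  next
    show "continuous_on UNIV ?f'"
      using dt sm by (intro continuous_intros smooth_continuous_on) (auto simp: test_functions_iff)
    show "0 < max R1 R2" using R1 by simp
    fix x assume x: "x \<notin> {- max R1 R2..max R1 R2}"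
    have "x \<notin> {-R1..R1}" "x \<notin> {-R2..R2}" using x by auto
    then have z: "\<psi> x = 0" "?D x = 0" using R1(2)[of x] R2(2)[of x] by blast+
    then show "\<psi> x * ?e x = 0" "?f' x = 0" by simp_all
  qed
  moreover have "(LINT x|lborel. ?f' x) = (LINT x|lborel. (- \<i> * of_real \<xi>) * (\<psi> x * ?e x)) + (LINT x|lborel. ?D x * ?e x)"
  proof -
    have "integrable lborel (\<lambda>x. (- \<i> * of_real \<xi>) * (\<psi> x * ?e x))" "integrable lborel (\<lambda>x. ?D x * ?e x)"
      by (rule integrable_mult_right FT_kernel_integrable test_functions_integrable \<psi> dt)+
    from Bochner_Integration.integral_add[OF this] show ?thesis by (simp only: mult.left_commute)
  qed
  moreover have "(LINT x|lborel. (- \<i> * of_real \<xi>) * (\<psi> x * ?e x)) = (- \<i> * of_real \<xi>) * FT \<psi> \<xi>"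
    unfolding FT_def by (rule integral_mult_right_zero)
  ultimately show ?thesis unfolding FT_def[of ?D] by (simp add: add_eq_0_iff)
qed

text \<open>Parseval's identity for both sides of the weak equation: the derivative of the test
  function becomes the factor i times its frequency, and the two integrands then agree almost
  everywhere by hypothesis.\<close>

lemma weak_ode_of_FT:
  assumes L2: "\<phi> \<in> L2" "f \<in> L2"
    and eq: "AE \<xi> in lborel. (of_real \<xi> - k) * l2_fun (l2_FT (l2_cls \<phi>)) \<xi> = l2_fun (l2_FT (l2_cls f)) \<xi>"
  shows "weak_ode k \<phi> f"
  unfolding weak_ode_def
proof
  fix \<psi> assume \<psi>: "\<psi> \<in> test_functions"
  let ?D = "\<lambda>x. vector_derivative \<psi> (at x)"
  let ?P = "l2_fun (l2_FT (l2_cls \<phi>))" and ?F = "l2_fun (l2_FT (l2_cls f))"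
  have dt: "?D \<in> test_functions" by (rule test_functions_derivative[OF \<psi>])
  have d: "?D \<in> L2" "integrable lborel ?D" and p: "\<psi> \<in> L2" "integrable lborel \<psi>"
    using dt \<psi> by (auto intro: test_functions_L2 test_functions_integrable)
  \<comment> \<open>Parseval's identity for the pairing without conjugation, hence the frequency
    -\<xi> in the second factor.\<close>
  have pars: "of_real (2 * pi) * (LINT x|lborel. g x * h x) = (LINT \<xi>|lborel. l2_fun (l2_FT (l2_cls g)) \<xi> * FT h (- \<xi>))"
    if g: "g \<in> L2" and h: "h \<in> L2" "integrable lborel h" for g h
  proof -
    have "of_real (2 * pi) * (LINT x|lborel. g x * h x) = l2_pair (l2_cls (l2_fun (l2_FT (l2_cls g)))) (l2_refl (l2_FT (l2_cls h)))"
      unfolding l2_cls_fun l2_pair_FT_FT l2_pair_cls[OF g h(1)] ..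
    also have "\<dots> = (LINT \<xi>|lborel. l2_fun (l2_FT (l2_cls g)) \<xi> * FT h (- \<xi>))"
      unfolding l2_FT_cls[OF h] l2_refl_cls[OF FT_L2[OF h(2,1)]]
      by (rule l2_pair_cls[OF l2_fun_L2 L2_refl[OF FT_L2[OF h(2,1)]]])
    finally show ?thesis .
  qed
  have kL2: "(\<lambda>x. k * \<phi> x + f x) \<in> L2" by (intro L2_add L2_cmult L2)
  have kf: "AE \<xi> in lborel. l2_fun (l2_FT (l2_cls (\<lambda>x. k * \<phi> x + f x))) \<xi> = k * ?P \<xi> + ?F \<xi>"
  proof -
    have 1: "l2_FT (l2_cls (\<lambda>x. k * \<phi> x + f x)) = l2_mul (\<lambda>_. k) (l2_FT (l2_cls \<phi>)) + l2_FT (l2_cls f)"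
      by (simp add: l2_cls_add L2 L2_cmult l2_mul_cls[symmetric] bounded_linear.linear[OF bounded_linear_l2_FT, THEN linear_add] l2_FT_mul_const)
    show ?thesis unfolding 1
      using l2_fun_plus[of "l2_mul (\<lambda>_. k) (l2_FT (l2_cls \<phi>))" "l2_FT (l2_cls f)"] l2_fun_mul[OF bdd_mult_const, of k "l2_FT (l2_cls \<phi>)"]
      by eventually_elim simp
  qed
  have [measurable]: "(\<lambda>\<xi>. FT \<psi> (- \<xi>)) \<in> borel_measurable borel" "(\<lambda>\<xi>. FT ?D (- \<xi>)) \<in> borel_measurable borel"
    by (rule L2_measurable[OF L2_refl[OF FT_L2]], rule p d, rule p d)+
  have "of_real (2 * pi) * (\<i> * (LINT x|lborel. \<phi> x * ?D x)) = \<i> * (LINT \<xi>|lborel. ?P \<xi> * FT ?D (- \<xi>))"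
    using pars[OF L2(1) d] by (simp add: mult.left_commute)
  also have "\<dots> = (LINT \<xi>|lborel. \<i> * (?P \<xi> * FT ?D (- \<xi>)))" by simp
  also have "\<dots> = (LINT \<xi>|lborel. l2_fun (l2_FT (l2_cls (\<lambda>x. k * \<phi> x + f x))) \<xi> * FT \<psi> (- \<xi>))"
  proof (rule integral_cong_AE)
    show "AE \<xi> in lborel. \<i> * (?P \<xi> * FT ?D (- \<xi>)) = l2_fun (l2_FT (l2_cls (\<lambda>x. k * \<phi> x + f x))) \<xi> * FT \<psi> (- \<xi>)"
      using kf eq
    proof eventually_elim
      case (elim \<xi>)
      have "\<i> * (?P \<xi> * FT ?D (- \<xi>)) = (\<i> * \<i>) * of_real (- \<xi>) * (?P \<xi> * FT \<psi> (- \<xi>))"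
        unfolding FT_test_derivative[OF \<psi>] by (simp only: mult_ac)
      then have "\<i> * (?P \<xi> * FT ?D (- \<xi>)) = of_real \<xi> * ?P \<xi> * FT \<psi> (- \<xi>)"
        by simp
      also have "of_real \<xi> * ?P \<xi> = k * ?P \<xi> + ?F \<xi>"
        using elim(2) by (simp add: algebra_simps)
      finally show ?case unfolding elim(1) .
    qed
  qed measurable
  also have "\<dots> = of_real (2 * pi) * (LINT x|lborel. (k * \<phi> x + f x) * \<psi> x)"
    by (rule pars[OF kL2 p, symmetric])
  finally show "\<i> * (LINT x|lborel. \<phi> x * ?D x) = (LINT x|lborel. (k * \<phi> x + f x) * \<psi> x)" by simp
qed

subsection \<open>The Fredholm alternative\<close>

text \<open>Dimension count on a finite-dimensional invariant subspace: the image of a basis B is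
  independent, and a vector outside its span would give more than card B independent vectors in the
  span of B.\<close>

lemma linear_inj_surj_on_span:
  fixes L :: "'a::real_vector \<Rightarrow> 'a"
  assumes L: "linear L" and S: "finite S" and maps: "\<And>v. v \<in> span S \<Longrightarrow> L v \<in> span S"
    and inj: "\<And>v. v \<in> span S \<Longrightarrow> L v = 0 \<Longrightarrow> v = 0"
    and y: "y \<in> span S"
  shows "\<exists>v\<in>span S. L v = y"
proof -
  obtain B where B: "B \<subseteq> S" "independent B" "S \<subseteq> span B"
    by (rule maximal_independent_subset)
  have fB: "finite B" using B(1) S by (rule finite_subset)
  have sp: "span B = span S"
    using B by (intro subset_antisym span_mono span_minimal[OF B(3) subspace_span])
  have inj_on: "inj_on L (span B)"
    unfolding linear_inj_on_span_iff_independent_image[OF L, of B, symmetric] sp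
    by (simp add: linear_inj_on_iff_eq_0[OF L subspace_span] inj)
  have ind: "independent (L ` B)"
    by (rule linear_independent_injective_image[OF L B(2) inj_on])
  have card: "card (L ` B) = card B"
    by (rule card_image[OF inj_on_subset[OF inj_on span_superset]])
  have sub: "L ` B \<subseteq> span B" using maps B(1) span_superset[of S] unfolding sp by blast
  have "y \<in> span (L ` B)"
  proof (rule ccontr)
    assume ny: "y \<notin> span (L ` B)"
    then have "independent (insert y (L ` B))" using ind by (simp add: independent_insert)
    moreover have "insert y (L ` B) \<subseteq> span B" using sub y sp by simp
    ultimately have "card (insert y (L ` B)) \<le> card B"
      by (rule independent_span_bound[OF fB, THEN conjunct2])
    moreover have "y \<notin> L ` B" using ny span_base[of y "L ` B"] by auto
    ultimately show False using fB card by simp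
  qed
  then have "y \<in> L ` span B" by (simp add: linear_span_image[OF L])
  then show ?thesis unfolding sp by blast
qed

text \<open>The difference B = A - F is a contraction, so 1 - B has a linear inverse G by the fixed
  point theorem. Then x - A x = y is equivalent to x - G (F x) = G y, an equation with a finite rank
  operator, for which injectivity implies solvability.\<close>

lemma fredholm_alternative:
  fixes A F :: "'a::banach \<Rightarrow> 'a"
  assumes A: "linear A" and F: "linear F" and S: "finite S" and range: "\<And>x. F x \<in> span S"
    and close: "\<And>x. norm (A x - F x) \<le> c * norm x" and c: "0 \<le> c" "c < 1"
    and inj: "\<And>x. A x = x \<Longrightarrow> x = 0"
  shows "\<exists>x. x - A x = y"
proof -
  define B where "B x = A x - F x" for x
  have B: "linear B" unfolding B_def using A F by (rule linear_compose_sub)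
  have uniq: "\<exists>!x. y + B x = x" for y
  proof (rule banach_fix_type[OF c], intro allI)
    fix x z
    have "dist (y + B x) (y + B z) = norm (B (x - z))"
      by (simp add: dist_norm linear_diff[OF B])
    also have "\<dots> \<le> c * dist x z" unfolding B_def dist_norm by (rule close)
    finally show "dist (y + B x) (y + B z) \<le> c * dist x z" .
  qed
  define G where "G y = (THE x. y + B x = x)" for y
  have G: "y + B (G y) = G y" for y
    unfolding G_def by (rule theI'[OF uniq])
  have G_unique: "x = G y" if "y + B x = x" for x y
    using uniq[of y] that G[of y] by auto
  have linG: "linear G"
  proof (rule linearI)
    fix a b :: 'a and r :: real
    have "(a + b) + B (G a + G b) = (a + B (G a)) + (b + B (G b))"
      by (simp add: linear_add[OF B])
    also have "\<dots> = G a + G b" unfolding G ..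
    finally show "G (a + b) = G a + G b" by (rule G_unique[symmetric])
    have "r *\<^sub>R a + B (r *\<^sub>R G a) = r *\<^sub>R (a + B (G a))"
      by (simp add: linear_scale[OF B] scaleR_add_right)
    also have "\<dots> = r *\<^sub>R G a" unfolding G ..
    finally show "G (r *\<^sub>R a) = r *\<^sub>R G a" by (rule G_unique[symmetric])
  qed
  define T where "T x = G (F x)" for x
  have linT: "linear T" unfolding T_def using linear_compose[OF F linG] by (simp add: comp_def)
  have T_range: "T x \<in> span (G ` S)" for x
    unfolding T_def linear_span_image[OF linG] using range by blast
  have fix0: "x = 0" if "T x = x" for x
  proof (rule inj)
    have "F x + B (G (F x)) = G (F x)" by (rule G)
    then show "A x = x" using that unfolding T_def by (simp add: B_def)
  qed
  have linI: "linear (\<lambda>v. v - T v)"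
    by (rule linear_compose_sub[OF linear_ident linT])
  \<comment> \<open>G y need not lie in the finite-dimensional range, but T (G y) does; so the
    correction v = x - G y is solved for instead of x.\<close>
  have "\<exists>v\<in>span (G ` S). v - T v = T (G y)"
  proof (rule linear_inj_surj_on_span[OF linI])
    show "finite (G ` S)" using S by simp
    show "v - T v \<in> span (G ` S)" if "v \<in> span (G ` S)" for v
      using that T_range by (rule span_diff)
    show "v = 0" if "v - T v = 0" for v using that by (intro fix0) simp
    show "T (G y) \<in> span (G ` S)" by (rule T_range)
  qed
  then obtain v where v: "v - T v = T (G y)" by blast
  define x where "x = G y + v"
  have x: "x = G (y + F x)"
  proof -
    have "T x = T (G y) + T v" unfolding x_def by (rule linear_add[OF linT])
    then have "x = G y + T x" using v by (simp add: x_def algebra_simps)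
    then show ?thesis unfolding T_def by (simp add: linear_add[OF linG])
  qed
  have "(y + F x) + B x = x" using G[of "y + F x"] unfolding x[symmetric] .
  then have "x - A x = y" by (simp add: B_def algebra_simps)
  then show ?thesis by blast
qed

subsection \<open>Behaviour at the ends of the line\<close>

text \<open>The sign \<^term>\<open>\<sigma>\<close> selects the end of the line: \<open>vanish \<sigma> f\<close> says that \<open>f\<close> tends to 0
  at \<open>- \<sigma> \<infinity>\<close>.\<close>

definition vanish :: "real \<Rightarrow> (real \<Rightarrow> complex) \<Rightarrow> bool" where
  "vanish \<sigma> f \<longleftrightarrow> (\<forall>e>0. \<exists>N. \<forall>x. \<sigma> * x < N \<longrightarrow> cmod (f x) < e)"

lemma vanish_at_bot: "vanish 1 f \<longleftrightarrow> (f \<longlongrightarrow> 0) at_bot"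
  unfolding vanish_def tendsto_iff eventually_at_bot_dense by simp

lemma vanish_at_top: "vanish (-1) f \<longleftrightarrow> (f \<longlongrightarrow> 0) at_top"
proof -
  have "(\<exists>N. \<forall>x. - 1 * x < N \<longrightarrow> cmod (f x) < e) \<longleftrightarrow> (\<exists>N. \<forall>x>N. cmod (f x) < e)" for e
  proof
    assume "\<exists>N. \<forall>x. - 1 * x < N \<longrightarrow> cmod (f x) < e"
    then obtain N where "\<forall>x. - 1 * x < N \<longrightarrow> cmod (f x) < e" by blast
    then show "\<exists>N. \<forall>x>N. cmod (f x) < e" by (intro exI[of _ "- N"]) auto
  next
    assume "\<exists>N. \<forall>x>N. cmod (f x) < e"
    then obtain N where "\<forall>x>N. cmod (f x) < e" by blast
    then show "\<exists>N. \<forall>x. - 1 * x < N \<longrightarrow> cmod (f x) < e" by (intro exI[of _ "- N"]) auto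
  qed
  then show ?thesis unfolding vanish_def tendsto_iff eventually_at_top_dense by simp
qed

lemma halfline_infinite:
  assumes "\<sigma> = 1 \<or> \<sigma> = (-1::real)"
  shows "emeasure lborel {x. \<sigma> * x < N} = \<infinity>"
proof (rule ccontr)
  assume "emeasure lborel {x. \<sigma> * x < N} \<noteq> \<infinity>"
  then obtain n :: nat where n: "emeasure lborel {x. \<sigma> * x < N} < of_nat n"
    using ennreal_Ex_less_of_nat by (auto simp: less_top)
  define I where "I = (if \<sigma> = 1 then {N - real n<..<N} else {- N<..<- N + real n})"
  have "emeasure lborel I = ennreal (real n)"
    by (simp add: I_def)
  moreover have "emeasure lborel I \<le> emeasure lborel {x. \<sigma> * x < N}"
    by (rule emeasure_mono) (use assms in \<open>auto simp: I_def split: if_splits\<close>)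
  ultimately show False using n by (simp add: ennreal_of_nat_eq_real_of_nat)
qed

lemma halfline_not_null:
  assumes "\<sigma> = 1 \<or> \<sigma> = (-1::real)" "AE x in lborel. \<not> \<sigma> * x < N"
  shows False
proof -
  have "emeasure lborel {x. \<sigma> * x < N} = (\<integral>\<^sup>+x. indicator {x. \<sigma> * x < N} x \<partial>lborel)"
    by (rule nn_integral_indicator[symmetric]) measurable
  also have "\<dots> = (\<integral>\<^sup>+x. 0 \<partial>(lborel::real measure))"
    by (rule nn_integral_cong_AE) (use assms(2) in \<open>eventually_elim, simp add: indicator_def\<close>)
  finally show False using halfline_infinite[OF assms(1)] by simp
qed

lemma L2_not_bounded_below:
  assumes \<sigma>: "\<sigma> = 1 \<or> \<sigma> = (-1::real)" and g: "g \<in> L2" and e: "e > 0"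
    and AE: "AE x in lborel. \<sigma> * x < N \<longrightarrow> e \<le> cmod (g x)"
  shows False
proof -
  have "(\<integral>\<^sup>+x. ennreal (e\<^sup>2) * indicator {x. \<sigma> * x < N} x \<partial>lborel) \<le> (\<integral>\<^sup>+x. ennreal ((cmod (g x))\<^sup>2) \<partial>lborel)"
  proof (rule nn_integral_mono_AE)
    show "AE x in lborel. ennreal (e\<^sup>2) * indicator {x. \<sigma> * x < N} x \<le> ennreal ((cmod (g x))\<^sup>2)"
      using AE by eventually_elim (use e in \<open>auto simp: indicator_def intro!: ennreal_leI power_mono\<close>)
  qed
  also have "\<dots> < \<infinity>" unfolding L2_nn_eq[OF g] by simp
  finally show False
    using e halfline_infinite[OF \<sigma>] by (subst (asm) nn_integral_cmult_indicator) (auto simp: ennreal_mult_eq_top_iff)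
qed

text \<open>Towards the end at -\<sigma> infinity, exp(i k x) has modulus at least 1 because 0 \<le>
  \<sigma> Im k, while r tends to 0. With c \<noteq> 0 the function g would stay above |c|/2 on a
  half-line, contrary to either assumption on g.\<close>

lemma vanishing_solution_zero:
  assumes \<sigma>: "\<sigma> = 1 \<or> \<sigma> = (-1::real)" and k: "0 \<le> \<sigma> * Im k"
    and eq: "AE x in lborel. g x - r x = c * exp (\<i> * k * of_real x)"
    and r: "vanish \<sigma> r" and g: "g \<in> L2 \<or> vanish \<sigma> g"
  shows "c = 0"
proof (rule ccontr)
  assume "c \<noteq> 0"
  define e where "e = cmod c / 2"
  have e: "e > 0" using \<open>c \<noteq> 0\<close> by (simp add: e_def)
  obtain N where N: "\<And>x. \<sigma> * x < N \<Longrightarrow> cmod (r x) < e"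
    using r e unfolding vanish_def by blast
  have low: "AE x in lborel. \<sigma> * x < min N 0 \<longrightarrow> e \<le> cmod (g x)"
    using eq
  proof eventually_elim
    case (elim x)
    show ?case
    proof
      assume x: "\<sigma> * x < min N 0"
      have "0 \<le> - (Im k * x)"
      proof -
        have "0 \<le> (\<sigma> * Im k) * (- (\<sigma> * x))" using x by (intro mult_nonneg_nonneg[OF k]) simp
        also have "\<dots> = - (Im k * x)" using \<sigma> by auto
        finally show ?thesis .
      qed
      then have "1 \<le> cmod (exp (\<i> * k * of_real x))" by (simp add: norm_exp_eq_Re)
      then have "cmod c * 1 \<le> cmod c * cmod (exp (\<i> * k * of_real x))" by (rule mult_left_mono) simp
      also have "\<dots> = cmod (g x - r x)" unfolding elim by (simp add: norm_mult)
      also have "\<dots> \<le> cmod (g x) + cmod (r x)" by (rule norm_triangle_ineq4)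
      finally show "e \<le> cmod (g x)" using N[of x] x unfolding e_def by simp
    qed
  qed
  from g show False
  proof
    assume "g \<in> L2" then show False using L2_not_bounded_below[OF \<sigma> _ e low] by blast
  next
    assume "vanish \<sigma> g"
    then obtain M where M: "\<And>x. \<sigma> * x < M \<Longrightarrow> cmod (g x) < e" using e unfolding vanish_def by blast
    have "AE x in lborel. \<not> \<sigma> * x < min M (min N 0)"
      using low
    proof eventually_elim
      case (elim x)
      then show ?case using M[of x] by fastforce
    qed
    then show False by (rule halfline_not_null[OF \<sigma>])
  qed
qed

lemma bdd_mult_resolvent:
  assumes "Im k \<noteq> 0"
  shows "bdd_mult (\<lambda>\<xi>. 1 / (of_real \<xi> - k))"
proof (rule bdd_multI)
  fix \<xi> :: real
  have "\<bar>Im k\<bar> \<le> cmod (of_real \<xi> - k)" using abs_Im_le_cmod[of "of_real \<xi> - k"] by simp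
  then show "cmod (1 / (of_real \<xi> - k)) \<le> 1 / \<bar>Im k\<bar>"
    using assms by (simp add: norm_divide frac_le)
qed measurable

lemma weak_ode_FT:
  assumes L2: "\<phi> \<in> L2" "f \<in> L2" and ode: "weak_ode k \<phi> f"
  shows "AE \<xi> in lborel. (of_real \<xi> - k) * l2_fun (l2_FT (l2_cls \<phi>)) \<xi> = l2_fun (l2_FT (l2_cls f)) \<xi>"
proof -
  \<comment> \<open>The equation is rewritten with the spectral parameter \<open>\<i>\<close> off the real line, for which
    it is solved by a bounded Fourier multiplier.\<close>
  define g where "g x = f x + (k - \<i>) * \<phi> x" for x
  have g: "g \<in> L2" unfolding g_def by (intro L2_add L2_cmult L2)
  have kg: "\<i> * \<phi> x + g x = k * \<phi> x + f x" for x by (simp add: g_def algebra_simps)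
  have ode': "weak_ode \<i> \<phi> g" using ode unfolding weak_ode_def kg .
  define m where "m = (\<lambda>\<xi>. 1 / (of_real \<xi> - \<i>))"
  have m: "bdd_mult m" unfolding m_def by (rule bdd_mult_resolvent) simp
  define a where "a = l2_IFT (l2_mul m (l2_FT (l2_cls g)))"
  have a: "AE \<xi> in lborel. (of_real \<xi> - \<i>) * l2_fun (l2_FT (l2_cls (l2_fun a))) \<xi> = l2_fun (l2_FT (l2_cls g)) \<xi>"
    unfolding l2_cls_fun a_def l2_FT_IFT using l2_fun_mul[OF m, of "l2_FT (l2_cls g)"]
  proof eventually_elim
    case (elim \<xi>)
    have "complex_of_real \<xi> - \<i> \<noteq> 0" by (simp add: complex_eq_iff)
    then show ?case unfolding elim by (simp add: m_def)
  qed
  have "weak_ode \<i> (l2_fun a) g" by (rule weak_ode_of_FT[OF l2_fun_L2 g a])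
  then obtain c where c: "AE x in lborel. \<phi> x - l2_fun a x = c * exp (\<i> * \<i> * of_real x)"
    using weak_ode_unique[OF loc_integrable_L2[OF L2(1)] loc_integrable_L2[OF l2_fun_L2] loc_integrable_L2[OF g] ode'] by blast
  \<comment> \<open>The exponential is exp(-x) here, which is not square integrable near minus
    infinity, whereas the difference of the two solutions is in L^2.\<close>
  have "c = 0"
  proof (rule vanishing_solution_zero[of 1 \<i> "\<lambda>x. \<phi> x - l2_fun a x" "\<lambda>_. 0"])
    show "AE x in lborel. \<phi> x - l2_fun a x - 0 = c * exp (\<i> * \<i> * of_real x)" using c by simp
    show "(\<lambda>x. \<phi> x - l2_fun a x) \<in> L2 \<or> vanish 1 (\<lambda>x. \<phi> x - l2_fun a x)"
      by (intro disjI1 L2_diff L2 l2_fun_L2)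
  qed (auto simp: vanish_def)
  then have "l2_cls \<phi> = a"
    using l2_cls_eq[OF L2(1) l2_fun_L2[of a]] c by simp
  then have 1: "AE \<xi> in lborel. (of_real \<xi> - \<i>) * l2_fun (l2_FT (l2_cls \<phi>)) \<xi> = l2_fun (l2_FT (l2_cls g)) \<xi>"
    using a by simp
  have 2: "l2_FT (l2_cls g) = l2_FT (l2_cls f) + l2_mul (\<lambda>_. k - \<i>) (l2_FT (l2_cls \<phi>))"
    unfolding g_def by (simp add: l2_cls_add L2 L2_cmult l2_mul_cls[symmetric]
      bounded_linear.linear[OF bounded_linear_l2_FT, THEN linear_add] l2_FT_mul_const)
  show ?thesis
    using 1 l2_fun_plus[of "l2_FT (l2_cls f)" "l2_mul (\<lambda>_. k - \<i>) (l2_FT (l2_cls \<phi>))"]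
      l2_fun_mul[OF bdd_mult_const, of "k - \<i>" "l2_FT (l2_cls \<phi>)"]
    unfolding 2
    by eventually_elim (simp add: algebra_simps)
qed

text \<open>Comparison with (1 + |x|)^(-2s), which has an explicit primitive that vanishes at
  infinity because 2s > 1; the factor 2^s comes from (1 + |x|)^2 \<le> 2 (1 + x^2).\<close>

lemma integrable_bracket:
  assumes s: "s > (1/2::real)"
  shows "integrable lborel (\<lambda>x::real. (1 + x\<^sup>2) powr (- s))"
proof -
  define g where "g x = (1 + x) powr (- 2 * s) * indicator {0..} x" for x :: real
  have [measurable]: "g \<in> borel_measurable borel" unfolding g_def by measurable
  have "(\<integral>\<^sup>+x. ennreal ((1 + x) powr (- 2 * s)) * indicator {0..} x \<partial>lborel) = ennreal (0 - (1 + 0) powr (1 - 2 * s) / (1 - 2 * s))"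
  proof (rule nn_integral_FTC_atLeast)
    fix x :: real assume "0 \<le> x"
    then show "((\<lambda>x. (1 + x) powr (1 - 2 * s) / (1 - 2 * s)) has_real_derivative (1 + x) powr (- 2 * s)) (at x)"
      using s by (auto intro!: derivative_eq_intros)
  next
    have "filterlim (\<lambda>x::real. 1 + x) at_top at_top"
      by (rule filterlim_tendsto_add_at_top[of "\<lambda>_. 1" 1 at_top "\<lambda>x. x", OF tendsto_const filterlim_ident])
    then have "((\<lambda>x. (1 + x) powr (1 - 2 * s)) \<longlongrightarrow> 0) at_top"
      using s by (intro tendsto_neg_powr) auto
    from tendsto_divide[OF this tendsto_const, of "1 - 2 * s"] s
    show "((\<lambda>x. (1 + x) powr (1 - 2 * s) / (1 - 2 * s)) \<longlongrightarrow> 0) at_top" by simp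
  qed auto
  then have "(\<integral>\<^sup>+x. ennreal (g x) \<partial>lborel) < \<infinity>"
    by (simp add: g_def ennreal_mult'' ennreal_indicator)
  then have g: "integrable lborel g"
    by (intro integrableI_nonneg) (auto simp: g_def)
  then have g': "integrable lborel (\<lambda>x. g (- x))"
    using lborel_integrable_real_affine[OF g, of "-1" 0] by simp
  show ?thesis
  proof (rule Bochner_Integration.integrable_bound)
    show "integrable lborel (\<lambda>x. 2 powr s * (g x + g (- x)))"
      by (intro integrable_mult_right Bochner_Integration.integrable_add g g')
    have "(1 + x\<^sup>2) powr (- s) \<le> 2 powr s * (g x + g (- x))" for x :: real
    proof -
      have "(1 + \<bar>x\<bar>)\<^sup>2 \<le> 2 * (1 + x\<^sup>2)"
        using sum_squares_bound[of 1 "\<bar>x\<bar>"] by (simp add: power2_sum)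
      then have "(1 + \<bar>x\<bar>)\<^sup>2 / 2 \<le> 1 + x\<^sup>2" by simp
      then have "(1 + x\<^sup>2) powr (- s) \<le> ((1 + \<bar>x\<bar>)\<^sup>2 / 2) powr (- s)"
        using s by (intro powr_mono2') auto
      also have "\<dots> = 2 powr s * (1 + \<bar>x\<bar>) powr (- 2 * s)"
      proof -
        have "(1 + \<bar>x\<bar>)\<^sup>2 = (1 + \<bar>x\<bar>) powr 2" by simp
        then have "((1 + \<bar>x\<bar>)\<^sup>2) powr (- s) = (1 + \<bar>x\<bar>) powr (- 2 * s)"
          by (simp only: powr_powr mult_minus_right mult_minus_left)
        moreover have "((1 + \<bar>x\<bar>)\<^sup>2 / 2) powr (- s) = ((1 + \<bar>x\<bar>)\<^sup>2) powr (- s) / 2 powr (- s)"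
          by (rule powr_divide)
        ultimately show ?thesis by (simp add: powr_minus_divide)
      qed
      also have "(1 + \<bar>x\<bar>) powr (- 2 * s) \<le> g x + g (- x)"
        by (auto simp: g_def indicator_def)
      finally show ?thesis by (simp add: mult_left_mono)
    qed
    then show "AE x in lborel. norm ((1 + x\<^sup>2) powr (- s)) \<le> norm (2 powr s * (g x + g (- x)))"
      by (auto intro!: AE_I2 order_trans[OF _ abs_ge_self])
  qed measurable
qed

subsection \<open>The outgoing and incoming resolvents of the free operator\<close>

text \<open>Up to the factor i \<sigma>, the fundamental solution of -i d/dx - k that is supported
  on the side \<sigma> (x - y) > 0.\<close>

definition res_kernel :: "real \<Rightarrow> complex \<Rightarrow> real \<Rightarrow> real \<Rightarrow> complex" where
  "res_kernel \<sigma> k x y = indicator {0<..} (\<sigma> * (x - y)) * exp (\<i> * k * of_real (x - y))"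

definition res :: "real \<Rightarrow> complex \<Rightarrow> (real \<Rightarrow> complex) \<Rightarrow> real \<Rightarrow> complex" where
  "res \<sigma> k f x = \<i> * of_real \<sigma> * (LINT y|lborel. res_kernel \<sigma> k x y * f y)"

lemma res_kernel_measurable [measurable (raw)]:
  assumes "f \<in> borel_measurable M" "g \<in> borel_measurable M"
  shows "(\<lambda>z. res_kernel \<sigma> k (f z) (g z)) \<in> borel_measurable M"
  unfolding res_kernel_def using assms by measurable

lemma res_measurable:
  assumes [measurable]: "f \<in> borel_measurable borel"
  shows "res \<sigma> k f \<in> borel_measurable borel"
proof -
  have "(\<lambda>x. LINT y|lborel. res_kernel \<sigma> k x y * f y) \<in> borel_measurable borel"
    by measurable
  then show ?thesis unfolding res_def[abs_def] by measurable
qed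

text \<open>The sign condition keeps the kernel bounded by 1. For real k it holds with both values
  of \<sigma>.\<close>

locale halfline_resolvent =
  fixes \<sigma> :: real and k :: complex
  assumes \<sigma>: "\<sigma> = 1 \<or> \<sigma> = -1" and k: "0 \<le> \<sigma> * Im k"
begin

lemma exp_le_one:
  assumes "0 \<le> \<sigma> * t" shows "cmod (exp (\<i> * k * of_real t)) \<le> 1"
proof -
  have "0 \<le> (\<sigma> * Im k) * (\<sigma> * t)" by (intro mult_nonneg_nonneg k assms)
  also have "\<dots> = Im k * t" using \<sigma> by auto
  finally show ?thesis by (simp add: norm_exp_eq_Re)
qed

lemma res_kernel_le: "cmod (res_kernel \<sigma> k x y) \<le> indicator {0<..} (\<sigma> * (x - y))"
  unfolding res_kernel_def norm_mult
  by (cases "0 < \<sigma> * (x - y)") (use exp_le_one[of "x - y"] in auto)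

lemma res_kernel_le_one: "cmod (res_kernel \<sigma> k x y) \<le> 1"
  by (rule order_trans[OF res_kernel_le]) (simp add: indicator_def)

lemma res_integrable:
  assumes "integrable lborel f"
  shows "integrable lborel (\<lambda>y. res_kernel \<sigma> k x y * f y)"
proof (rule Bochner_Integration.integrable_bound[OF assms])
  have [measurable]: "f \<in> borel_measurable borel" using assms by auto
  show "(\<lambda>y. res_kernel \<sigma> k x y * f y) \<in> borel_measurable lborel" by measurable
  show "AE y in lborel. norm (res_kernel \<sigma> k x y * f y) \<le> norm (f y)"
    using res_kernel_le_one[of x] by (intro AE_I2) (simp add: norm_mult mult_left_le_one_le)
qed

lemma res_add:
  assumes "integrable lborel f" "integrable lborel g"
  shows "res \<sigma> k (\<lambda>y. f y + g y) x = res \<sigma> k f x + res \<sigma> k g x"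
  unfolding res_def distrib_left[of "res_kernel _ _ _ _"]
  by (subst Bochner_Integration.integral_add) (simp_all add: res_integrable assms distrib_left)

lemma res_cmult: "res \<sigma> k (\<lambda>y. c * f y) x = c * res \<sigma> k f x"
  unfolding res_def by (simp add: mult.left_commute)

lemma res_cong_AE:
  assumes "f \<in> borel_measurable borel" "g \<in> borel_measurable borel" "AE y in lborel. f y = g y"
  shows "res \<sigma> k f = res \<sigma> k g"
proof
  fix x
  have "(LINT y|lborel. res_kernel \<sigma> k x y * f y) = (LINT y|lborel. res_kernel \<sigma> k x y * g y)"
  proof (rule integral_cong_AE)
    show "AE y in lborel. res_kernel \<sigma> k x y * f y = res_kernel \<sigma> k x y * g y"
      using assms(3) by eventually_elim simp
  qed (use assms in measurable)
  then show "res \<sigma> k f x = res \<sigma> k g x" by (simp add: res_def)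
qed

lemma integrable_indicator_norm:
  fixes f :: "real \<Rightarrow> complex"
  assumes "integrable lborel f" and [measurable]: "E \<in> sets borel"
  shows "integrable lborel (\<lambda>y. indicator E y * cmod (f y))"
proof (rule Bochner_Integration.integrable_bound[OF integrable_norm[OF assms(1)]])
  have [measurable]: "f \<in> borel_measurable borel" using assms by auto
  show "(\<lambda>y. indicator E y * cmod (f y)) \<in> borel_measurable lborel" by measurable
qed (auto simp: indicator_def)

lemma kernel_integral_le:
  fixes f :: "real \<Rightarrow> complex"
  assumes f: "integrable lborel f" and [measurable]: "E \<in> sets borel"
    and m: "m \<in> borel_measurable borel" "\<And>y. cmod (m y) \<le> indicator E y"
  shows "cmod (LINT y|lborel. m y * f y) \<le> (LINT y|lborel. indicator E y * cmod (f y))"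
proof -
  have [measurable]: "f \<in> borel_measurable borel" using f by auto
  note m(1)[measurable]
  have "cmod (LINT y|lborel. m y * f y) \<le> (LINT y|lborel. cmod (m y * f y))"
    by (rule integral_norm_bound)
  also have "\<dots> \<le> (LINT y|lborel. indicator E y * cmod (f y))"
  proof (rule integral_mono')
    show "integrable lborel (\<lambda>y. indicator E y * cmod (f y))"
      by (rule integrable_indicator_norm[OF f]) measurable
    show "cmod (m y * f y) \<le> indicator E y * cmod (f y)" for y
      using m(2)[of y] by (simp add: norm_mult mult_right_mono)
  qed simp
  finally show ?thesis .
qed

lemma norm_res: "cmod (res \<sigma> k f x) = cmod (LINT y|lborel. res_kernel \<sigma> k x y * f y)"
  using \<sigma> by (auto simp: res_def norm_mult)

lemma res_tail:
  assumes "integrable lborel f"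
  shows "cmod (res \<sigma> k f x) \<le> (LINT y|lborel. indicator {y. 0 < \<sigma> * (x - y)} y * cmod (f y))"
  unfolding norm_res
proof (rule kernel_integral_le[OF assms])
  show "cmod (res_kernel \<sigma> k x y) \<le> indicator {y. 0 < \<sigma> * (x - y)} y" for y
    using res_kernel_le[of x y] by (simp add: indicator_def)
qed measurable

lemma res_bound:
  assumes "integrable lborel f"
  shows "cmod (res \<sigma> k f x) \<le> (LINT y|lborel. cmod (f y))"
proof -
  have "(LINT y|lborel. indicator {y. 0 < \<sigma> * (x - y)} y * cmod (f y)) \<le> (LINT y|lborel. cmod (f y))"
    by (rule integral_mono') (auto intro: assms simp: indicator_def)
  with res_tail[OF assms, of x] show ?thesis by linarith
qed

text \<open>The value at x is bounded by the mass of f beyond x towards the end -\<sigma> infinity,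
  and these masses shrink to 0 by dominated convergence.\<close>

lemma res_vanish:
  assumes f: "integrable lborel f" shows "vanish \<sigma> (res \<sigma> k f)"
  unfolding vanish_def
proof (intro allI impI)
  fix e :: real assume e: "e > 0"
  have [measurable]: "f \<in> borel_measurable borel" using f by auto
  have "(\<lambda>n::nat. LINT y|lborel. indicator {y. \<sigma> * y < - real n} y * cmod (f y)) \<longlonglongrightarrow> (LINT y::real|lborel. 0)"
  proof (rule integral_dominated_convergence[where w = "\<lambda>y. cmod (f y)"])
    show "integrable lborel (\<lambda>y. cmod (f y))" using f by simp
    show "AE y in lborel. norm (indicator {y. \<sigma> * y < - real n} y * cmod (f y)) \<le> cmod (f y)" for n
      by (rule AE_I2) (auto simp: indicator_def)
    show "AE y in lborel. (\<lambda>n. indicator {y. \<sigma> * y < - real n} y * cmod (f y)) \<longlonglongrightarrow> 0"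
    proof (rule AE_I2, rule tendsto_eventually)
      fix y :: real
      obtain N :: nat where N: "- (\<sigma> * y) \<le> real N" using real_arch_simple by blast
      show "\<forall>\<^sub>F n in sequentially. indicator {y. \<sigma> * y < - real n} y * cmod (f y) = 0"
        using eventually_ge_at_top[of N]
      proof eventually_elim
        case (elim n)
        then have "- (\<sigma> * y) \<le> real n" using N by (meson of_nat_le_iff order_trans)
        then show ?case by (simp add: indicator_def)
      qed
    qed
  qed measurable
  then have "(\<lambda>n::nat. LINT y|lborel. indicator {y. \<sigma> * y < - real n} y * cmod (f y)) \<longlonglongrightarrow> 0" by simp
  then have "\<forall>\<^sub>F n in sequentially. (LINT y|lborel. indicator {y. \<sigma> * y < - real n} y * cmod (f y)) < e"
    using e by (rule order_tendstoD(2))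
  then obtain n :: nat where n: "(LINT y|lborel. indicator {y. \<sigma> * y < - real n} y * cmod (f y)) < e"
    unfolding eventually_sequentially by blast
  have "cmod (res \<sigma> k f x) < e" if x: "\<sigma> * x < - real n" for x
  proof -
    have "(LINT y|lborel. indicator {y. 0 < \<sigma> * (x - y)} y * cmod (f y)) \<le> (LINT y|lborel. indicator {y. \<sigma> * y < - real n} y * cmod (f y))"
    proof (rule integral_mono')
      show "integrable lborel (\<lambda>y. indicator {y. \<sigma> * y < - real n} y * cmod (f y))"
        by (rule integrable_indicator_norm[OF f]) measurable
      show "indicator {y. 0 < \<sigma> * (x - y)} y * cmod (f y) \<le> indicator {y. \<sigma> * y < - real n} y * cmod (f y)" for y
        using x by (auto simp: indicator_def right_diff_distrib)
    qed simp
    with res_tail[OF f, of x] n show ?thesis by linarith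
  qed
  then show "\<exists>N. \<forall>x. \<sigma> * x < N \<longrightarrow> cmod (res \<sigma> k f x) < e" by blast
qed

lemma res_loc_integrable:
  assumes f: "integrable lborel f" shows "loc_integrable (res \<sigma> k f)"
  unfolding loc_integrable_def
proof (intro conjI allI)
  have [measurable]: "f \<in> borel_measurable borel" using f by auto
  show [measurable]: "res \<sigma> k f \<in> borel_measurable borel" by (rule res_measurable) measurable
  fix R :: real
  show "integrable lborel (\<lambda>x. indicator {-R..R} x * res \<sigma> k f x)"
  proof (rule Bochner_Integration.integrable_bound)
    show "integrable lborel (\<lambda>x. (LINT y|lborel. cmod (f y)) * indicator {-R..R} x)"
      by (intro integrable_mult_right integrable_real_indicator) (auto simp: emeasure_lborel_Icc_eq)
    show "AE x in lborel. norm (indicator {-R..R} x * res \<sigma> k f x) \<le> norm ((LINT y|lborel. cmod (f y)) * indicator {-R..R} x)"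
      using res_bound[OF f] by (intro AE_I2) (auto simp: indicator_def)
  qed measurable
qed

lemma res_pair:
  assumes f: "integrable lborel f" and \<psi>: "integrable lborel \<psi>"
  shows "(LINT x|lborel. res \<sigma> k f x * \<psi> x) = \<i> * of_real \<sigma> * (LINT y|lborel. f y * (LINT x|lborel. res_kernel \<sigma> k x y * \<psi> x))"
proof -
  have [measurable]: "f \<in> borel_measurable borel" "\<psi> \<in> borel_measurable borel" using f \<psi> by auto
  let ?h = "\<lambda>x y. res_kernel \<sigma> k x y * f y * \<psi> x"
  have int: "integrable (lborel \<Otimes>\<^sub>M lborel) (\<lambda>(x, y). ?h x y)"
  proof (rule Bochner_Integration.integrable_bound)
    show "integrable (lborel \<Otimes>\<^sub>M lborel) (\<lambda>(x, y). \<psi> x * f y)"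
    proof (rule lborel_pair.Fubini_integrable)
      have "integrable lborel (\<lambda>x. cmod (\<psi> x) * (LINT y|lborel. cmod (f y)))"
        by (intro integrable_mult_left integrable_norm \<psi>)
      then show "integrable lborel (\<lambda>x. LINT y|lborel. norm (case (x, y) of (x, y) \<Rightarrow> \<psi> x * f y))"
        by (simp add: norm_mult)
    qed (use f in simp_all)
    have "norm (?h x y) \<le> norm (\<psi> x * f y)" for x y
    proof -
      have "cmod (res_kernel \<sigma> k x y) * (cmod (f y) * cmod (\<psi> x)) \<le> 1 * (cmod (f y) * cmod (\<psi> x))"
        by (rule mult_right_mono[OF res_kernel_le_one]) simp
      then show ?thesis by (simp add: norm_mult mult_ac)
    qed
    then show "AE z in lborel \<Otimes>\<^sub>M lborel. norm (case z of (x, y) \<Rightarrow> ?h x y) \<le> norm (case z of (x, y) \<Rightarrow> \<psi> x * f y)"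
      by (auto intro!: AE_I2)
  qed measurable
  have "(LINT x|lborel. res \<sigma> k f x * \<psi> x) = (LINT x|lborel. \<i> * of_real \<sigma> * (LINT y|lborel. ?h x y))"
  proof (rule Bochner_Integration.integral_cong[OF refl])
    fix x
    have "(LINT y|lborel. ?h x y) = (LINT y|lborel. res_kernel \<sigma> k x y * f y) * \<psi> x"
      by (rule integral_mult_left_zero)
    then show "res \<sigma> k f x * \<psi> x = \<i> * of_real \<sigma> * (LINT y|lborel. ?h x y)" by (simp add: res_def)
  qed
  also have "\<dots> = \<i> * of_real \<sigma> * (LINT x|lborel. LINT y|lborel. ?h x y)"
    by (rule integral_mult_right_zero)
  also have "(LINT x|lborel. LINT y|lborel. ?h x y) = (LINT y|lborel. LINT x|lborel. ?h x y)"
    by (rule lborel_pair.Fubini_integral[OF int, symmetric])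
  also have "\<dots> = (LINT y|lborel. f y * (LINT x|lborel. res_kernel \<sigma> k x y * \<psi> x))"
  proof (rule Bochner_Integration.integral_cong[OF refl])
    fix y
    have "(LINT x|lborel. f y * (res_kernel \<sigma> k x y * \<psi> x)) = f y * (LINT x|lborel. res_kernel \<sigma> k x y * \<psi> x)"
      by (rule integral_mult_right_zero)
    then show "(LINT x|lborel. ?h x y) = f y * (LINT x|lborel. res_kernel \<sigma> k x y * \<psi> x)"
      by (simp only: mult_ac)
  qed
  finally show ?thesis .
qed

lemma halfline_FTC:
  assumes g: "\<And>x. (g has_vector_derivative g' x) (at x)" and cont: "continuous_on UNIV g'"
    and supp: "\<And>x. x \<notin> {-R..R} \<Longrightarrow> g x = 0" "\<And>x. x \<notin> {-R..R} \<Longrightarrow> g' x = (0::complex)"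
  shows "(LINT x|lborel. indicator {0<..} (\<sigma> * (x - y)) * g' x) = - of_real \<sigma> * g y"
proof -
  have [measurable]: "g' \<in> borel_measurable borel" by (rule borel_measurable_continuous_onI[OF cont])
  define M where "M = max R \<bar>y\<bar> + 1"
  have M: "R < M" "\<bar>y\<bar> < M" by (auto simp: M_def)
  have FTC: "(LINT x|lborel. indicator {a..b} x *\<^sub>R g' x) = g b - g a" if "a \<le> b" for a b
    by (rule has_bochner_integral_integral_eq[OF has_bochner_integral_FTC_Icc[OF that]])
       (auto intro: has_vector_derivative_at_within g continuous_on_subset[OF cont])
  from \<sigma> show ?thesis
  proof
    assume s: "\<sigma> = 1"
    have "(LINT x|lborel. indicator {0<..} (\<sigma> * (x - y)) * g' x) = (LINT x|lborel. indicator {y..M} x *\<^sub>R g' x)"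
    proof (rule integral_cong_AE)
      show "AE x in lborel. indicator {0<..} (\<sigma> * (x - y)) * g' x = indicator {y..M} x *\<^sub>R g' x"
        using AE_lborel_singleton[of y]
        by eventually_elim (use M supp(2) s in \<open>auto simp: indicator_def\<close>)
    qed measurable
    then show ?thesis using FTC[of y M] M supp(1)[of M] s by simp
  next
    assume s: "\<sigma> = -1"
    have "(LINT x|lborel. indicator {0<..} (\<sigma> * (x - y)) * g' x) = (LINT x|lborel. indicator {-M..y} x *\<^sub>R g' x)"
    proof (rule integral_cong_AE)
      show "AE x in lborel. indicator {0<..} (\<sigma> * (x - y)) * g' x = indicator {-M..y} x *\<^sub>R g' x"
        using AE_lborel_singleton[of y]
        by eventually_elim (use M supp(2) s in \<open>auto simp: indicator_def\<close>)
    qed measurable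
    then show ?thesis using FTC[of "-M" y] M supp(1)[of "-M"] s by simp
  qed
qed

text \<open>The derivative of exp(i k (x - y)) \<psi>(x) is integrated over the half-line where the
  kernel lives; the boundary term at x = y is the point evaluation of \<psi>.\<close>

lemma res_kernel_test_derivative:
  assumes \<psi>: "\<psi> \<in> test_functions"
  shows "(LINT x|lborel. res_kernel \<sigma> k x y * vector_derivative \<psi> (at x)) =
    - of_real \<sigma> * \<psi> y - \<i> * k * (LINT x|lborel. res_kernel \<sigma> k x y * \<psi> x)"
proof -
  let ?D = "\<lambda>x. vector_derivative \<psi> (at x)" and ?e = "\<lambda>x. exp (\<i> * k * of_real (x - y))"
  have sm: "smooth \<psi>" using \<psi> by (simp add: test_functions_iff)
  have dt: "?D \<in> test_functions" by (rule test_functions_derivative[OF \<psi>])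
  have [measurable]: "\<psi> \<in> borel_measurable borel" "?D \<in> borel_measurable borel"
    by (rule test_functions_measurable \<psi> dt)+
  obtain R1 where R1: "R1 > 0" "\<And>x. x \<notin> {-R1..R1} \<Longrightarrow> \<psi> x = 0" using test_functions_support[OF \<psi>] by blast
  obtain R2 where R2: "R2 > 0" "\<And>x. x \<notin> {-R2..R2} \<Longrightarrow> ?D x = 0" using test_functions_support[OF dt] by blast
  let ?g' = "\<lambda>x. ?e x * ?D x + \<i> * k * ?e x * \<psi> x"
  have "(LINT x|lborel. indicator {0<..} (\<sigma> * (x - y)) * ?g' x) = - of_real \<sigma> * (?e y * \<psi> y)"
  proof (rule halfline_FTC[where R = "max R1 R2" and g = "\<lambda>x. ?e x * \<psi> x" and g' = ?g'])
    fix x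
    have "((\<lambda>z. exp (\<i> * k * (z - of_real y))) has_field_derivative \<i> * k * exp (\<i> * k * (of_real x - of_real y))) (at (of_real x))"
      by (auto intro!: derivative_eq_intros)
    then have "(?e has_vector_derivative \<i> * k * ?e x) (at x)"
      using has_vector_derivative_real_field[of "\<lambda>z. exp (\<i> * k * (z - of_real y))" _ x UNIV] by simp
    from has_vector_derivative_mult[OF this smooth_has_vector_derivative[OF sm]]
    show "((\<lambda>x. ?e x * \<psi> x) has_vector_derivative ?g' x) (at x)" .
  next
    show "continuous_on UNIV ?g'"
      using dt sm by (intro continuous_intros smooth_continuous_on) (auto simp: test_functions_iff)
    fix x assume x: "x \<notin> {- max R1 R2..max R1 R2}"
    have "x \<notin> {-R1..R1}" "x \<notin> {-R2..R2}" using x by auto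
    then have z: "\<psi> x = 0" "?D x = 0" using R1(2)[of x] R2(2)[of x] by blast+
    then show "?e x * \<psi> x = 0" "?g' x = 0" by simp_all
  qed
  then have 1: "(LINT x|lborel. indicator {0<..} (\<sigma> * (x - y)) * ?g' x) = - of_real \<sigma> * \<psi> y" by simp
  have int: "integrable lborel (\<lambda>x. res_kernel \<sigma> k x y * g x)" if g: "g \<in> test_functions" for g
  proof (rule Bochner_Integration.integrable_bound[OF test_functions_integrable[OF g]])
    have [measurable]: "g \<in> borel_measurable borel" by (rule test_functions_measurable[OF g])
    show "(\<lambda>x. res_kernel \<sigma> k x y * g x) \<in> borel_measurable lborel" by measurable
    show "AE x in lborel. norm (res_kernel \<sigma> k x y * g x) \<le> norm (g x)"
      using res_kernel_le_one[of _ y] by (intro AE_I2) (simp add: norm_mult mult_left_le_one_le)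
  qed
  have "(LINT x|lborel. indicator {0<..} (\<sigma> * (x - y)) * ?g' x) =
     (LINT x|lborel. res_kernel \<sigma> k x y * ?D x + (\<i> * k) * (res_kernel \<sigma> k x y * \<psi> x))"
    by (rule Bochner_Integration.integral_cong) (simp_all add: res_kernel_def algebra_simps)
  also have "\<dots> = (LINT x|lborel. res_kernel \<sigma> k x y * ?D x) + (LINT x|lborel. (\<i> * k) * (res_kernel \<sigma> k x y * \<psi> x))"
    by (intro Bochner_Integration.integral_add integrable_mult_right int \<psi> dt)
  also have "(LINT x|lborel. (\<i> * k) * (res_kernel \<sigma> k x y * \<psi> x)) = (\<i> * k) * (LINT x|lborel. res_kernel \<sigma> k x y * \<psi> x)"
    by (rule integral_mult_right_zero)
  finally show ?thesis unfolding 1 by (simp add: algebra_simps)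
qed

text \<open>Fubini's theorem moves the kernel onto the test function. The boundary term of the
  half-line integration by parts reproduces f, the remaining term reproduces k times the
  resolvent.\<close>

lemma res_weak_ode:
  assumes f: "integrable lborel f"
  shows "weak_ode k (res \<sigma> k f) f"
  unfolding weak_ode_def
proof
  fix \<psi> assume \<psi>: "\<psi> \<in> test_functions"
  let ?D = "\<lambda>x. vector_derivative \<psi> (at x)"
  define H where "H y = (LINT x|lborel. res_kernel \<sigma> k x y * \<psi> x)" for y
  have dt: "?D \<in> test_functions" by (rule test_functions_derivative[OF \<psi>])
  note i\<psi> = test_functions_integrable[OF \<psi>]
  have [measurable]: "f \<in> borel_measurable borel" "\<psi> \<in> borel_measurable borel" using f i\<psi> by auto
  have [measurable]: "H \<in> borel_measurable borel" unfolding H_def[abs_def] by measurable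
  have H: "cmod (H y) \<le> (LINT x|lborel. cmod (\<psi> x))" for y
  proof -
    have "cmod (H y) \<le> (LINT x|lborel. cmod (res_kernel \<sigma> k x y * \<psi> x))"
      unfolding H_def by (rule integral_norm_bound)
    also have "\<dots> \<le> (LINT x|lborel. cmod (\<psi> x))"
      by (rule integral_mono') (use i\<psi> res_kernel_le_one[of _ y] in \<open>auto simp: norm_mult mult_left_le_one_le\<close>)
    finally show ?thesis .
  qed
  have if\<psi>: "integrable lborel (\<lambda>y. f y * \<psi> y)" by (rule loc_integrable_test[OF loc_integrable_L1[OF f] \<psi>])
  have ifH: "integrable lborel (\<lambda>y. f y * H y)"
  proof (rule Bochner_Integration.integrable_bound)
    show "integrable lborel (\<lambda>y. f y * of_real (LINT x|lborel. cmod (\<psi> x)))" using f by simp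
    show "AE y in lborel. norm (f y * H y) \<le> norm (f y * of_real (LINT x|lborel. cmod (\<psi> x)))"
      using H by (intro AE_I2) (auto simp: norm_mult intro!: mult_left_mono order_trans[OF H abs_ge_self])
  qed measurable
  have 2: "of_real \<sigma> * of_real \<sigma> = (1::complex)" using \<sigma> by auto
  have P: "(LINT x|lborel. res \<sigma> k f x * \<psi> x) = \<i> * of_real \<sigma> * (LINT y|lborel. f y * H y)"
    unfolding H_def by (rule res_pair[OF f i\<psi>])
  have "(LINT x|lborel. res \<sigma> k f x * ?D x) = \<i> * of_real \<sigma> * (LINT y|lborel. f y * (- of_real \<sigma> * \<psi> y - \<i> * k * H y))"
    unfolding res_pair[OF f test_functions_integrable[OF dt]] res_kernel_test_derivative[OF \<psi>] H_def ..
  also have "(\<lambda>y. f y * (- of_real \<sigma> * \<psi> y - \<i> * k * H y)) = (\<lambda>y. (- of_real \<sigma>) * (f y * \<psi> y) - (\<i> * k) * (f y * H y))"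
    by (simp add: algebra_simps)
  also have "(LINT y|lborel. (- of_real \<sigma>) * (f y * \<psi> y) - (\<i> * k) * (f y * H y)) =
     (- of_real \<sigma>) * (LINT y|lborel. f y * \<psi> y) - (\<i> * k) * (LINT y|lborel. f y * H y)"
    unfolding Bochner_Integration.integral_diff[OF integrable_mult_right[OF if\<psi>] integrable_mult_right[OF ifH]]
      integral_mult_right_zero ..
  finally have 3: "(LINT x|lborel. res \<sigma> k f x * ?D x) = \<i> * of_real \<sigma> *
      ((- of_real \<sigma>) * (LINT y|lborel. f y * \<psi> y) - (\<i> * k) * (LINT y|lborel. f y * H y))" .
  \<comment> \<open>Pure algebra, isolated so that the squares of i and of \<sigma> can be evaluated
    afterwards.\<close>
  have "\<i> * (\<i> * s * ((- s) * Y - (\<i> * k) * Z)) = - (\<i> * \<i>) * ((s * s) * Y) - (\<i> * \<i>) * (k * (\<i> * s * Z))"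
    for s Y Z :: complex
    by algebra
  from this[of "of_real \<sigma>" "LINT y|lborel. f y * \<psi> y" "LINT y|lborel. f y * H y"]
  have "\<i> * (LINT x|lborel. res \<sigma> k f x * ?D x) = k * (LINT x|lborel. res \<sigma> k f x * \<psi> x) + (LINT y|lborel. f y * \<psi> y)"
    unfolding P[symmetric] 2 3[symmetric] by simp
  also have "\<dots> = (LINT x|lborel. k * (res \<sigma> k f x * \<psi> x)) + (LINT y|lborel. f y * \<psi> y)" by simp
  also have "\<dots> = (LINT x|lborel. k * (res \<sigma> k f x * \<psi> x) + f x * \<psi> x)"
    by (rule Bochner_Integration.integral_add[symmetric, OF integrable_mult_right[OF loc_integrable_test[OF res_loc_integrable[OF f] \<psi>]] if\<psi>])
  finally show "\<i> * (LINT x|lborel. res \<sigma> k f x * ?D x) = (LINT x|lborel. (k * res \<sigma> k f x + f x) * \<psi> x)"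
    by (simp add: distrib_right mult.assoc)
qed

end

subsection \<open>The Fredholm operator of the Lax equation\<close>

lemma norm_l2_FT: "(norm (l2_FT a))\<^sup>2 = 2 * pi * (norm a)\<^sup>2"
proof -
  have "complex_of_real ((norm (l2_FT a))\<^sup>2) = of_real (2 * pi * (norm a)\<^sup>2)"
    using Plancherel[of a a] unfolding l2_pair_cnj_self by simp
  then show ?thesis by (simp only: of_real_eq_iff)
qed

lemma norm_l2_szego: "norm (l2_szego a) \<le> norm a"
proof -
  have "norm (l2_FT (l2_szego a)) \<le> 1 * norm (l2_FT a)"
    unfolding l2_FT_szego by (rule norm_l2_mul_le) (auto simp: indicator_def)
  then have "(norm (l2_FT (l2_szego a)))\<^sup>2 \<le> (norm (l2_FT a))\<^sup>2" by (intro power_mono) auto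
  then have "(norm (l2_szego a))\<^sup>2 \<le> (norm a)\<^sup>2" unfolding norm_l2_FT by simp
  then show ?thesis by (rule power2_le_imp_le) simp
qed

lemma l2_mul_const_split:
  "l2_mul (\<lambda>_. c) a = Re c *\<^sub>R a + Im c *\<^sub>R l2_mul (\<lambda>_. \<i>) a"
proof (rule l2_eqI)
  show "AE x in lborel. l2_fun (l2_mul (\<lambda>_. c) a) x = l2_fun (Re c *\<^sub>R a + Im c *\<^sub>R l2_mul (\<lambda>_. \<i>) a) x"
    using l2_fun_mul[OF bdd_mult_const, of c a] l2_fun_mul[OF bdd_mult_const, of \<i> a]
      l2_fun_scaleR[of "Re c" a] l2_fun_scaleR[of "Im c" "l2_mul (\<lambda>_. \<i>) a"]
      l2_fun_plus[of "Re c *\<^sub>R a" "Im c *\<^sub>R l2_mul (\<lambda>_. \<i>) a"]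
  proof eventually_elim
    case (elim x)
    have "c = of_real (Re c) + of_real (Im c) * \<i>" by (simp add: complex_eq_iff)
    then have "c * l2_fun a x = (of_real (Re c) + of_real (Im c) * \<i>) * l2_fun a x" by simp
    then show ?case unfolding elim by (simp add: algebra_simps)
  qed
qed

locale lax_resolvent = halfline_resolvent +
  fixes u :: "real \<Rightarrow> complex" and s :: real
  assumes s: "s > 1/2" and u: "u \<in> hardy_sobolev 1" and us: "u \<in> L2_weighted s"
begin

lemma u_L2: "u \<in> L2" and u_hardy: "hardy (l2_cls u)"
  using u unfolding hardy_sobolev_iff by auto

lemma u_measurable [measurable]: "u \<in> borel_measurable borel"
  using u_L2 by (rule L2_measurable)

lemma u_bdd: "bdd_mult u"
  unfolding bdd_mult_def using hardy_sobolev_bounded[OF u] by simp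

lemma u_weight: "integrable lborel (\<lambda>x. (cmod (u x))\<^sup>2 * (1 + x\<^sup>2) powr s)"
  using us by (simp add: L2_weighted_def)

text \<open>By the arithmetic-geometric mean inequality |u| is dominated by |u|^2 w + 1/w with w =
  (1 + x^2)^s; the second term is integrable because s > 1/2.\<close>

lemma u_integrable: "integrable lborel u"
proof (rule Bochner_Integration.integrable_bound)
  show "integrable lborel (\<lambda>x. (cmod (u x))\<^sup>2 * (1 + x\<^sup>2) powr s + (1 + x\<^sup>2) powr (- s))"
    by (intro Bochner_Integration.integrable_add u_weight integrable_bracket s)
  have "cmod (u x) \<le> (cmod (u x))\<^sup>2 * (1 + x\<^sup>2) powr s + (1 + x\<^sup>2) powr (- s)" for x
  proof -
    define w where "w = (1 + x\<^sup>2) powr s"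
    have "1 + x\<^sup>2 > 0" by (simp add: add_pos_nonneg)
    then have w: "w > 0" "(1 + x\<^sup>2) powr (- s) = 1 / w" by (simp_all add: w_def powr_minus_divide)
    have "0 \<le> (w * cmod (u x) - 1)\<^sup>2" by simp
    also have "(w * cmod (u x) - 1)\<^sup>2 = w * ((cmod (u x))\<^sup>2 * w + 1 / w - 2 * cmod (u x))"
      using w(1) by (simp add: power2_eq_square field_simps)
    finally have "0 \<le> (cmod (u x))\<^sup>2 * w + 1 / w - 2 * cmod (u x)"
      using w(1) by (simp add: zero_le_mult_iff)
    then show ?thesis unfolding w(2) w_def[symmetric] using norm_ge_zero[of "u x"] by linarith
  qed
  then show "AE x in lborel. norm (u x) \<le> norm ((cmod (u x))\<^sup>2 * (1 + x\<^sup>2) powr s + (1 + x\<^sup>2) powr (- s))"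
    by (auto intro!: AE_I2 order_trans[OF _ abs_ge_self])
qed measurable

definition mulu :: "l2 \<Rightarrow> real \<Rightarrow> complex" where "mulu h y = u y * l2_fun h y"

lemma mulu_integrable: "integrable lborel (mulu h)"
  unfolding mulu_def[abs_def] by (rule L2_mult_integrable[OF u_L2 l2_fun_L2])

lemma mulu_L2: "mulu h \<in> L2"
  unfolding mulu_def[abs_def] by (rule L2_bdd_mult[OF u_bdd l2_fun_L2])

lemma mulu_measurable [measurable]: "mulu h \<in> borel_measurable borel"
  using mulu_L2 by (rule L2_measurable)

text \<open>A bounded function times an L^2 function: the resolvent itself is not claimed to be in
  L^2, and only after multiplication by cnj u does the construction return to the Hilbert
  space.\<close>

lemma res_mult_cnj_L2:
  assumes "integrable lborel f" shows "(\<lambda>x. res \<sigma> k f x * cnj (u x)) \<in> L2"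
proof (rule L2_bounded_mult[OF L2_cnj[OF u_L2]])
  show "res \<sigma> k f \<in> borel_measurable borel" by (rule res_measurable) (use assms in auto)
  show "AE x in lborel. cmod (res \<sigma> k f x) \<le> (LINT y|lborel. cmod (f y))"
    by (intro AE_I2 res_bound assms)
qed

definition KK :: "l2 \<Rightarrow> l2" where "KK h = l2_cls (\<lambda>x. res \<sigma> k (mulu h) x * cnj (u x))"
definition AA :: "l2 \<Rightarrow> l2" where "AA h = l2_szego (KK h)"

lemma res_mulu_add: "res \<sigma> k (mulu (a + b)) x = res \<sigma> k (mulu a) x + res \<sigma> k (mulu b) x"
proof -
  have "res \<sigma> k (mulu (a + b)) = res \<sigma> k (\<lambda>y. mulu a y + mulu b y)"
  proof (rule res_cong_AE)
    show "AE y in lborel. mulu (a + b) y = mulu a y + mulu b y"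
      using l2_fun_plus[of a b] by eventually_elim (simp add: mulu_def distrib_left)
  qed measurable
  then show ?thesis by (simp add: res_add mulu_integrable)
qed

lemma res_mulu_scaleR: "res \<sigma> k (mulu (r *\<^sub>R a)) x = of_real r * res \<sigma> k (mulu a) x"
proof -
  have "res \<sigma> k (mulu (r *\<^sub>R a)) = res \<sigma> k (\<lambda>y. of_real r * mulu a y)"
  proof (rule res_cong_AE)
    show "AE y in lborel. mulu (r *\<^sub>R a) y = of_real r * mulu a y"
      using l2_fun_scaleR[of r a] by eventually_elim (simp add: mulu_def)
  qed measurable
  then show ?thesis by (simp add: res_cmult)
qed

lemma linear_KK: "linear KK"
proof (rule linearI)
  fix a b :: l2 and r :: real
  show "KK (a + b) = KK a + KK b"
    unfolding KK_def res_mulu_add distrib_right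
    by (intro l2_cls_add res_mult_cnj_L2 mulu_integrable)
  show "KK (r *\<^sub>R a) = r *\<^sub>R KK a"
    unfolding KK_def res_mulu_scaleR mult.assoc
    by (simp add: l2_mul_cls[symmetric] res_mult_cnj_L2 mulu_integrable l2_mul_const_scaleR)
qed

lemma linear_AA: "linear AA"
  unfolding AA_def using linear_compose[OF linear_KK bounded_linear.linear[OF bounded_linear_l2_szego]]
  by (simp add: comp_def)

section \<open>Finite rank approximation of the resolvent\<close>

lemma sigma_sq: "\<sigma> * \<sigma> = 1" using \<sigma> by auto

text \<open>For y before p the kernel factorises, K(x, y) = exp(i k (x - p)) K(p, y), so these
  contributions cancel and only the mass of f between p and x remains.\<close>

lemma res_split:
  assumes f: "integrable lborel f" and px: "\<sigma> * p \<le> \<sigma> * x"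
  shows "cmod (res \<sigma> k f x - exp (\<i> * k * of_real (x - p)) * res \<sigma> k f p)
    \<le> (LINT y|lborel. indicator {y. \<sigma> * p \<le> \<sigma> * y \<and> \<sigma> * y < \<sigma> * x} y * cmod (f y))"
proof -
  let ?e = "exp (\<i> * k * of_real (x - p))"
  let ?m = "\<lambda>y. res_kernel \<sigma> k x y - ?e * res_kernel \<sigma> k p y"
  have "(LINT y|lborel. ?m y * f y) = (LINT y|lborel. res_kernel \<sigma> k x y * f y - ?e * (res_kernel \<sigma> k p y * f y))"
    by (rule Bochner_Integration.integral_cong) (simp_all add: algebra_simps)
  also have "\<dots> = (LINT y|lborel. res_kernel \<sigma> k x y * f y) - ?e * (LINT y|lborel. res_kernel \<sigma> k p y * f y)"
    unfolding Bochner_Integration.integral_diff[OF res_integrable[OF f] integrable_mult_right[OF res_integrable[OF f]]]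
      integral_mult_right_zero ..
  finally have 1: "(LINT y|lborel. ?m y * f y) = (LINT y|lborel. res_kernel \<sigma> k x y * f y) - ?e * (LINT y|lborel. res_kernel \<sigma> k p y * f y)" .
  have "res \<sigma> k f x - ?e * res \<sigma> k f p = \<i> * of_real \<sigma> * (LINT y|lborel. ?m y * f y)"
    unfolding 1 res_def by (simp only: right_diff_distrib mult_ac)
  then have "cmod (res \<sigma> k f x - ?e * res \<sigma> k f p) = cmod (LINT y|lborel. ?m y * f y)"
    using \<sigma> by (auto simp: norm_mult)
  also have "\<dots> \<le> (LINT y|lborel. indicator {y. \<sigma> * p \<le> \<sigma> * y \<and> \<sigma> * y < \<sigma> * x} y * cmod (f y))"
  proof (rule kernel_integral_le[OF f])
    fix y
    show "cmod (?m y) \<le> indicator {y. \<sigma> * p \<le> \<sigma> * y \<and> \<sigma> * y < \<sigma> * x} y"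
    proof (cases "\<sigma> * y < \<sigma> * p")
      case True
      have "?e * exp (\<i> * k * of_real (p - y)) = exp (\<i> * k * of_real (x - y))"
        by (simp add: mult_exp_exp algebra_simps)
      moreover have "0 < \<sigma> * (x - y)" "0 < \<sigma> * (p - y)"
        using True px by (simp_all add: right_diff_distrib)
      ultimately have "?m y = 0" by (simp add: res_kernel_def)
      then show ?thesis by simp
    next
      case False
      then have "res_kernel \<sigma> k p y = 0" by (simp add: res_kernel_def right_diff_distrib)
      then have "cmod (?m y) \<le> indicator {0<..} (\<sigma> * (x - y))" using res_kernel_le[of x y] by simp
      then show ?thesis using False by (simp add: indicator_def right_diff_distrib)
    qed
  qed measurable
  finally show ?thesis .
qed

text \<open>A smallness condition on \<open>u\<close> alone controls the mass of \<open>u h\<close>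
  on E uniformly for h in a ball, as an approximation in operator norm demands.\<close>

lemma mulu_Cauchy_Schwarz:
  assumes [measurable]: "E \<in> sets borel" and e: "0 \<le> e"
    and E: "(LINT y|lborel. indicator E y * (cmod (u y))\<^sup>2) \<le> e\<^sup>2"
  shows "(LINT y|lborel. indicator E y * cmod (mulu h y)) \<le> e * norm h"
proof -
  let ?a = "\<lambda>y. complex_of_real (indicator E y * cmod (u y))" and ?b = "\<lambda>y. complex_of_real (cmod (l2_fun h y))"
  have a: "?a \<in> L2"
    by (rule L2_dominated[OF _ L2_integrable_square[OF u_L2]]) (auto simp: indicator_def)
  have b: "?b \<in> L2"
    by (rule L2_dominated[OF _ L2_integrable_square[OF l2_fun_L2[of h]]]) auto
  have nb: "norm (l2_cls ?b) = norm h"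
  proof -
    have "(norm (l2_cls ?b))\<^sup>2 = (norm h)\<^sup>2" unfolding norm_l2_cls[OF b] by (simp add: norm_l2_square)
    then show ?thesis by simp
  qed
  have "(norm (l2_cls ?a))\<^sup>2 = (LINT y|lborel. indicator E y * (cmod (u y))\<^sup>2)"
    unfolding norm_l2_cls[OF a] by (rule Bochner_Integration.integral_cong) (auto simp: indicator_def)
  then have "(norm (l2_cls ?a))\<^sup>2 \<le> e\<^sup>2" using E by simp
  then have na: "norm (l2_cls ?a) \<le> e" using e by (rule power2_le_imp_le)
  have "l2_pair (l2_cls ?a) (l2_cls ?b) = (LINT y|lborel. complex_of_real (indicator E y * cmod (mulu h y)))"
    unfolding l2_pair_cls[OF a b] by (simp add: mulu_def norm_mult mult.assoc)
  then have "l2_pair (l2_cls ?a) (l2_cls ?b) = of_real (LINT y|lborel. indicator E y * cmod (mulu h y))"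
    by (simp only: integral_complex_of_real)
  then have "(LINT y|lborel. indicator E y * cmod (mulu h y)) \<le> cmod (l2_pair (l2_cls ?a) (l2_cls ?b))" by simp
  also have "\<dots> \<le> norm (l2_cls ?a) * norm (l2_cls ?b)" by (rule norm_l2_pair)
  also have "\<dots> \<le> e * norm h" unfolding nb by (rule mult_right_mono[OF na]) simp
  finally show ?thesis .
qed

text \<open>The two unbounded ends are small because u is square integrable, the bounded cells
  because u is bounded and the cells are short.\<close>

lemma partition:
  assumes e: "0 < e"
  obtains t :: "nat \<Rightarrow> real" and N :: nat where "strict_mono t"
    "(LINT y|lborel. indicator {y. \<sigma> * y < t 0} y * (cmod (u y))\<^sup>2) \<le> e\<^sup>2"
    "(LINT y|lborel. indicator {y. t N \<le> \<sigma> * y} y * (cmod (u y))\<^sup>2) \<le> e\<^sup>2"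
    "\<And>j. j < N \<Longrightarrow> (LINT y|lborel. indicator {y. t j \<le> \<sigma> * y \<and> \<sigma> * y \<le> t (Suc j)} y * (cmod (u y))\<^sup>2) \<le> e\<^sup>2"
proof -
  note u2 = L2_integrable_square[OF u_L2]
  obtain C where C: "AE x in lborel. cmod (u x) \<le> C" using hardy_sobolev_bounded[OF u] by blast
  have "\<forall>\<^sub>F R in at_top. dist (l2_trunc R (l2_cls u)) (l2_cls u) < e"
    by (rule tendstoD[OF l2_trunc_tendsto e])
  then obtain M0 where M0: "\<And>R. R \<ge> M0 \<Longrightarrow> dist (l2_trunc R (l2_cls u)) (l2_cls u) < e"
    unfolding eventually_at_top_linorder by blast
  define M where "M = max M0 0"
  have tail: "(LINT y|lborel. indicator E y * (cmod (u y))\<^sup>2) \<le> e\<^sup>2"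
    if [measurable]: "E \<in> sets borel" and E: "\<And>y. y \<in> E \<Longrightarrow> M < \<bar>y\<bar>" for E
  proof -
    have d: "l2_trunc M (l2_cls u) - l2_cls u = l2_cls (\<lambda>y. indicator {-M..M} y * u y - u y)"
      unfolding l2_trunc_def l2_mul_cls[OF bdd_mult_indicator[of "{-M..M}"] u_L2, OF atLeastAtMost_borel]
      by (rule l2_cls_diff[OF L2_trunc[OF u_L2] u_L2, symmetric])
    have "norm (l2_trunc M (l2_cls u) - l2_cls u) \<le> e"
      using M0[of M] unfolding dist_norm M_def by (intro less_imp_le) simp
    then have "(norm (l2_trunc M (l2_cls u) - l2_cls u))\<^sup>2 \<le> e\<^sup>2"
      by (intro power_mono) auto
    then have 1: "(LINT y|lborel. (cmod (indicator {-M..M} y * u y - u y))\<^sup>2) \<le> e\<^sup>2"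
      unfolding d norm_l2_cls[OF L2_diff[OF L2_trunc[OF u_L2] u_L2]] .
    have "(LINT y|lborel. indicator E y * (cmod (u y))\<^sup>2) \<le> (LINT y|lborel. (cmod (indicator {-M..M} y * u y - u y))\<^sup>2)"
    proof (rule integral_mono')
      show "integrable lborel (\<lambda>y. (cmod (indicator {-M..M} y * u y - u y))\<^sup>2)"
        by (rule L2_integrable_square[OF L2_diff[OF L2_trunc[OF u_L2] u_L2]])
      show "indicator E y * (cmod (u y))\<^sup>2 \<le> (cmod (indicator {-M..M} y * u y - u y))\<^sup>2" for y
        using E[of y] by (cases "y \<in> E") (auto simp: indicator_def)
    qed simp
    with 1 show ?thesis by linarith
  qed
  \<comment> \<open>Larger than M, because the last tail contains its end point while
    \<open>tail\<close> requires M < |y| strictly; it also makes L positive when M = 0.\<close>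
  define L where "L = M + 1"
  have L: "L > 0" by (simp add: L_def M_def)
  \<comment> \<open>The mass of |u|^2 on a cell is at most C^2 \<delta>, and 2 L is divided into N +
    1 cells; the additional one keeps the division legitimate when N = 0.\<close>
  obtain N :: nat where N: "2 * L * C\<^sup>2 / e\<^sup>2 \<le> real N" using real_arch_simple by blast
  define \<delta> where "\<delta> = 2 * L / real (Suc N)"
  define t where "t j = - L + real j * \<delta>" for j :: nat
  have \<delta>: "\<delta> > 0" using L by (simp add: \<delta>_def)
  have \<delta>C: "C\<^sup>2 * \<delta> \<le> e\<^sup>2"
  proof -
    have "2 * L * C\<^sup>2 \<le> real N * e\<^sup>2" using N e by (simp add: divide_le_eq)
    also have "\<dots> \<le> real (Suc N) * e\<^sup>2" by (intro mult_right_mono) auto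
    finally show ?thesis by (simp add: \<delta>_def divide_le_eq mult_ac)
  qed
  have abs: "\<bar>\<sigma> * y\<bar> = \<bar>y\<bar>" for y using \<sigma> by auto
  have tN: "t (Suc N) = L" by (simp add: t_def \<delta>_def)
  show ?thesis
  proof (rule that[of t "Suc N"])
    show "strict_mono t" by (rule strict_monoI) (simp add: t_def \<delta>)
    show "(LINT y|lborel. indicator {y. \<sigma> * y < t 0} y * (cmod (u y))\<^sup>2) \<le> e\<^sup>2"
    proof (rule tail)
      fix y assume "y \<in> {y. \<sigma> * y < t 0}"
      then show "M < \<bar>y\<bar>" unfolding abs[of y, symmetric] by (simp add: t_def L_def)
    qed measurable
    show "(LINT y|lborel. indicator {y. t (Suc N) \<le> \<sigma> * y} y * (cmod (u y))\<^sup>2) \<le> e\<^sup>2"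
    proof (rule tail)
      fix y assume "y \<in> {y. t (Suc N) \<le> \<sigma> * y}"
      then show "M < \<bar>y\<bar>" unfolding abs[of y, symmetric] tN by (simp add: L_def)
    qed measurable
    fix j
    let ?E = "{y. t j \<le> \<sigma> * y \<and> \<sigma> * y \<le> t (Suc j)}"
    have E: "?E = (if \<sigma> = 1 then {t j..t (Suc j)} else {- t (Suc j)..- t j})" using \<sigma> by auto
    have em: "emeasure lborel ?E = ennreal \<delta>"
      unfolding E using \<delta> by (auto simp: t_def algebra_simps)
    have "(LINT y|lborel. indicator ?E y * (cmod (u y))\<^sup>2) \<le> (LINT y|lborel. C\<^sup>2 * indicator ?E y)"
    proof (rule integral_mono_AE)
      show "integrable lborel (\<lambda>y. indicator ?E y * (cmod (u y))\<^sup>2)"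
        by (rule Bochner_Integration.integrable_bound[OF u2]) (auto simp: indicator_def)
      show "integrable lborel (\<lambda>y. C\<^sup>2 * indicator ?E y)"
        by (intro integrable_mult_right integrable_real_indicator) (auto simp: em)
      show "AE y in lborel. indicator ?E y * (cmod (u y))\<^sup>2 \<le> C\<^sup>2 * indicator ?E y"
        using C by eventually_elim (auto simp: indicator_def intro!: power_mono)
    qed
    also have "\<dots> = C\<^sup>2 * \<delta>" using \<delta> by (simp add: measure_def em)
    finally show "(LINT y|lborel. indicator ?E y * (cmod (u y))\<^sup>2) \<le> e\<^sup>2" using \<delta>C by linarith
  qed
qed

text \<open>On each cell of a fine partition the resolvent is close to its value propagated from the
  beginning of the cell, a function of finite rank.\<close>

lemma res_finite_rank:
  assumes e: "0 < e"
  shows "\<exists>(N :: nat) (I :: nat \<Rightarrow> real set) (p :: nat \<Rightarrow> real).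
    (\<forall>j. I j \<in> sets borel) \<and> (\<forall>j. \<forall>x\<in>I j. 0 \<le> \<sigma> * (x - p j)) \<and>
    (\<forall>h x. cmod (res \<sigma> k (mulu h) x - (\<Sum>j\<le>N. indicator (I j) x * exp (\<i> * k * of_real (x - p j)) * res \<sigma> k (mulu h) (p j)))
       \<le> e * norm h)"
proof -
  obtain t N where mono: "strict_mono t"
    and E0: "(LINT y|lborel. indicator {y. \<sigma> * y < t 0} y * (cmod (u y))\<^sup>2) \<le> e\<^sup>2"
    and EN: "(LINT y|lborel. indicator {y. t N \<le> \<sigma> * y} y * (cmod (u y))\<^sup>2) \<le> e\<^sup>2"
    and Ej: "\<And>j. j < N \<Longrightarrow> (LINT y|lborel. indicator {y. t j \<le> \<sigma> * y \<and> \<sigma> * y \<le> t (Suc j)} y * (cmod (u y))\<^sup>2) \<le> e\<^sup>2"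
    by (rule partition[OF e]) blast
  \<comment> \<open>Half-open cells in the variable \<sigma> x, so that those with j \<le> N are
    disjoint. The cell j = N is the whole half-line beyond the grid; there is no cell before
    \<open>t 0\<close>.\<close>
  define I where "I j = {x. t j < \<sigma> * x \<and> (j < N \<longrightarrow> \<sigma> * x \<le> t (Suc j))}" for j
  define p where "p j = \<sigma> * t j" for j
  have sp: "\<sigma> * p j = t j" for j unfolding p_def using sigma_sq by (simp flip: mult.assoc)
  have [measurable]: "I j \<in> sets borel" for j unfolding I_def by measurable
  have small: "(LINT y|lborel. indicator E y * cmod (mulu h y)) \<le> e * norm h"
    if E: "E \<subseteq> E'" "E \<in> sets borel" "E' \<in> sets borel" and E': "(LINT y|lborel. indicator E' y * (cmod (u y))\<^sup>2) \<le> e\<^sup>2" for E E' h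
  proof -
    have "(LINT y|lborel. indicator E y * cmod (mulu h y)) \<le> (LINT y|lborel. indicator E' y * cmod (mulu h y))"
    proof (rule integral_mono')
      show "integrable lborel (\<lambda>y. indicator E' y * cmod (mulu h y))"
        by (rule integrable_indicator_norm[OF mulu_integrable E(3)])
      show "indicator E y * cmod (mulu h y) \<le> indicator E' y * cmod (mulu h y)" for y
        using E(1) by (auto simp: indicator_def)
    qed simp
    also have "\<dots> \<le> e * norm h" by (rule mulu_Cauchy_Schwarz[OF E(3) _ E']) (use e in simp)
    finally show ?thesis .
  qed
  show ?thesis
  proof (intro exI[of _ N] exI[of _ I] exI[of _ p] conjI allI ballI)
    show "I j \<in> sets borel" for j by measurable
    show "0 \<le> \<sigma> * (x - p j)" if "x \<in> I j" for j x
      using that by (simp add: I_def right_diff_distrib sp)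
    fix h x
    let ?f = "mulu h"
    let ?T = "\<lambda>j. indicator (I j) x * exp (\<i> * k * of_real (x - p j)) * res \<sigma> k ?f (p j)"
    show "cmod (res \<sigma> k ?f x - (\<Sum>j\<le>N. ?T j)) \<le> e * norm h"
    proof (cases "t 0 < \<sigma> * x")
      \<comment> \<open>Before the first grid point the approximation is 0, and the resolvent itself
        is bounded by the small mass of that tail.\<close>
      case False
      have "?T j = 0" for j
      proof -
        have "t 0 \<le> t j" using strict_mono_less_eq[OF mono, of 0 j] by simp
        then have "x \<notin> I j" using False by (simp add: I_def)
        then show ?thesis by simp
      qed
      then have "(\<Sum>j\<le>N. ?T j) = 0" by (intro sum.neutral ballI)
      then have "cmod (res \<sigma> k ?f x - (\<Sum>j\<le>N. ?T j)) = cmod (res \<sigma> k ?f x)" by (simp only: diff_0_right)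
      also have "\<dots> \<le> (LINT y|lborel. indicator {y. 0 < \<sigma> * (x - y)} y * cmod (?f y))"
        by (rule res_tail[OF mulu_integrable])
      also have "\<dots> \<le> e * norm h"
        by (rule small[OF _ _ _ E0]) (use False in \<open>auto simp: right_diff_distrib\<close>)
      finally show ?thesis .
    next
      case True
      \<comment> \<open>Its maximum is the index of the unique cell that contains x; capping at N
        sends everything beyond the grid to the last cell.\<close>
      define J where "J = {j. j \<le> N \<and> t j < \<sigma> * x}"
      have J: "finite J" "J \<noteq> {}" using True by (auto simp: J_def)
      define j where "j = Max J"
      have jJ: "j \<in> J" unfolding j_def by (rule Max_in[OF J])
      have xI: "x \<in> I j"
      proof -
        have "\<sigma> * x \<le> t (Suc j)" if "j < N"
        proof (rule ccontr)
          assume "\<not> \<sigma> * x \<le> t (Suc j)"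
          then have "Suc j \<in> J" using that by (simp add: J_def)
          then have "Suc j \<le> j" unfolding j_def by (rule Max_ge[OF J(1)])
          then show False by simp
        qed
        then show ?thesis using jJ by (simp add: I_def J_def)
      qed
      have disj: "x \<notin> I i" if "i \<le> N" "i \<noteq> j" for i
      proof
        assume xi: "x \<in> I i"
        have jN: "j \<le> N" using jJ by (simp add: J_def)
        from that(2) consider "i < j" | "j < i" by linarith
        then show False
        proof cases
          case 1
          then have "\<sigma> * x \<le> t (Suc i)" using xi jN by (simp add: I_def)
          moreover have "t (Suc i) \<le> t j" using 1 strict_mono_less_eq[OF mono, of "Suc i" j] by simp
          ultimately show False using xI by (simp add: I_def)
        next
          case 2
          then have "\<sigma> * x \<le> t (Suc j)" using xI that(1) by (simp add: I_def)
          moreover have "t (Suc j) \<le> t i" using 2 strict_mono_less_eq[OF mono, of "Suc j" i] by simp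
          ultimately show False using xi by (simp add: I_def)
        qed
      qed
      have "(\<Sum>i\<le>N. ?T i) = (\<Sum>i\<in>{j}. ?T i)"
        by (rule sum.mono_neutral_right) (use jJ disj in \<open>auto simp: J_def\<close>)
      then have "cmod (res \<sigma> k ?f x - (\<Sum>i\<le>N. ?T i)) = cmod (res \<sigma> k ?f x - exp (\<i> * k * of_real (x - p j)) * res \<sigma> k ?f (p j))"
        using xI by simp
      also have "\<dots> \<le> (LINT y|lborel. indicator {y. \<sigma> * p j \<le> \<sigma> * y \<and> \<sigma> * y < \<sigma> * x} y * cmod (?f y))"
        by (rule res_split[OF mulu_integrable]) (use xI in \<open>simp add: I_def sp\<close>)
      also have "\<dots> \<le> e * norm h"
      proof (cases "j < N")
        case jN: True
        show ?thesis
          by (rule small[OF _ _ _ Ej[OF jN]]) (use xI jN in \<open>auto simp: I_def sp\<close>)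
      next
        case False
        then have "j = N" using jJ by (simp add: J_def)
        show ?thesis
          by (rule small[OF _ _ _ EN]) (auto simp: \<open>j = N\<close> sp)
      qed
      finally show ?thesis .
    qed
  qed
qed

lemma AA_fredholm:
  assumes inj: "\<And>h. AA h = h \<Longrightarrow> h = 0"
  shows "\<exists>h. h - AA h = g"
proof -
  \<comment> \<open>The pointwise error \<open>e * norm h\<close> is later multiplied by cnj u, so
    this choice makes the contraction constant 1/2; the added 1 avoids division by zero.\<close>
  define e where "e = 1 / (2 * (norm (l2_cls u) + 1))"
  have pos: "norm (l2_cls u) + 1 > 0" by (simp add: add_nonneg_pos)
  have e: "e > 0" unfolding e_def using pos by simp
  have eu: "e * norm (l2_cls u) \<le> 1/2"
    unfolding e_def using pos by (simp add: divide_le_eq)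
  from res_finite_rank[OF e] obtain N :: nat and I :: "nat \<Rightarrow> real set" and p :: "nat \<Rightarrow> real"
    where I0: "\<forall>j. I j \<in> sets borel" "\<forall>j. \<forall>x\<in>I j. 0 \<le> \<sigma> * (x - p j)"
    and close0: "\<forall>h x. cmod (res \<sigma> k (mulu h) x - (\<Sum>j\<le>N. indicator (I j) x * exp (\<i> * k * of_real (x - p j)) * res \<sigma> k (mulu h) (p j)))
       \<le> e * norm h"
    by (elim exE conjE)
  have I: "I j \<in> sets borel" "x \<in> I j \<Longrightarrow> 0 \<le> \<sigma> * (x - p j)" for j x
    using I0 by auto
  note close = close0[rule_format]
  note I(1)[measurable]
  \<comment> \<open>The exponential has modulus at most 1 on its own cell, where \<sigma> (x - p j)
    \<ge> 0; the indicator keeps the product bounded elsewhere.\<close>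
  define g\<^sub>0 where "g\<^sub>0 j x = indicator (I j) x * exp (\<i> * k * of_real (x - p j)) * cnj (u x)" for j x
  have g0: "g\<^sub>0 j \<in> L2" for j
    unfolding g\<^sub>0_def
  proof (rule L2_bounded_mult[OF L2_cnj[OF u_L2]])
    show "AE x in lborel. cmod (indicator (I j) x * exp (\<i> * k * of_real (x - p j))) \<le> 1"
      using exp_le_one I(2) by (intro AE_I2) (auto simp: indicator_def)
  qed measurable
  define c where "c j h = res \<sigma> k (mulu h) (p j)" for j h
  define F where "F h = (\<Sum>j\<le>N. l2_mul (\<lambda>_. c j h) (l2_cls (g\<^sub>0 j)))" for h
  \<comment> \<open>The span is over the reals, so a complex coefficient needs the two generators g
    and i g.\<close>
  define S where "S = (\<lambda>j. l2_cls (g\<^sub>0 j)) ` {..N} \<union> (\<lambda>j. l2_mul (\<lambda>_. \<i>) (l2_cls (g\<^sub>0 j))) ` {..N}"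
  have F_alt: "F h = (\<Sum>j\<le>N. Re (c j h) *\<^sub>R l2_cls (g\<^sub>0 j) + Im (c j h) *\<^sub>R l2_mul (\<lambda>_. \<i>) (l2_cls (g\<^sub>0 j)))" for h
    unfolding F_def by (subst l2_mul_const_split) (rule refl)
  have F_range: "F h \<in> span S" for h
    unfolding F_alt S_def by (intro span_sum span_add span_scale span_base) auto
  have linF: "linear F"
  proof (rule linearI)
    show "F (a + b) = F a + F b" for a b
      unfolding F_alt c_def res_mulu_add by (simp add: scaleR_add_left sum.distrib algebra_simps)
    show "F (r *\<^sub>R a) = r *\<^sub>R F a" for r a
      unfolding F_alt c_def res_mulu_scaleR by (simp add: scaleR_sum_right scaleR_add_right)
  qed
  have KF: "norm (KK h - F h) \<le> (1/2) * norm h" for h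
  proof -
    have Fh: "AE x in lborel. l2_fun (F h) x = (\<Sum>j\<le>N. c j h * g\<^sub>0 j x)"
    proof -
      have L: "(\<lambda>x. c j h * g\<^sub>0 j x) \<in> L2" for j by (rule L2_cmult[OF g0])
      have "F h = (\<Sum>j\<le>N. l2_cls (\<lambda>x. c j h * g\<^sub>0 j x))"
        unfolding F_def l2_mul_cls[OF bdd_mult_const g0] ..
      moreover have "(\<lambda>x. \<Sum>j\<le>n. c j h * g\<^sub>0 j x) \<in> L2 \<and> (\<Sum>j\<le>n. l2_cls (\<lambda>x. c j h * g\<^sub>0 j x)) = l2_cls (\<lambda>x. \<Sum>j\<le>n. c j h * g\<^sub>0 j x)" for n
        by (induction n) (auto simp: l2_cls_add L L2_add)
      ultimately show ?thesis using l2_fun_cls[of "\<lambda>x. \<Sum>j\<le>N. c j h * g\<^sub>0 j x"] by (simp only:)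
    qed
    have Kh: "AE x in lborel. l2_fun (KK h) x = res \<sigma> k (mulu h) x * cnj (u x)"
      unfolding KK_def by (rule l2_fun_cls[OF res_mult_cnj_L2[OF mulu_integrable]])
    have "norm (KK h - F h) \<le> (e * norm h) * norm (l2_cls u)"
    proof (rule norm_l2_le)
      show "0 \<le> e * norm h" using e by simp
      show "AE x in lborel. cmod (l2_fun (KK h - F h) x) \<le> (e * norm h) * cmod (l2_fun (l2_cls u) x)"
        using Fh Kh l2_fun_minus[of "KK h" "F h"] l2_fun_cls[OF u_L2]
      proof eventually_elim
        case (elim x)
        have "l2_fun (KK h - F h) x = (res \<sigma> k (mulu h) x - (\<Sum>j\<le>N. indicator (I j) x * exp (\<i> * k * of_real (x - p j)) * res \<sigma> k (mulu h) (p j))) * cnj (u x)"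
          unfolding elim left_diff_distrib sum_distrib_right c_def g\<^sub>0_def by (simp add: mult_ac)
        then show ?case
          unfolding elim(4) using mult_right_mono[OF close[of h x] norm_ge_zero[of "u x"]]
          by (simp add: norm_mult)
      qed
    qed
    also have "\<dots> = (e * norm (l2_cls u)) * norm h" by simp
    also have "\<dots> \<le> (1/2) * norm h" by (rule mult_right_mono[OF eu]) simp
    finally show ?thesis .
  qed
  note lin_szego = bounded_linear.linear[OF bounded_linear_l2_szego]
  show ?thesis
  proof (rule fredholm_alternative[where F = "\<lambda>h. l2_szego (F h)" and S = "l2_szego ` S" and c = "1/2"])
    show "linear (\<lambda>h. l2_szego (F h))" using linear_compose[OF linF lin_szego] by (simp add: comp_def)
    show "finite (l2_szego ` S)" by (simp add: S_def)
    show "l2_szego (F h) \<in> span (l2_szego ` S)" for h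
      unfolding linear_span_image[OF lin_szego] using F_range by blast
    show "norm (AA h - l2_szego (F h)) \<le> 1/2 * norm h" for h
    proof -
      have "AA h - l2_szego (F h) = l2_szego (KK h - F h)"
        unfolding AA_def by (rule linear_diff[OF lin_szego, symmetric])
      then show ?thesis using norm_l2_szego[of "KK h - F h"] KF[of h] by simp
    qed
  qed (use linear_AA inj in auto)
qed

end

subsection \<open>The Lax equation\<close>

text \<open>The nonlocal term is moved to the right side and treated as a source. The case v = u is
  the equation of the theorem, v = 0 the eigenvalue equation.\<close>

lemma lax_weak_ode:
  assumes "loc_integrable \<phi>" "loc_integrable v"
    and "loc_integrable (\<lambda>x. u x * szego (\<lambda>y. cnj (u y) * \<phi> y) x)"
  shows "distr_eq (lax u \<phi>) (distr_of (\<lambda>x. k * \<phi> x + v x)) \<longleftrightarrow>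
    weak_ode k \<phi> (\<lambda>x. v x + u x * szego (\<lambda>y. cnj (u y) * \<phi> y) x)"
  unfolding distr_eq_def weak_ode_def
proof (rule ball_cong[OF refl])
  fix \<psi> assume \<psi>: "\<psi> \<in> test_functions"
  let ?w = "\<lambda>x. u x * szego (\<lambda>y. cnj (u y) * \<phi> y) x"
  have "(LINT x|lborel. (k * \<phi> x + (v x + ?w x)) * \<psi> x) = (LINT x|lborel. (k * \<phi> x + v x) * \<psi> x + ?w x * \<psi> x)"
    by (simp add: algebra_simps)
  also have "\<dots> = (LINT x|lborel. (k * \<phi> x + v x) * \<psi> x) + (LINT x|lborel. ?w x * \<psi> x)"
    by (intro Bochner_Integration.integral_add loc_integrable_test[OF _ \<psi>] loc_integrable_add loc_integrable_cmult assms)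
  finally have 1: "(LINT x|lborel. (k * \<phi> x + (v x + ?w x)) * \<psi> x) =
    (LINT x|lborel. (k * \<phi> x + v x) * \<psi> x) + (LINT x|lborel. ?w x * \<psi> x)" .
  have "a - b = c \<longleftrightarrow> a = c + b" for a b c :: complex by (rule diff_eq_eq)
  then show "(lax u \<phi> \<psi> = distr_of (\<lambda>x. k * \<phi> x + v x) \<psi>) \<longleftrightarrow>
    (\<i> * (LINT x|lborel. \<phi> x * vector_derivative \<psi> (at x)) = (LINT x|lborel. (k * \<phi> x + (v x + ?w x)) * \<psi> x))"
    unfolding 1 by (simp add: lax_def distr_deriv_def distr_of_def)
qed

lemma weak_ode_cong_AE:
  assumes "weak_ode k \<phi> f" "\<phi> \<in> borel_measurable borel" "f \<in> borel_measurable borel" "g \<in> borel_measurable borel"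
    and "AE x in lborel. f x = g x"
  shows "weak_ode k \<phi> g"
  unfolding weak_ode_def
proof
  fix \<psi> assume \<psi>: "\<psi> \<in> test_functions"
  note [measurable] = test_functions_measurable[OF \<psi>] assms(2-4)
  have "(LINT x|lborel. (k * \<phi> x + f x) * \<psi> x) = (LINT x|lborel. (k * \<phi> x + g x) * \<psi> x)"
  proof (rule integral_cong_AE)
    show "AE x in lborel. (k * \<phi> x + f x) * \<psi> x = (k * \<phi> x + g x) * \<psi> x"
      using assms(5) by eventually_elim simp
  qed measurable
  then show "\<i> * (LINT x|lborel. \<phi> x * vector_derivative \<psi> (at x)) = (LINT x|lborel. (k * \<phi> x + g x) * \<psi> x)"
    using assms(1) \<psi> unfolding weak_ode_def by simp
qed

text \<open>Division by \<xi> - k, which vanishes for at most one real \<xi>, carries the vanishing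
  at negative frequencies from f to \<phi>; the equation also bounds \<xi> times the transform of
  \<phi> by L^2 functions, which is the H^1 condition.\<close>

lemma hardy_sobolev_of_FT:
  assumes L2: "\<phi> \<in> L2" "f \<in> L2" and hf: "hardy (l2_cls f)"
    and eq: "AE \<xi> in lborel. (of_real \<xi> - k) * l2_fun (l2_FT (l2_cls \<phi>)) \<xi> = l2_fun (l2_FT (l2_cls f)) \<xi>"
  shows "\<phi> \<in> hardy_sobolev 1"
  unfolding hardy_sobolev_iff
proof (intro conjI L2)
  let ?P = "l2_fun (l2_FT (l2_cls \<phi>))" and ?F = "l2_fun (l2_FT (l2_cls f))"
  show "hardy (l2_cls \<phi>)"
    unfolding hardy_def
    using eq hf[unfolded hardy_def] AE_lborel_singleton[of "Re k"]
  proof eventually_elim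
    case (elim \<xi>)
    show ?case
    proof
      assume "\<xi> < 0"
      moreover have "of_real \<xi> - k \<noteq> 0" using elim(3) by (auto simp: complex_eq_iff)
      ultimately show "?P \<xi> = 0" using elim by simp
    qed
  qed
  show "integrable lborel (\<lambda>\<xi>. (1 + \<xi>\<^sup>2) * (cmod (?P \<xi>))\<^sup>2)"
  proof (rule Bochner_Integration.integrable_bound)
    show "integrable lborel (\<lambda>\<xi>. (1 + 2 * (cmod k)\<^sup>2) * (cmod (?P \<xi>))\<^sup>2 + 2 * (cmod (?F \<xi>))\<^sup>2)"
      by (intro Bochner_Integration.integrable_add integrable_mult_right L2_integrable_square l2_fun_L2)
    show "AE \<xi> in lborel. norm ((1 + \<xi>\<^sup>2) * (cmod (?P \<xi>))\<^sup>2) \<le> norm ((1 + 2 * (cmod k)\<^sup>2) * (cmod (?P \<xi>))\<^sup>2 + 2 * (cmod (?F \<xi>))\<^sup>2)"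
      using eq
    proof eventually_elim
      case (elim \<xi>)
      have "of_real \<xi> * ?P \<xi> = k * ?P \<xi> + ?F \<xi>" using elim by (simp add: algebra_simps)
      then have "\<bar>\<xi>\<bar> * cmod (?P \<xi>) = cmod (k * ?P \<xi> + ?F \<xi>)" by (metis norm_mult norm_of_real)
      also have "\<dots> \<le> cmod k * cmod (?P \<xi>) + cmod (?F \<xi>)"
        using norm_triangle_ineq[of "k * ?P \<xi>" "?F \<xi>"] by (simp add: norm_mult)
      finally have "(\<bar>\<xi>\<bar> * cmod (?P \<xi>))\<^sup>2 \<le> (cmod k * cmod (?P \<xi>) + cmod (?F \<xi>))\<^sup>2"
        by (intro power_mono) auto
      also have "\<dots> \<le> 2 * (cmod k * cmod (?P \<xi>))\<^sup>2 + 2 * (cmod (?F \<xi>))\<^sup>2"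
        using sum_squares_bound[of "cmod k * cmod (?P \<xi>)" "cmod (?F \<xi>)"] by (simp add: power2_sum)
      finally show ?case by (simp add: power_mult_distrib algebra_simps)
    qed
  qed measurable
qed

lemma hardy_add: "hardy a \<Longrightarrow> hardy b \<Longrightarrow> hardy (a + b)"
proof -
  assume a: "hardy a" and b: "hardy b"
  have 1: "l2_FT (a + b) = l2_FT a + l2_FT b"
    by (rule linear_add[OF bounded_linear.linear[OF bounded_linear_l2_FT]])
  show ?thesis
    unfolding hardy_def 1
    using a[unfolded hardy_def] b[unfolded hardy_def] l2_fun_plus[of "l2_FT a" "l2_FT b"]
    by eventually_elim simp
qed

section \<open>Square integrability and decay of half-line solutions\<close>

context halfline_resolvent
begin

text \<open>The transform of f lives on [0, infinity), where 1/(\<xi> - k) is bounded by 1/d, so the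
  equation has an L^2 solution. It differs from the half-line solution by a multiple of exp(i k x),
  and this multiple is zero.\<close>

lemma res_L2_off_spectrum:
  assumes f: "integrable lborel f" "f \<in> L2" and hf: "hardy (l2_cls f)"
    and d: "0 < d" "\<And>\<xi>. 0 \<le> \<xi> \<Longrightarrow> d \<le> cmod (of_real \<xi> - k)"
  shows "res \<sigma> k f \<in> L2"
proof -
  define m where "m \<xi> = indicator {0..} \<xi> / (of_real \<xi> - k)" for \<xi> :: real
  have m: "bdd_mult m"
  proof (rule bdd_multI)
    show "m \<in> borel_measurable borel" unfolding m_def by measurable
    show "cmod (m \<xi>) \<le> 1 / d" for \<xi>
      using d(2)[of \<xi>] d(1) by (auto simp: m_def norm_divide indicator_def frac_le)
  qed
  define a where "a = l2_IFT (l2_mul m (l2_FT (l2_cls f)))"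
  have "AE \<xi> in lborel. (of_real \<xi> - k) * l2_fun (l2_FT (l2_cls (l2_fun a))) \<xi> = l2_fun (l2_FT (l2_cls f)) \<xi>"
    unfolding l2_cls_fun a_def l2_FT_IFT
    using l2_fun_mul[OF m, of "l2_FT (l2_cls f)"] hf[unfolded hardy_def]
  proof eventually_elim
    case (elim \<xi>)
    show ?case
    proof (cases "\<xi> < 0")
      case True then show ?thesis using elim by simp
    next
      case False
      then have "of_real \<xi> - k \<noteq> 0" using d(2)[of \<xi>] d(1) by auto
      then show ?thesis using False elim by (simp add: m_def)
    qed
  qed
  then have "weak_ode k (l2_fun a) f" by (rule weak_ode_of_FT[OF l2_fun_L2 f(2)])
  then obtain c where c: "AE x in lborel. l2_fun a x - res \<sigma> k f x = c * exp (\<i> * k * of_real x)"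
    using weak_ode_unique[OF loc_integrable_L2[OF l2_fun_L2] res_loc_integrable[OF f(1)] loc_integrable_L1[OF f(1)] _ res_weak_ode[OF f(1)]]
    by blast
  have "c = 0"
    by (rule vanishing_solution_zero[OF \<sigma> k c res_vanish[OF f(1)]]) simp
  from c have eq: "AE x in lborel. l2_fun a x = res \<sigma> k f x" by eventually_elim (simp add: \<open>c = 0\<close>)
  have "f \<in> borel_measurable borel" using f(2) by measurable
  then show ?thesis by (rule L2_cong_AE[OF l2_fun_L2 res_measurable eq])
qed

text \<open>The flux identity: the total mass of \<^term>\<open>exp (- (\<i> * k * of_real y)) * f y\<close> is the
  jump of the modulus of the solution across the line.\<close>

lemma res_flux:
  assumes f: "integrable lborel f" and real: "Im k = 0"
  shows "(cmod (LINT y|lborel. exp (- (\<i> * k * of_real y)) * f y))\<^sup>2 =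
    2 * Re (\<i> * of_real \<sigma> * (LINT x|lborel. f x * cnj (res \<sigma> k f x)))"
proof -
  have [measurable]: "f \<in> borel_measurable borel" using f by auto
  define G where "G y = exp (- (\<i> * k * of_real y)) * f y" for y
  have [measurable]: "G \<in> borel_measurable borel" unfolding G_def[abs_def] by measurable
  have nG: "cmod (G y) = cmod (f y)" for y
    using real by (simp add: G_def norm_mult norm_exp_eq_Re)
  have G: "integrable lborel G"
    by (rule Bochner_Integration.integrable_bound[OF f]) (auto simp: nG)
  \<comment> \<open>For real k the exponential of modulus 1 splits off and the resolvent becomes a
    running integral of G, up to a phase.\<close>
  define P where "P x = (LINT y|lborel. indicator {0<..} (\<sigma> * (x - y)) * G y)" for x
  have res_P: "res \<sigma> k f x = \<i> * of_real \<sigma> * exp (\<i> * k * of_real x) * P x" for x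
  proof -
    have "(LINT y|lborel. res_kernel \<sigma> k x y * f y) = (LINT y|lborel. exp (\<i> * k * of_real x) * (indicator {0<..} (\<sigma> * (x - y)) * G y))"
    proof (rule Bochner_Integration.integral_cong[OF refl])
      fix y
      have "exp (\<i> * k * of_real (x - y)) = exp (\<i> * k * of_real x) * exp (- (\<i> * k * of_real y))"
        by (simp add: mult_exp_exp algebra_simps)
      then show "res_kernel \<sigma> k x y * f y = exp (\<i> * k * of_real x) * (indicator {0<..} (\<sigma> * (x - y)) * G y)"
        unfolding res_kernel_def G_def by (simp only: mult_ac)
    qed
    also have "\<dots> = exp (\<i> * k * of_real x) * P x" unfolding P_def by (rule integral_mult_right_zero)
    finally show ?thesis by (simp add: res_def mult.assoc)
  qed
  let ?h = "\<lambda>x y. indicator {0<..} (\<sigma> * (x - y)) * (G x * cnj (G y))"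
  have GG: "integrable (lborel \<Otimes>\<^sub>M lborel) (\<lambda>(x, y). G x * cnj (G y))"
  proof (rule lborel_pair.Fubini_integrable)
    have "integrable lborel (\<lambda>x. cmod (G x) * (LINT y|lborel. cmod (G y)))"
      by (intro integrable_mult_left integrable_norm G)
    then show "integrable lborel (\<lambda>x. LINT y|lborel. norm (case (x, y) of (x, y) \<Rightarrow> G x * cnj (G y)))"
      by (simp add: norm_mult)
  qed (use G in simp_all)
  have int: "integrable (lborel \<Otimes>\<^sub>M lborel) (\<lambda>(x, y). ?h x y)"
  proof (rule Bochner_Integration.integrable_bound[OF GG])
    show "(\<lambda>(x, y). ?h x y) \<in> borel_measurable (lborel \<Otimes>\<^sub>M lborel)" by measurable
  qed (auto intro!: AE_I2 simp: indicator_def)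
  have int': "integrable (lborel \<Otimes>\<^sub>M lborel) (\<lambda>(x, y). indicator {0<..} (\<sigma> * (y - x)) * (G x * cnj (G y)))"
  proof (rule Bochner_Integration.integrable_bound[OF GG])
    show "(\<lambda>(x, y). indicator {0<..} (\<sigma> * (y - x)) * (G x * cnj (G y))) \<in> borel_measurable (lborel \<Otimes>\<^sub>M lborel)" by measurable
  qed (auto intro!: AE_I2 simp: indicator_def)
  define Z where "Z = (LINT x|lborel. G x * cnj (P x))"
  have cP: "(LINT y|lborel. ?h x y) = G x * cnj (P x)" for x
  proof -
    have "(LINT y|lborel. ?h x y) = (LINT y|lborel. G x * cnj (indicator {0<..} (\<sigma> * (x - y)) * G y))"
      by (rule Bochner_Integration.integral_cong) (auto simp: indicator_def)
    then show ?thesis unfolding P_def by (simp only: integral_mult_right_zero Bochner_Integration.integral_cnj)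
  qed
  have P': "(LINT x|lborel. indicator {0<..} (\<sigma> * (y - x)) * (G x * cnj (G y))) = cnj (G y * cnj (P y))" for y
  proof -
    have "(LINT x|lborel. indicator {0<..} (\<sigma> * (y - x)) * (G x * cnj (G y))) = (LINT x|lborel. (indicator {0<..} (\<sigma> * (y - x)) * G x) * cnj (G y))"
      by (simp only: mult.assoc)
    also have "\<dots> = P y * cnj (G y)" unfolding P_def by (rule integral_mult_left_zero)
    finally show ?thesis by (simp add: mult.commute)
  qed
  have "of_real ((cmod (LINT y|lborel. G y))\<^sup>2) = (LINT x|lborel. G x) * cnj (LINT y|lborel. G y)"
    by (rule complex_norm_square)
  also have "\<dots> = (LINT x|lborel. G x * cnj (LINT y|lborel. G y))" by (rule integral_mult_left_zero[symmetric])
  \<comment> \<open>The squared modulus of the total integral is a double integral of G(x) cnj G(y).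
    Off the diagonal, a null set, it splits into the parts on the two sides, which are Z and its
    conjugate.\<close>
  also have "\<dots> = (LINT x|lborel. (LINT y|lborel. ?h x y) + (LINT y|lborel. indicator {0<..} (\<sigma> * (y - x)) * (G x * cnj (G y))))"
  proof (rule Bochner_Integration.integral_cong[OF refl])
    fix x
    have i: "integrable lborel (\<lambda>y. ?h x y)" "integrable lborel (\<lambda>y. indicator {0<..} (\<sigma> * (y - x)) * (G x * cnj (G y)))"
      by (rule Bochner_Integration.integrable_bound[of lborel "\<lambda>y. G x * cnj (G y)"]; use G in \<open>auto simp: indicator_def\<close>)+
    have "G x * cnj (LINT y|lborel. G y) = (LINT y|lborel. G x * cnj (G y))"
      by (simp only: integral_mult_right_zero Bochner_Integration.integral_cnj)
    also have "\<dots> = (LINT y|lborel. ?h x y + indicator {0<..} (\<sigma> * (y - x)) * (G x * cnj (G y)))"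
    proof (rule integral_cong_AE)
      show "AE y in lborel. G x * cnj (G y) = ?h x y + indicator {0<..} (\<sigma> * (y - x)) * (G x * cnj (G y))"
        using AE_lborel_singleton[of x] by eventually_elim (use \<sigma> in \<open>auto simp: indicator_def\<close>)
    qed measurable
    finally show "G x * cnj (LINT y|lborel. G y) = (LINT y|lborel. ?h x y) + (LINT y|lborel. indicator {0<..} (\<sigma> * (y - x)) * (G x * cnj (G y)))"
      unfolding Bochner_Integration.integral_add[OF i] .
  qed
  also have "\<dots> = (LINT x|lborel. LINT y|lborel. ?h x y) + (LINT x|lborel. LINT y|lborel. indicator {0<..} (\<sigma> * (y - x)) * (G x * cnj (G y)))"
    using lborel_pair.integrable_fst[OF int] lborel_pair.integrable_fst[OF int']
    by (intro Bochner_Integration.integral_add) auto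
  also have "(LINT x|lborel. LINT y|lborel. ?h x y) = Z" unfolding Z_def cP ..
  also have "(LINT x|lborel. LINT y|lborel. indicator {0<..} (\<sigma> * (y - x)) * (G x * cnj (G y))) =
      (LINT y|lborel. LINT x|lborel. indicator {0<..} (\<sigma> * (y - x)) * (G x * cnj (G y)))"
    by (rule lborel_pair.Fubini_integral[OF int', symmetric])
  also have "\<dots> = cnj Z" unfolding Z_def P' by (rule Bochner_Integration.integral_cnj)
  also have "Z + cnj Z = of_real (2 * Re Z)" by (simp add: complex_eq_iff)
  finally have main: "(cmod (LINT y|lborel. G y))\<^sup>2 = 2 * Re Z" by (simp only: of_real_eq_iff)
  have "G x * cnj (P x) = \<i> * of_real \<sigma> * (f x * cnj (res \<sigma> k f x))" for x
  proof -
    have kr: "cnj k = k" using real by (simp add: complex_eq_iff)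
    have "cnj (res \<sigma> k f x) = - \<i> * of_real \<sigma> * exp (- (\<i> * k * of_real x)) * cnj (P x)"
      unfolding res_P by (simp add: exp_cnj kr)
    then have "\<i> * of_real \<sigma> * (f x * cnj (res \<sigma> k f x)) = - (\<i> * \<i>) * (of_real \<sigma> * of_real \<sigma>) * (exp (- (\<i> * k * of_real x)) * f x * cnj (P x))"
      by (simp only: mult_ac mult_minus_left mult_minus_right)
    moreover have "of_real \<sigma> * of_real \<sigma> = (1::complex)" using \<sigma> by auto
    ultimately show ?thesis by (auto simp: G_def)
  qed
  then have "Z = \<i> * of_real \<sigma> * (LINT x|lborel. f x * cnj (res \<sigma> k f x))"
    unfolding Z_def by (simp only: integral_mult_right_zero)
  then show ?thesis using main unfolding G_def by (simp only:)
qed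

text \<open>When the total integral vanishes, the integral over one side of x is minus the integral
  over the other side. Choosing the side that points away from the origin leaves only points with
  |y| \<ge> |x|.\<close>

lemma res_two_sided_tail:
  assumes f: "integrable lborel f" and real: "Im k = 0"
    and zero: "(LINT y|lborel. exp (- (\<i> * k * of_real y)) * f y) = 0"
  shows "cmod (res \<sigma> k f x) \<le> (LINT y|lborel. indicator {y. \<bar>x\<bar> \<le> \<bar>y\<bar>} y * cmod (f y))"
proof -
  have [measurable]: "f \<in> borel_measurable borel" using f by auto
  let ?E = "{y. \<bar>x\<bar> \<le> \<bar>y\<bar>}"
  have absx: "y \<in> ?E \<longleftrightarrow> \<bar>\<sigma> * x\<bar> \<le> \<bar>\<sigma> * y\<bar>" for y using \<sigma> by auto
  show ?thesis
  proof (cases "\<sigma> * x \<le> 0")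
    case True
    show ?thesis unfolding norm_res
    proof (rule kernel_integral_le[OF f])
      fix y
      have "y \<in> ?E" if "0 < \<sigma> * (x - y)"
        using that True unfolding absx by (simp add: right_diff_distrib)
      then show "cmod (res_kernel \<sigma> k x y) \<le> indicator ?E y"
        using res_kernel_le[of x y] by (cases "0 < \<sigma> * (x - y)") (auto simp: indicator_def split: if_splits)
    qed measurable
  next
    case False
    let ?e = "\<lambda>y. exp (\<i> * k * of_real (x - y))"
    have ne: "cmod (?e y) = 1" for y using real by (simp add: norm_exp_eq_Re)
    have ie: "integrable lborel (\<lambda>y. ?e y * f y)"
    proof (rule Bochner_Integration.integrable_bound[OF f])
      show "AE y in lborel. norm (?e y * f y) \<le> norm (f y)"
        by (intro AE_I2) (simp only: norm_mult ne mult_1 order_refl)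
    qed measurable
    have "(LINT y|lborel. ?e y * f y) = (LINT y|lborel. exp (\<i> * k * of_real x) * (exp (- (\<i> * k * of_real y)) * f y))"
    proof (rule Bochner_Integration.integral_cong[OF refl])
      fix y
      have "?e y = exp (\<i> * k * of_real x) * exp (- (\<i> * k * of_real y))"
        by (simp add: mult_exp_exp algebra_simps)
      then show "?e y * f y = exp (\<i> * k * of_real x) * (exp (- (\<i> * k * of_real y)) * f y)"
        by (simp only: mult.assoc)
    qed
    also have "\<dots> = 0" unfolding integral_mult_right_zero zero by simp
    finally have e0: "(LINT y|lborel. ?e y * f y) = 0" .
    \<comment> \<open>Subtracting the full exponential, whose integral against f is 0, moves the
      kernel to the complementary half-line.\<close>
    have "(LINT y|lborel. (res_kernel \<sigma> k x y - ?e y) * f y) = (LINT y|lborel. res_kernel \<sigma> k x y * f y) - (LINT y|lborel. ?e y * f y)"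
      unfolding left_diff_distrib by (rule Bochner_Integration.integral_diff[OF res_integrable[OF f] ie])
    then have "cmod (res \<sigma> k f x) = cmod (LINT y|lborel. (res_kernel \<sigma> k x y - ?e y) * f y)"
      unfolding norm_res e0 by simp
    also have "\<dots> \<le> (LINT y|lborel. indicator ?E y * cmod (f y))"
    proof (rule kernel_integral_le[OF f])
      fix y
      show "cmod (res_kernel \<sigma> k x y - ?e y) \<le> indicator ?E y"
      proof (cases "0 < \<sigma> * (x - y)")
        case True
        then show ?thesis by (simp add: res_kernel_def)
      next
        case F: False
        then have "\<sigma> * x \<le> \<sigma> * y" by (simp add: right_diff_distrib)
        then have "y \<in> ?E" using False unfolding absx by simp
        moreover have "res_kernel \<sigma> k x y - ?e y = - ?e y" using F by (simp add: res_kernel_def)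
        ultimately show ?thesis using ne[of y] by (simp only: norm_minus_cancel indicator_simps order_refl)
      qed
    qed measurable
    finally show ?thesis .
  qed
qed

end

section \<open>Functions of weighted bounded growth\<close>

lemma Linf_weighted_bound:
  assumes "\<phi> \<in> Linf_weighted (- s)"
  shows "\<exists>C\<ge>0. AE x in lborel. cmod (\<phi> x) \<le> C * (1 + x\<^sup>2) powr (s / 2)"
proof -
  let ?g = "\<lambda>x. cmod (of_real (japanese x powr - s) * \<phi> x)"
  have e: "esssup lborel (\<lambda>x. ereal (?g x)) < \<infinity>" using assms by (simp add: Linf_weighted_def)
  have "\<exists>C::real. esssup lborel (\<lambda>x. ereal (?g x)) \<le> ereal C"
    by (cases "esssup lborel (\<lambda>x. ereal (?g x))") (use e in auto)
  then obtain C where C: "esssup lborel (\<lambda>x. ereal (?g x)) \<le> ereal C" by blast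
  have "AE x in lborel. cmod (\<phi> x) \<le> max C 0 * (1 + x\<^sup>2) powr (s / 2)"
    using esssup_AE[of "\<lambda>x. ereal (?g x)" lborel]
  proof eventually_elim
    case (elim x)
    have "ereal (?g x) \<le> ereal C" using elim C by (rule order_trans)
    then have 1: "japanese x powr (- s) * cmod (\<phi> x) \<le> C" by (simp add: norm_mult)
    have p: "1 + x\<^sup>2 > 0" by (simp add: add_pos_nonneg)
    have j: "japanese x powr (- s) = 1 / (1 + x\<^sup>2) powr (s / 2)"
      using p by (simp add: japanese_def powr_half_sqrt[symmetric] powr_powr powr_minus_divide)
    have q: "(1 + x\<^sup>2) powr (s / 2) > 0" using p by simp
    have "cmod (\<phi> x) \<le> C * (1 + x\<^sup>2) powr (s / 2)"
      using 1 q unfolding j by (simp add: field_simps)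
    also have "\<dots> \<le> max C 0 * (1 + x\<^sup>2) powr (s / 2)" by (rule mult_right_mono) auto
    finally show ?case .
  qed
  then show ?thesis by (intro exI[of _ "max C 0"]) simp
qed

lemma Linf_weightedI:
  assumes [measurable]: "\<phi> \<in> borel_measurable borel" and "\<And>x. cmod (\<phi> x) \<le> C" and s: "s \<ge> 0"
  shows "\<phi> \<in> Linf_weighted (- s)"
  unfolding Linf_weighted_def
proof (intro CollectI conjI assms(1))
  have [measurable]: "japanese \<in> borel_measurable borel" unfolding japanese_def[abs_def] by measurable
  have "esssup lborel (\<lambda>x. ereal (cmod (of_real (japanese x powr - s) * \<phi> x))) \<le> ereal C"
  proof (rule esssup_I)
    show "AE x in lborel. ereal (cmod (of_real (japanese x powr - s) * \<phi> x)) \<le> ereal C"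
    proof (rule AE_I2)
      fix x
      have "1 \<le> japanese x" by (simp add: japanese_def)
      then have "japanese x powr (- s) \<le> 1 powr (- s)" using s by (intro powr_mono2') auto
      then have "japanese x powr (- s) * cmod (\<phi> x) \<le> 1 * C"
        using assms(2)[of x] by (intro mult_mono) auto
      then show "ereal (cmod (of_real (japanese x powr - s) * \<phi> x)) \<le> ereal C" by (simp add: norm_mult)
    qed
  qed measurable
  then show "esssup lborel (\<lambda>x. ereal (cmod (of_real (japanese x powr - s) * \<phi> x))) < \<infinity>"
    by (rule le_less_trans) simp
qed

lemma Linf_weighted_loc_integrable:
  assumes \<phi>: "\<phi> \<in> Linf_weighted (- s)" and s: "s \<ge> 0"
  shows "loc_integrable \<phi>"
  unfolding loc_integrable_def
proof (intro conjI allI)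
  show [measurable]: "\<phi> \<in> borel_measurable borel" using \<phi> by (simp add: Linf_weighted_def)
  obtain C where C: "C \<ge> 0" "AE x in lborel. cmod (\<phi> x) \<le> C * (1 + x\<^sup>2) powr (s / 2)"
    using Linf_weighted_bound[OF \<phi>] by blast
  fix R :: real
  show "integrable lborel (\<lambda>x. indicator {-R..R} x * \<phi> x)"
  proof (rule Bochner_Integration.integrable_bound)
    show "integrable lborel (\<lambda>x. (C * (1 + R\<^sup>2) powr (s / 2)) * indicator {-R..R} x)"
      by (intro integrable_mult_right integrable_real_indicator) (auto simp: emeasure_lborel_Icc_eq)
    show "AE x in lborel. norm (indicator {-R..R} x * \<phi> x) \<le> norm ((C * (1 + R\<^sup>2) powr (s / 2)) * indicator {-R..R} x)"
      using C(2)
    proof eventually_elim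
      case (elim x)
      show ?case
      proof (cases "x \<in> {-R..R}")
        case True
        then have "x\<^sup>2 \<le> R\<^sup>2" by (simp add: abs_le_square_iff[symmetric] abs_le_iff)
        then have "(1 + x\<^sup>2) powr (s / 2) \<le> (1 + R\<^sup>2) powr (s / 2)"
          using s by (intro powr_mono2) auto
        then have "C * (1 + x\<^sup>2) powr (s / 2) \<le> C * (1 + R\<^sup>2) powr (s / 2)"
          using C(1) by (rule mult_left_mono)
        then show ?thesis using True elim C(1) by simp
      qed simp
    qed
  qed measurable
qed

section \<open>Injectivity of 1 - A\<close>

context lax_resolvent
begin

lemma s_nonneg: "0 \<le> s" using s by simp

text \<open>The growth (1 + x^2)^(s/2) of \<phi>, squared, is exactly the weight with which |u|^2 is
  integrable.\<close>

lemma cnj_u_mult_L2: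
  assumes \<phi>: "\<phi> \<in> Linf_weighted (- s)"
  shows "(\<lambda>x. cnj (u x) * \<phi> x) \<in> L2"
proof -
  have [measurable]: "\<phi> \<in> borel_measurable borel" using \<phi> by (simp add: Linf_weighted_def)
  obtain C where C: "C \<ge> 0" "AE x in lborel. cmod (\<phi> x) \<le> C * (1 + x\<^sup>2) powr (s / 2)"
    using Linf_weighted_bound[OF \<phi>] by blast
  show ?thesis
  proof (rule L2_dominated)
    show "integrable lborel (\<lambda>x. C\<^sup>2 * ((cmod (u x))\<^sup>2 * (1 + x\<^sup>2) powr s))"
      by (rule integrable_mult_right[OF u_weight])
    show "AE x in lborel. (cmod (cnj (u x) * \<phi> x))\<^sup>2 \<le> C\<^sup>2 * ((cmod (u x))\<^sup>2 * (1 + x\<^sup>2) powr s)"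
      using C(2)
    proof eventually_elim
      case (elim x)
      have "(cmod (\<phi> x))\<^sup>2 \<le> (C * (1 + x\<^sup>2) powr (s / 2))\<^sup>2" using elim by (rule power_mono) simp
      also have "\<dots> = C\<^sup>2 * (1 + x\<^sup>2) powr s"
        by (simp add: power_mult_distrib power2_eq_square[of "_ powr _"] powr_add[symmetric])
      finally have "(cmod (u x))\<^sup>2 * (cmod (\<phi> x))\<^sup>2 \<le> (cmod (u x))\<^sup>2 * (C\<^sup>2 * (1 + x\<^sup>2) powr s)"
        by (rule mult_left_mono) simp
      then show ?case by (simp add: norm_mult power_mult_distrib mult_ac)
    qed
  qed measurable
qed

text \<open>Because \<open>u h\<close> is integrable, its transform is the classical integral, so
  \<open>FT_mult_hardy\<close> applies at every negative frequency.\<close>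

lemma hardy_mulu:
  assumes "hardy h" shows "hardy (l2_cls (mulu h))"
proof -
  have "FT (mulu h) = FT (\<lambda>x. l2_fun (l2_cls u) x * l2_fun h x)"
  proof (rule FT_cong_AE)
    show "AE x in lborel. mulu h x = l2_fun (l2_cls u) x * l2_fun h x"
      using l2_fun_cls[OF u_L2] by eventually_elim (simp add: mulu_def)
  qed measurable
  then have zero: "FT (mulu h) \<xi> = 0" if "\<xi> < 0" for \<xi>
    using FT_mult_hardy[OF u_hardy assms that] by simp
  show ?thesis
    unfolding hardy_def l2_FT_cls[OF mulu_L2 mulu_integrable]
    using l2_fun_cls[OF FT_L2[OF mulu_integrable mulu_L2, of h]] by eventually_elim (simp add: zero)
qed

text \<open>With q = cnj u R(u h) and h = \<Pi> q, the integral is the pairing of \<Pi> q with the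
  conjugate of q.\<close>

lemma flux_real:
  assumes h: "AA h = h"
  shows "(LINT x|lborel. mulu h x * cnj (res \<sigma> k (mulu h) x)) \<in> \<real>"
proof -
  have L: "(\<lambda>x. res \<sigma> k (mulu h) x * cnj (u x)) \<in> L2" by (rule res_mult_cnj_L2[OF mulu_integrable])
  have "(LINT x|lborel. mulu h x * cnj (res \<sigma> k (mulu h) x)) = (LINT x|lborel. l2_fun h x * cnj (res \<sigma> k (mulu h) x * cnj (u x)))"
    by (simp add: mulu_def mult_ac)
  also have "\<dots> = l2_pair (l2_cls (l2_fun h)) (l2_cls (\<lambda>x. cnj (res \<sigma> k (mulu h) x * cnj (u x))))"
    by (rule l2_pair_cls[OF l2_fun_L2 L2_cnj[OF L], symmetric])
  also have "\<dots> = l2_pair h (l2_cnj (KK h))"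
    unfolding l2_cls_fun KK_def l2_cnj_cls[OF L] ..
  also have "h = l2_szego (KK h)" using h by (simp add: AA_def)
  finally show ?thesis using l2_pair_szego_real[of "KK h"] h by (simp add: AA_def)
qed

text \<open>The weight w = (1 + x^2)^(s/2) increases with |x|, so at x it may be pulled into the
  integral over |y| \<ge> |x|. The weighted mass T of \<open>u h\<close> is finite since w u and h
  are in L^2; hence |R(u h)| \<le> T / w, and 1/w is in L^2.\<close>

lemma res_mulu_L2_of_flux:
  assumes real: "Im k = 0" and h: "AA h = h"
  shows "res \<sigma> k (mulu h) \<in> L2"
proof -
  let ?f = "mulu h"
  have "Re (\<i> * of_real \<sigma> * (LINT x|lborel. ?f x * cnj (res \<sigma> k ?f x))) = 0"
    using flux_real[OF h] \<sigma> by (auto simp: complex_is_Real_iff)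
  then have "(cmod (LINT y|lborel. exp (- (\<i> * k * of_real y)) * ?f y))\<^sup>2 = 0"
    by (simp only: res_flux[OF mulu_integrable real] mult_zero_right)
  then have zero: "(LINT y|lborel. exp (- (\<i> * k * of_real y)) * ?f y) = 0" by simp
  let ?w = "\<lambda>x::real. (1 + x\<^sup>2) powr (s / 2)"
  have p: "1 + x\<^sup>2 > 0" for x :: real by (simp add: add_pos_nonneg)
  have W: "(\<lambda>y. of_real (?w y) * u y) \<in> L2"
  proof (rule L2_dominated[OF _ u_weight])
    have "(?w x)\<^sup>2 = (1 + x\<^sup>2) powr s" for x
      by (simp add: power2_eq_square[of "_ powr _"] powr_add[symmetric])
    then show "AE x in lborel. (cmod (of_real (?w x) * u x))\<^sup>2 \<le> (cmod (u x))\<^sup>2 * (1 + x\<^sup>2) powr s"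
      by (simp add: norm_mult power_mult_distrib mult.commute)
  qed measurable
  have "integrable lborel (\<lambda>y. cmod ((of_real (?w y) * u y) * l2_fun h y))"
    by (rule integrable_norm[OF L2_mult_integrable[OF W l2_fun_L2]])
  then have wf: "integrable lborel (\<lambda>y. ?w y * cmod (?f y))"
    by (simp add: mulu_def norm_mult mult.assoc)
  define T where "T = (LINT y|lborel. ?w y * cmod (?f y))"
  have T0: "0 \<le> T" unfolding T_def by (rule Bochner_Integration.integral_nonneg) simp
  have bound: "?w x * cmod (res \<sigma> k ?f x) \<le> T" for x
  proof -
    have "?w x * cmod (res \<sigma> k ?f x) \<le> ?w x * (LINT y|lborel. indicator {y. \<bar>x\<bar> \<le> \<bar>y\<bar>} y * cmod (?f y))"
      by (rule mult_left_mono[OF res_two_sided_tail[OF mulu_integrable real zero]]) simp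
    also have "\<dots> = (LINT y|lborel. ?w x * (indicator {y. \<bar>x\<bar> \<le> \<bar>y\<bar>} y * cmod (?f y)))"
      by (rule integral_mult_right_zero[symmetric])
    also have "\<dots> \<le> T"
      unfolding T_def
    proof (rule integral_mono'[OF wf])
      fix y
      have "?w x \<le> ?w y" if "\<bar>x\<bar> \<le> \<bar>y\<bar>"
        using that s_nonneg by (intro powr_mono2) (auto simp: abs_le_square_iff)
      then show "?w x * (indicator {y. \<bar>x\<bar> \<le> \<bar>y\<bar>} y * cmod (?f y)) \<le> ?w y * cmod (?f y)"
        by (auto simp: indicator_def intro: mult_right_mono)
    qed simp
    finally show ?thesis .
  qed
  show ?thesis
  proof (rule L2_dominated)
    show "res \<sigma> k ?f \<in> borel_measurable borel" by (rule res_measurable) measurable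
    show "integrable lborel (\<lambda>x. T\<^sup>2 * (1 + x\<^sup>2) powr (- s))"
      by (rule integrable_mult_right[OF integrable_bracket[OF s]])
    have "(cmod (res \<sigma> k ?f x))\<^sup>2 \<le> T\<^sup>2 * (1 + x\<^sup>2) powr (- s)" for x
    proof -
      have "(?w x * cmod (res \<sigma> k ?f x))\<^sup>2 \<le> T\<^sup>2" by (rule power_mono[OF bound]) simp
      moreover have "(?w x)\<^sup>2 = (1 + x\<^sup>2) powr s"
        by (simp add: power2_eq_square[of "_ powr _"] powr_add[symmetric])
      ultimately have "(1 + x\<^sup>2) powr s * (cmod (res \<sigma> k ?f x))\<^sup>2 \<le> T\<^sup>2" by (simp add: power_mult_distrib)
      then show ?thesis using p[of x] by (simp add: powr_minus_divide field_simps)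
    qed
    then show "AE x in lborel. (cmod (res \<sigma> k ?f x))\<^sup>2 \<le> T\<^sup>2 * (1 + x\<^sup>2) powr (- s)" by simp
  qed
qed

lemma off_spectrum_gap:
  assumes "Im k \<noteq> 0 \<or> Re k < 0"
  shows "\<exists>d>0. \<forall>\<xi>\<ge>0. d \<le> cmod (of_real \<xi> - k)"
proof (cases "Im k = 0")
  case False
  show ?thesis
  proof (intro exI[of _ "\<bar>Im k\<bar>"] conjI allI impI)
    fix \<xi> :: real
    show "\<bar>Im k\<bar> \<le> cmod (of_real \<xi> - k)" using abs_Im_le_cmod[of "of_real \<xi> - k"] by simp
  qed (use False in simp)
next
  case True
  with assms have r: "Re k < 0" by simp
  show ?thesis
  proof (intro exI[of _ "- Re k"] conjI allI impI)
    fix \<xi> :: real assume "0 \<le> \<xi>"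
    then show "- Re k \<le> cmod (of_real \<xi> - k)" using r abs_Re_le_cmod[of "of_real \<xi> - k"] by simp
  qed (use r in simp)
qed

lemma AA_injective:
  assumes not_pp: "Im k = 0 \<Longrightarrow> k \<notin> sigma_pp u" and h: "AA h = h"
  shows "h = 0"
proof -
  let ?f = "mulu h"
  define \<phi> where "\<phi> = res \<sigma> k ?f"
  have hh: "hardy h" using hardy_szego[of "KK h"] h by (simp add: AA_def)
  note hf = hardy_mulu[OF hh]
  have \<phi>L2: "\<phi> \<in> L2"
  proof (cases "Im k = 0")
    case True then show ?thesis unfolding \<phi>_def by (rule res_mulu_L2_of_flux[OF _ h])
  next
    case False
    then obtain d where "d > 0" "\<And>\<xi>. 0 \<le> \<xi> \<Longrightarrow> d \<le> cmod (of_real \<xi> - k)" using off_spectrum_gap by blast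
    then show ?thesis unfolding \<phi>_def by (intro res_L2_off_spectrum[OF mulu_integrable mulu_L2 hf])
  qed
  have ode: "weak_ode k \<phi> ?f" unfolding \<phi>_def by (rule res_weak_ode[OF mulu_integrable])
  note eq = weak_ode_FT[OF \<phi>L2 mulu_L2 ode]
  have \<phi>H: "\<phi> \<in> hardy_sobolev 1" by (rule hardy_sobolev_of_FT[OF \<phi>L2 mulu_L2 hf eq])
  have \<phi>0: "AE x in lborel. \<phi> x = 0"
  proof (cases "Im k = 0")
    case True
    have [measurable]: "\<phi> \<in> borel_measurable borel" using \<phi>L2 by (rule L2_measurable)
    let ?q = "\<lambda>y. cnj (u y) * \<phi> y"
    have q: "?q \<in> L2" using res_mult_cnj_L2[OF mulu_integrable, of h] by (simp add: \<phi>_def mult.commute)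
    \<comment> \<open>The fixed point equation identifies h with \<Pi>(cnj u \<phi>), which makes
      the differential equation for \<phi> the eigenvalue equation.\<close>
    have "l2_cls (szego ?q) = h"
      unfolding szego_cls(2)[OF q] using h by (simp add: AA_def KK_def \<phi>_def mult.commute)
    then have sz: "AE x in lborel. l2_fun h x = szego ?q x"
      using l2_fun_cls[OF szego_cls(1)[OF q]] by simp
    have i: "integrable lborel (\<lambda>x. u x * szego ?q x)" by (rule L2_mult_integrable[OF u_L2 szego_cls(1)[OF q]])
    have "weak_ode k \<phi> (\<lambda>x. 0 + u x * szego ?q x)"
    proof (rule weak_ode_cong_AE[OF ode])
      show "AE x in lborel. ?f x = 0 + u x * szego ?q x"
        using sz by eventually_elim (simp add: mulu_def)
    qed (use szego_cls(1)[OF q] in measurable)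
    then have "distr_eq (lax u \<phi>) (distr_of (\<lambda>x. k * \<phi> x + 0))"
      by (subst lax_weak_ode) (auto intro: loc_integrable_L2 \<phi>L2 loc_integrable_L1[OF i])
    then show ?thesis
      using not_pp[OF True] \<phi>H unfolding sigma_pp_def by auto
  next
    case False
    let ?P = "l2_FT (l2_cls \<phi>)" and ?F = "l2_FT (l2_cls ?f)"
    have "l2_pair ?F (l2_cnj ?P) = of_real (2 * pi) * (LINT x|lborel. ?f x * cnj (\<phi> x))"
      unfolding Plancherel l2_cnj_cls[OF \<phi>L2] l2_pair_cls[OF mulu_L2 L2_cnj[OF \<phi>L2]] ..
    then have Im0: "Im (l2_pair ?F (l2_cnj ?P)) = 0"
      using flux_real[OF h] by (simp add: \<phi>_def complex_is_Real_iff)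
    have "l2_pair (l2_cls (l2_fun ?F)) (l2_cnj ?P) = (LINT \<xi>|lborel. l2_fun ?F \<xi> * cnj (l2_fun ?P \<xi>))"
      unfolding l2_cnj_def by (rule l2_pair_cls[OF l2_fun_L2 L2_cnj[OF l2_fun_L2]])
    then have "Im (l2_pair ?F (l2_cnj ?P)) = (LINT \<xi>|lborel. Im (l2_fun ?F \<xi> * cnj (l2_fun ?P \<xi>)))"
      by (simp only: l2_cls_fun integral_Im[OF l2_pair_integrable(2)])
    \<comment> \<open>On the Fourier side the pairing is the integral of (\<xi> - cnj k)-type terms
      reduced by the equation F = (\<xi> - k) P to (\<xi> - k) |P|^2, whose imaginary part only sees
      k.\<close>
    also have "\<dots> = (LINT \<xi>|lborel. - Im k * (cmod (l2_fun ?P \<xi>))\<^sup>2)"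
    proof (rule integral_cong_AE)
      show "AE \<xi> in lborel. Im (l2_fun ?F \<xi> * cnj (l2_fun ?P \<xi>)) = - Im k * (cmod (l2_fun ?P \<xi>))\<^sup>2"
        using eq
      proof eventually_elim
        case (elim \<xi>)
        have "l2_fun ?F \<xi> * cnj (l2_fun ?P \<xi>) = (of_real \<xi> - k) * of_real ((cmod (l2_fun ?P \<xi>))\<^sup>2)"
          unfolding elim[symmetric] complex_norm_square by (simp only: mult.assoc)
        then show ?case by (simp del: of_real_power)
      qed
    qed measurable
    also have "\<dots> = - Im k * (norm ?P)\<^sup>2" by (simp add: norm_l2_square)
    finally have "?P = 0" using Im0 False by simp
    then have "(norm (l2_cls \<phi>))\<^sup>2 = 0" using norm_l2_FT[of "l2_cls \<phi>"] by simp
    then have "l2_cls \<phi> = l2_cls (\<lambda>_. 0)" by (simp add: zero_l2_def)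
    then show ?thesis by (rule l2_cls_eqD[OF _ \<phi>L2 L2_zero])
  qed
  \<comment> \<open>The conclusion is drawn from h = \<Pi>(cnj u \<phi>) and \<phi> = 0, so no
    division by u occurs.\<close>
  have "KK h = 0"
    unfolding KK_def zero_l2_def
  proof (rule l2_cls_eq[OF res_mult_cnj_L2[OF mulu_integrable] L2_zero])
    show "AE x in lborel. res \<sigma> k ?f x * cnj (u x) = 0"
      using \<phi>0 unfolding \<phi>_def by eventually_elim simp
  qed
  then have "AA h = 0"
    unfolding AA_def by (simp add: linear_0[OF bounded_linear.linear[OF bounded_linear_l2_szego]])
  then show ?thesis using h by simp
qed

section \<open>From the fixed point equation to solutions of the Lax equation\<close>

definition lax_solution :: "(real \<Rightarrow> complex) \<Rightarrow> bool" where
  "lax_solution \<phi> \<longleftrightarrow> \<phi> \<in> Linf_weighted (- s) \<and> distr_eq (lax u \<phi>) (distr_of (\<lambda>x. k * \<phi> x + u x))"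

lemma u_mulu_integrable: "integrable lborel (\<lambda>y. u y + mulu h y)"
  by (rule Bochner_Integration.integrable_add[OF u_integrable mulu_integrable])

text \<open>The link between \<phi> and h, used in both directions: for a given solution it shows
  that h satisfies the fixed point equation, and for a given fixed point it shows that h is the
  projection of cnj u \<phi>.\<close>

lemma szego_cls_res:
  assumes "\<phi> \<in> borel_measurable borel" "AE x in lborel. \<phi> x = res \<sigma> k (\<lambda>y. u y + mulu h y) x"
  shows "l2_szego (l2_cls (\<lambda>x. cnj (u x) * \<phi> x)) = l2_szego (l2_cls (\<lambda>x. res \<sigma> k u x * cnj (u x))) + AA h"
proof -
  note L = res_mult_cnj_L2[OF u_integrable] res_mult_cnj_L2[OF mulu_integrable, of h]
  have eq: "AE x in lborel. res \<sigma> k u x * cnj (u x) + res \<sigma> k (mulu h) x * cnj (u x) = cnj (u x) * \<phi> x"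
    using assms(2) by eventually_elim (simp add: res_add[OF u_integrable mulu_integrable] algebra_simps)
  have "(\<lambda>x. cnj (u x) * \<phi> x) \<in> L2"
    by (rule L2_cong_AE[OF L2_add[OF L] _ eq]) (use assms(1) in measurable)
  then have "l2_cls (\<lambda>x. cnj (u x) * \<phi> x) = l2_cls (\<lambda>x. res \<sigma> k u x * cnj (u x) + res \<sigma> k (mulu h) x * cnj (u x))"
    by (intro l2_cls_eq[OF L2_add[OF L] _ eq, symmetric])
  then show ?thesis
    unfolding l2_cls_add[OF L] AA_def KK_def
    by (simp add: linear_add[OF bounded_linear.linear[OF bounded_linear_l2_szego]])
qed

text \<open>The side condition kills the homogeneous solution exp(i k x). Its first alternative
  serves the H^1 solutions of part (1), its second the one-sided limits of part (2).\<close>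

lemma lax_solution_representation:
  assumes sol: "lax_solution \<phi>" and side: "\<phi> \<in> L2 \<or> vanish \<sigma> \<phi>"
    and h: "h = l2_szego (l2_cls (\<lambda>x. cnj (u x) * \<phi> x))"
  shows "AE x in lborel. \<phi> x = res \<sigma> k (\<lambda>y. u y + mulu h y) x"
    "h = l2_szego (l2_cls (\<lambda>x. res \<sigma> k u x * cnj (u x))) + AA h"
proof -
  have \<phi>: "\<phi> \<in> Linf_weighted (- s)" and eq: "distr_eq (lax u \<phi>) (distr_of (\<lambda>x. k * \<phi> x + u x))"
    using sol by (auto simp: lax_solution_def)
  have m: "\<phi> \<in> borel_measurable borel" using \<phi> by (simp add: Linf_weighted_def)
  let ?q = "\<lambda>y. cnj (u y) * \<phi> y"
  have q: "?q \<in> L2" by (rule cnj_u_mult_L2[OF \<phi>])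
  have sz: "AE x in lborel. szego ?q x = l2_fun h x"
    using l2_fun_cls[OF szego_cls(1)[OF q]] unfolding h szego_cls(2)[OF q] by eventually_elim simp
  have i: "integrable lborel (\<lambda>x. u x * szego ?q x)" by (rule L2_mult_integrable[OF u_L2 szego_cls(1)[OF q]])
  note loc = Linf_weighted_loc_integrable[OF \<phi> s_nonneg]
  have "weak_ode k \<phi> (\<lambda>x. u x + u x * szego ?q x)"
    using eq by (subst (asm) lax_weak_ode[OF loc loc_integrable_L2[OF u_L2] loc_integrable_L1[OF i]])
  then have ode: "weak_ode k \<phi> (\<lambda>y. u y + mulu h y)"
  proof (rule weak_ode_cong_AE[OF _ m])
    show "AE x in lborel. u x + u x * szego ?q x = u x + mulu h x"
      using sz by eventually_elim (simp add: mulu_def)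
  qed (use szego_cls(1)[OF q] in measurable)
  note f = u_mulu_integrable[of h]
  obtain c where c: "AE x in lborel. \<phi> x - res \<sigma> k (\<lambda>y. u y + mulu h y) x = c * exp (\<i> * k * of_real x)"
    using weak_ode_unique[OF loc res_loc_integrable[OF f] loc_integrable_L1[OF f] ode res_weak_ode[OF f]] by blast
  have "c = 0" by (rule vanishing_solution_zero[OF \<sigma> k c res_vanish[OF f] side])
  with c show 1: "AE x in lborel. \<phi> x = res \<sigma> k (\<lambda>y. u y + mulu h y) x" by simp
  show "h = l2_szego (l2_cls (\<lambda>x. res \<sigma> k u x * cnj (u x))) + AA h"
    using szego_cls_res[OF m 1] unfolding h .
qed

text \<open>The difference of the two associated h is a fixed point of A, hence 0, and h determines
  the solution through the resolvent.\<close>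

lemma lax_solution_unique:
  assumes not_pp: "Im k = 0 \<Longrightarrow> k \<notin> sigma_pp u"
    and 1: "lax_solution \<phi>\<^sub>1" "\<phi>\<^sub>1 \<in> L2 \<or> vanish \<sigma> \<phi>\<^sub>1"
    and 2: "lax_solution \<phi>\<^sub>2" "\<phi>\<^sub>2 \<in> L2 \<or> vanish \<sigma> \<phi>\<^sub>2"
  shows "AE x in lborel. \<phi>\<^sub>1 x = \<phi>\<^sub>2 x"
proof -
  define h\<^sub>1 where "h\<^sub>1 = l2_szego (l2_cls (\<lambda>x. cnj (u x) * \<phi>\<^sub>1 x))"
  define h\<^sub>2 where "h\<^sub>2 = l2_szego (l2_cls (\<lambda>x. cnj (u x) * \<phi>\<^sub>2 x))"
  note r1 = lax_solution_representation[OF 1 h\<^sub>1_def] and r2 = lax_solution_representation[OF 2 h\<^sub>2_def]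
  have "h\<^sub>1 - h\<^sub>2 = AA h\<^sub>1 - AA h\<^sub>2"
    using r1(2) r2(2) by (metis add_diff_cancel_left)
  also have "\<dots> = AA (h\<^sub>1 - h\<^sub>2)" by (rule linear_diff[OF linear_AA, symmetric])
  finally have "h\<^sub>1 - h\<^sub>2 = 0" by (intro AA_injective[OF not_pp]) auto
  then have "h\<^sub>1 = h\<^sub>2" by simp
  then show ?thesis using r1(1) r2(1) by auto
qed

text \<open>Injectivity yields h by the Fredholm alternative, and R(u + u h) is bounded, hence in
  the weighted space. Away from [0, infinity) the source u + u h, being in the Hardy space, even
  makes the solution an element of H^1_+.\<close>

lemma lax_solution_exists:
  assumes not_pp: "Im k = 0 \<Longrightarrow> k \<notin> sigma_pp u"
  shows "\<exists>\<phi>. lax_solution \<phi> \<and> vanish \<sigma> \<phi> \<and> (Im k \<noteq> 0 \<or> Re k < 0 \<longrightarrow> \<phi> \<in> hardy_sobolev 1)"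
proof -
  obtain h where h: "h - AA h = l2_szego (l2_cls (\<lambda>x. res \<sigma> k u x * cnj (u x)))"
    using AA_fredholm[OF AA_injective[OF not_pp]] by blast
  let ?f = "\<lambda>y. u y + mulu h y"
  define \<phi> where "\<phi> = res \<sigma> k ?f"
  note f = u_mulu_integrable[of h]
  have m: "\<phi> \<in> borel_measurable borel" unfolding \<phi>_def by (rule res_measurable) measurable
  have \<phi>: "\<phi> \<in> Linf_weighted (- s)"
    by (rule Linf_weightedI[OF m _ s_nonneg]) (unfold \<phi>_def, rule res_bound[OF f])
  let ?q = "\<lambda>y. cnj (u y) * \<phi> y"
  have q: "?q \<in> L2" by (rule cnj_u_mult_L2[OF \<phi>])
  have "l2_szego (l2_cls ?q) = h"
    using szego_cls_res[OF m, of h] h by (simp add: \<phi>_def algebra_simps)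
  then have sz: "AE x in lborel. l2_fun h x = szego ?q x"
    using l2_fun_cls[OF szego_cls(1)[OF q]] unfolding szego_cls(2)[OF q] by simp
  have i: "integrable lborel (\<lambda>x. u x * szego ?q x)" by (rule L2_mult_integrable[OF u_L2 szego_cls(1)[OF q]])
  have ode: "weak_ode k \<phi> ?f" unfolding \<phi>_def by (rule res_weak_ode[OF f])
  have "weak_ode k \<phi> (\<lambda>x. u x + u x * szego ?q x)"
  proof (rule weak_ode_cong_AE[OF ode m])
    show "AE x in lborel. u x + mulu h x = u x + u x * szego ?q x"
      using sz by eventually_elim (simp add: mulu_def)
  qed (use szego_cls(1)[OF q] in measurable)
  then have "distr_eq (lax u \<phi>) (distr_of (\<lambda>x. k * \<phi> x + u x))"
    by (subst lax_weak_ode[OF Linf_weighted_loc_integrable[OF \<phi> s_nonneg] loc_integrable_L2[OF u_L2] loc_integrable_L1[OF i]])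
  then have sol: "lax_solution \<phi>" using \<phi> by (simp add: lax_solution_def)
  have hs: "\<phi> \<in> hardy_sobolev 1" if off: "Im k \<noteq> 0 \<or> Re k < 0"
  proof -
    have "h = l2_szego (l2_cls ?q)" using \<open>l2_szego (l2_cls ?q) = h\<close> by simp
    then have hh: "hardy h" by (simp add: hardy_szego)
    have f2: "?f \<in> L2" by (rule L2_add[OF u_L2 mulu_L2])
    have hf: "hardy (l2_cls ?f)"
      unfolding l2_cls_add[OF u_L2 mulu_L2] by (rule hardy_add[OF u_hardy hardy_mulu[OF hh]])
    obtain d where "d > 0" "\<And>\<xi>. 0 \<le> \<xi> \<Longrightarrow> d \<le> cmod (of_real \<xi> - k)" using off_spectrum_gap[OF off] by blast
    then have \<phi>2: "\<phi> \<in> L2" unfolding \<phi>_def by (intro res_L2_off_spectrum[OF f f2 hf])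
    show ?thesis by (rule hardy_sobolev_of_FT[OF \<phi>2 f2 hf weak_ode_FT[OF \<phi>2 f2 ode]])
  qed
  have "vanish \<sigma> \<phi>" unfolding \<phi>_def by (rule res_vanish[OF f])
  then show ?thesis using sol hs by blast
qed

lemma ex1_AE_hardy_sobolev:
  assumes not_pp: "Im k = 0 \<Longrightarrow> k \<notin> sigma_pp u" and off: "Im k \<noteq> 0 \<or> Re k < 0"
  shows "ex1_AE (\<lambda>\<phi>. \<phi> \<in> hardy_sobolev 1 \<inter> Linf_weighted (- s) \<and>
    distr_eq (lax u \<phi>) (distr_of (\<lambda>x. k * \<phi> x + u x)))"
proof -
  obtain \<phi> where \<phi>: "lax_solution \<phi>" "\<phi> \<in> hardy_sobolev 1" using lax_solution_exists[OF not_pp] off by blast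
  show ?thesis
    unfolding ex1_AE_def
  proof (intro exI[of _ \<phi>] conjI allI impI)
    show "\<phi> \<in> hardy_sobolev 1 \<inter> Linf_weighted (- s)" "distr_eq (lax u \<phi>) (distr_of (\<lambda>x. k * \<phi> x + u x))"
      using \<phi> by (auto simp: lax_solution_def)
    fix g assume g: "g \<in> hardy_sobolev 1 \<inter> Linf_weighted (- s) \<and> distr_eq (lax u g) (distr_of (\<lambda>x. k * g x + u x))"
    show "AE x in lborel. g x = \<phi> x"
      by (rule lax_solution_unique[OF not_pp _ _ \<phi>(1)])
         (use g \<phi>(2) in \<open>auto simp: lax_solution_def hardy_sobolev_iff\<close>)
  qed
qed

lemma ex1_AE_vanish:
  assumes not_pp: "Im k = 0 \<Longrightarrow> k \<notin> sigma_pp u"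
  shows "ex1_AE (\<lambda>\<phi>. \<phi> \<in> Linf_weighted (- s) \<and>
    distr_eq (lax u \<phi>) (distr_of (\<lambda>x. k * \<phi> x + u x)) \<and> vanish \<sigma> \<phi>)"
proof -
  obtain \<phi> where \<phi>: "lax_solution \<phi>" "vanish \<sigma> \<phi>" using lax_solution_exists[OF not_pp] by blast
  show ?thesis
    unfolding ex1_AE_def
  proof (intro exI[of _ \<phi>] conjI allI impI)
    show "\<phi> \<in> Linf_weighted (- s)" "distr_eq (lax u \<phi>) (distr_of (\<lambda>x. k * \<phi> x + u x))" "vanish \<sigma> \<phi>"
      using \<phi> by (auto simp: lax_solution_def)
    fix g assume g: "g \<in> Linf_weighted (- s) \<and> distr_eq (lax u g) (distr_of (\<lambda>x. k * g x + u x)) \<and> vanish \<sigma> g"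
    show "AE x in lborel. g x = \<phi> x"
      by (rule lax_solution_unique[OF not_pp _ _ \<phi>(1)]) (use g \<phi>(2) in \<open>auto simp: lax_solution_def\<close>)
  qed
qed

end

theorem theorem1p1:
  fixes u :: "real \<Rightarrow> complex" and s :: real
  assumes "s > 1/2" and "u \<in> hardy_sobolev 1 \<inter> L2_weighted s"
  shows "(\<forall>k \<in> {k. Im k > 0} \<union> {k. Im k < 0} \<union> (complex_of_real ` {..<0} - sigma_pp u).
            ex1_AE (\<lambda>\<phi>. \<phi> \<in> hardy_sobolev 1 \<inter> Linf_weighted (-s) \<and>
              distr_eq (lax u \<phi>) (distr_of (\<lambda>x. k * \<phi> x + u x))))
       \<and> (\<forall>l::real. l > 0 \<and> complex_of_real l \<notin> sigma_pp u \<longrightarrow>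
            ex1_AE (\<lambda>\<phi>. \<phi> \<in> Linf_weighted (-s) \<and>
              distr_eq (lax u \<phi>) (distr_of (\<lambda>x. complex_of_real l * \<phi> x + u x)) \<and>
              (\<phi> \<longlongrightarrow> 0) at_bot) \<and>
            ex1_AE (\<lambda>\<phi>. \<phi> \<in> Linf_weighted (-s) \<and>
              distr_eq (lax u \<phi>) (distr_of (\<lambda>x. complex_of_real l * \<phi> x + u x)) \<and>
              (\<phi> \<longlongrightarrow> 0) at_top))"
proof (intro conjI ballI allI impI)
  fix k assume k: "k \<in> {k. Im k > 0} \<union> {k. Im k < 0} \<union> (complex_of_real ` {..<0} - sigma_pp u)"
  have not_pp: "Im k = 0 \<Longrightarrow> k \<notin> sigma_pp u" and off: "Im k \<noteq> 0 \<or> Re k < 0" using k by auto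
  \<comment> \<open>For Im k < 0 only integration from plus infinity has a bounded kernel; for
    negative real k either sign would satisfy the locale assumption.\<close>
  define \<sigma> :: real where "\<sigma> = (if Im k < 0 then -1 else 1)"
  interpret lax_resolvent \<sigma> k u s
    by unfold_locales (use assms in \<open>auto simp: \<sigma>_def\<close>)
  show "ex1_AE (\<lambda>\<phi>. \<phi> \<in> hardy_sobolev 1 \<inter> Linf_weighted (-s) \<and>
      distr_eq (lax u \<phi>) (distr_of (\<lambda>x. k * \<phi> x + u x)))"
    by (rule ex1_AE_hardy_sobolev[OF not_pp off])
next
  fix l :: real assume l: "l > 0 \<and> complex_of_real l \<notin> sigma_pp u"
  interpret lax_resolvent 1 "complex_of_real l" u s
    by unfold_locales (use assms in auto)
  show "ex1_AE (\<lambda>\<phi>. \<phi> \<in> Linf_weighted (-s) \<and>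
      distr_eq (lax u \<phi>) (distr_of (\<lambda>x. complex_of_real l * \<phi> x + u x)) \<and> (\<phi> \<longlongrightarrow> 0) at_bot)"
    using ex1_AE_vanish l unfolding vanish_at_bot by simp
next
  fix l :: real assume l: "l > 0 \<and> complex_of_real l \<notin> sigma_pp u"
  interpret lax_resolvent "-1" "complex_of_real l" u s
    by unfold_locales (use assms in auto)
  show "ex1_AE (\<lambda>\<phi>. \<phi> \<in> Linf_weighted (-s) \<and>
      distr_eq (lax u \<phi>) (distr_of (\<lambda>x. complex_of_real l * \<phi> x + u x)) \<and> (\<phi> \<longlongrightarrow> 0) at_top)"
    using ex1_AE_vanish l unfolding vanish_at_top by simp
qed

end
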